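(* Let $k$ be a positive integer and let $\alpha$ be a real number such that the powers $\alpha^2,\ldots,\alpha^{k-1}$ are all irrational. Then the sequence $\{(\alpha n)^{:k}\}$, for $n=1,2,\ldots$, is uniformly distributed in $[0,1)$ if and only if $\alpha^k$ is irrational.
   Context: For real $x$, $\lfloor x\rfloor$ is the greatest integer less than or equal to $x$, and $\{x\}=x-\lfloor x\rfloor$. For real $x$ define $x^{:0}=1$ and $x^{:j}=x\lfloor x^{:(j-1)}\rfloor$ for $j>0$; thus $(\alpha n)^{:k}=\alpha n\lfloor\alpha n\lfloor\cdots\lfloor\alpha n\rfloor\cdots\rfloor\rfloor$ with $k$ factors $\alpha n$. The condition on the powers of $\alpha$ is vacuous when $k\le 2$. "Uniformly distributed" means equidistributed with respect to Lebesgue measure. *)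

theory Defs
  imports "HOL-Analysis.Analysis"
begin

text \<open>The bracket power, written \<open>x\<^sup>:\<^sup>j\<close> informally:
  \<open>floor_pow x j = x\<lfloor>x\<lfloor>\<cdots>\<lfloor>x\<rfloor>\<cdots>\<rfloor>\<rfloor>\<close> with \<open>j\<close> factors \<open>x\<close>;
  the outermost product is not rounded.\<close>

primrec floor_pow :: "real \<Rightarrow> nat \<Rightarrow> real" where
  "floor_pow x 0 = 1"
| "floor_pow x (Suc j) = x * of_int \<lfloor>floor_pow x j\<rfloor>"

text \<open>Equidistribution in \<open>[0,1)\<close> with respect to Lebesgue measure of the sequence
  \<open>s 1, s 2, \<dots>\<close>; the value \<open>s 0\<close> is not part of the sequence.\<close>

definition uniformly_distributed :: "(nat \<Rightarrow> real) \<Rightarrow> bool" where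
  "uniformly_distributed s \<longleftrightarrow>
     (\<forall>n\<ge>1. s n \<in> {0..<1}) \<and>
     (\<forall>a b. 0 \<le> a \<and> a < b \<and> b \<le> 1 \<longrightarrow>
        (\<lambda>N. real (card {n \<in> {1..N}. s n \<in> {a..<b}}) / real N) \<longlonglongrightarrow> b - a)"

end

theory Submission
  imports Defs
begin

text \<open>
  Fix \<open>n\<close>, put \<open>x = \<alpha> n\<close>, and let \<open>m\<^sub>j\<close> and \<open>f\<^sub>j\<close> be the integer and fractional parts of the \<open>j\<close>-th
  bracket power of \<open>x\<close>. The recursion \<open>m\<^sub>j + f\<^sub>j = x m\<^sub>j\<^sub>-\<^sub>1\<close> says that \<open>(1 - x t) M = 1 - F\<close> for the
  generating series \<open>M = \<Sum> m\<^sub>j t^j\<close> (with \<open>m\<^sub>0 = 1\<close>) and \<open>F = \<Sum> f\<^sub>j t^j\<close> (over \<open>j \<ge> 1\<close>). Comparing logarithmic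
  derivatives gives \<open>x^k = N\<^sub>k + k f\<^sub>k + P\<^sub>k(f\<^sub>1, \<dots>, f\<^sub>k\<^sub>-\<^sub>1)\<close>, where \<open>N\<^sub>k\<close> is an integer, polynomial in the
  \<open>m\<^sub>j\<close>, and \<open>P\<^sub>k\<close> is a polynomial with nonnegative integer coefficients (\<open>power_decomposition\<close>). Solved for
  the bracket power this is \<open>floor_pow_formula\<close>: up to a polynomial in the lower \<open>m\<^sub>j\<close> and the lower \<open>f\<^sub>j\<close>,
  the \<open>k\<close>-th bracket power is \<open>x^k / k\<close>.

  \<^bold>\<open>Irrational case.\<close> Write \<open>e(y) = exp(2 \<pi> \<i> y)\<close>. By induction on \<open>k\<close>, for rational \<open>r\<close> the character \<open>e\<close> of
  \<open>r\<close> times the \<open>k\<close>-th bracket power is \<open>e((r/k) \<alpha>^k n^k)\<close> times a sequence which is a limit in mean of trigonometric polynomials whose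
  phases are polynomials in \<open>n\<close> of degree below \<open>k\<close> (\<open>bracket_char_all\<close>). Weyl's theorem on polynomials with an irrational
  leading coefficient kills the mean of such a product when \<open>\<alpha>^k\<close> is irrational, and Weyl's criterion applies.

  \<^bold>\<open>Rational case.\<close> The same argument shows that \<open>(f\<^sub>1, \<dots>, f\<^sub>k\<^sub>-\<^sub>1)\<close> is equidistributed in the unit cube
  (\<open>joint_moments\<close>). If \<open>\<alpha>^k\<close> has denominator \<open>q\<close>, the identity yields \<open>q k f\<^sub>k = - q P\<^sub>k(f)\<close> modulo one, so
  it has to be shown that \<open>q P\<^sub>k\<close> of a uniform random point of the cube is not uniform modulo one. What gives it away is that
  its density is more singular at the level \<open>0\<close> than at every other integer level.
  Since \<open>P\<^sub>k\<close> is homogeneous of weight \<open>k\<close> when \<open>f\<^sub>j\<close> has weight \<open>j\<close>, the set \<open>P\<^sub>k < \<epsilon>\<close>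
  has volume at least a constant times \<open>\<epsilon>\<close> to the power \<open>(k-1)/2\<close> (\<open>origin_integral_bound\<close>). On the other
  hand \<open>P\<^sub>k\<close> is affine in the coordinates \<open>f\<^sub>j\<close> with \<open>j > k/2\<close>, with slopes at least \<open>f\<^sub>k\<^sub>-\<^sub>j\<close>
  (\<open>cyc_poly_affine\<close>). A test function of width \<open>\<epsilon>\<close> that is the \<open>r\<close>-th derivative of a bump, where \<open>r\<close> is the
  number of these coordinates, can therefore be integrated \<open>r\<close> times, and each integration gains a factor
  \<open>\<epsilon> / f\<^sub>k\<^sub>-\<^sub>j\<close> (\<open>high_integral_bound\<close>). At a nonzero level one of the remaining coordinates is moreover confined to
  an interval of length of order \<open>\<epsilon>\<close>. So nonzero levels contribute only about \<open>\<epsilon>\<close> to the power \<open>1 + r\<close>,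
  up to an arbitrarily small loss in the exponent (\<open>window_integral_bound\<close>), and \<open>1 + r \<ge> k/2\<close>. The test function has
  mean zero, so uniformity would force the two kinds of contributions to cancel, which is impossible for small \<open>\<epsilon>\<close>.

  If \<open>\<alpha>\<close> itself is rational, all terms of the sequence have a common denominator.
\<close>

section \<open>Exponential means of real polynomials\<close>

text \<open>The character \<open>e(x) = exp(2 \<pi> \<i> x)\<close> of the reals modulo one.\<close>

definition ee :: "real \<Rightarrow> complex" where "ee x = cis (2 * pi * x)"

lemma norm_ee [simp]: "norm (ee x) = 1"
  by (simp add: ee_def)

lemma ee_add: "ee (x + y) = ee x * ee y"
  by (simp add: ee_def cis_mult distrib_left)

lemma ee_0 [simp]: "ee 0 = 1"
  by (simp add: ee_def)

lemma ee_minus: "ee (- x) = cnj (ee x)"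
  by (simp add: ee_def cis_cnj)

lemma ee_of_int [simp]: "ee (of_int n) = 1"
  by (metis cis_multiple_2pi ee_def Ints_of_int mult.commute)

lemma ee_add_int: "ee (x + of_int n) = ee x"
  by (simp add: ee_add)

lemma ee_frac: "ee (frac x) = ee x"
  using ee_add_int[of "frac x" "\<lfloor>x\<rfloor>"] by (simp add: frac_def)

lemma ee_eq_1_iff: "ee x = 1 \<longleftrightarrow> x \<in> \<int>"
proof
  assume "ee x = 1"
  then have "cos (2 * pi * x) = 1" by (simp add: ee_def complex_eq_iff)
  then obtain n :: int where "2 * pi * x = of_int n * 2 * pi"
    using cos_one_2pi_int by auto
  then have "x = of_int n" by simp
  then show "x \<in> \<int>" by simp
next
  assume "x \<in> \<int>"
  then show "ee x = 1" by (auto elim: Ints_cases)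
qed

definition has_mean :: "(nat \<Rightarrow> complex) \<Rightarrow> complex \<Rightarrow> bool" where
  "has_mean g c \<longleftrightarrow> (\<lambda>N. (\<Sum>n=1..N. g n) / of_nat N) \<longlonglongrightarrow> c"

lemma has_mean_const: "has_mean (\<lambda>n. c) c"
proof -
  have "\<forall>\<^sub>F N in sequentially. (\<Sum>n=1..N. c) / of_nat N = c"
    using eventually_gt_at_top[of 0] by eventually_elim simp
  then show ?thesis unfolding has_mean_def by (rule tendsto_eventually)
qed

lemma has_mean_add: "has_mean f a \<Longrightarrow> has_mean g b \<Longrightarrow> has_mean (\<lambda>n. f n + g n) (a + b)"
  unfolding has_mean_def by (simp add: sum.distrib add_divide_distrib tendsto_add)

lemma has_mean_cmult: "has_mean f a \<Longrightarrow> has_mean (\<lambda>n. c * f n) (c * a)"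
  unfolding has_mean_def by (simp add: sum_distrib_left[symmetric] tendsto_mult_left
      times_divide_eq_right[symmetric] del: times_divide_eq_right)

lemma has_mean_sum:
  "finite A \<Longrightarrow> (\<And>x. x \<in> A \<Longrightarrow> has_mean (f x) (a x)) \<Longrightarrow> has_mean (\<lambda>n. \<Sum>x\<in>A. f x n) (\<Sum>x\<in>A. a x)"
proof (induction A rule: finite_induct)
  case empty
  then show ?case using has_mean_const[of 0] by simp
qed (simp add: has_mean_add)

lemma has_mean_unique: "has_mean g a \<Longrightarrow> has_mean g b \<Longrightarrow> a = b"
  unfolding has_mean_def by (rule LIMSEQ_unique)

lemma has_mean_cnj: "has_mean g a \<Longrightarrow> has_mean (\<lambda>n. cnj (g n)) (cnj a)"
  unfolding has_mean_def using tendsto_cnj by fastforce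

lemma shift_mean_diff:
  assumes "\<And>n. norm (u n) \<le> B"
  shows "(\<lambda>N. (\<Sum>n=1..N. u (n + h) - u n) / of_nat N) \<longlonglongrightarrow> (0::complex)"
proof -
  have B: "B \<ge> 0" using assms[of 0] norm_ge_zero order_trans by blast
  have bd: "norm (\<Sum>n=1..N. u (n + h) - u n) \<le> 2 * real h * B" for N
  proof (induction h)
    case 0
    then show ?case by simp
  next
    case (Suc h)
    have "(\<Sum>n=1..N. u (n + Suc h) - u n)
        = (\<Sum>n=1..N. u (n + Suc h) - u (n + h)) + (\<Sum>n=1..N. u (n + h) - u n)"
      by (simp add: sum.distrib[symmetric])
    also have "(\<Sum>n=1..N. u (n + Suc h) - u (n + h)) = u (Suc N + h) - u (1 + h)"
      using sum_Suc_diff[of 1 N "\<lambda>n. u (n + h)"] by simp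
    also have "norm ((u (Suc N + h) - u (1 + h)) + (\<Sum>n=1..N. u (n + h) - u n))
       \<le> (B + B) + 2 * real h * B"
      by (intro norm_triangle_mono Suc order_trans[OF norm_triangle_ineq4] add_mono assms)
    finally show ?case by (simp add: algebra_simps)
  qed
  show ?thesis
  proof (rule Lim_null_comparison)
    show "\<forall>\<^sub>F N in sequentially. norm ((\<Sum>n=1..N. u (n + h) - u n) / of_nat N) \<le> (2 * real h * B) / real N"
      using bd by (intro always_eventually) (auto simp: norm_divide intro!: divide_right_mono)
    show "(\<lambda>N. (2 * real h * B) / real N) \<longlonglongrightarrow> 0"
      by (rule lim_const_over_n)
  qed
qed

lemma has_mean_shift:
  assumes "\<And>n. norm (u n) \<le> B" "has_mean u c"
  shows "has_mean (\<lambda>n. u (n + h)) c"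
  using tendsto_add[OF shift_mean_diff[of u B h, OF assms(1)] assms(2)[unfolded has_mean_def]]
  unfolding has_mean_def by (simp add: sum_subtractf add_divide_distrib[symmetric])

text \<open>Averaging \<open>u\<close> over a window of length \<open>H\<close> does not change its mean. By
  Cauchy-Schwarz the square of the mean of the averaged sequence is at most the mean of its squared modulus;
  expanding that, only the \<open>H\<close> diagonal correlations survive, which leaves \<open>1/H\<close>.\<close>

lemma van_der_Corput:
  fixes u :: "nat \<Rightarrow> complex"
  assumes u1: "\<And>n. norm (u n) = 1"
    and corr: "\<And>h. h \<ge> 1 \<Longrightarrow> has_mean (\<lambda>n. u (n + h) * cnj (u n)) 0"
  shows "has_mean u 0"
  unfolding has_mean_def
proof (rule tendstoI)
  fix e :: real assume e: "e > 0"
  obtain H :: nat where H: "H \<ge> 1" "1 / real H < (e/2)\<^sup>2"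
  proof -
    obtain n :: nat where "n \<noteq> 0" "inverse (real n) < (e/2)\<^sup>2"
      using real_arch_inverse[of "(e/2)\<^sup>2"] e by auto
    then show ?thesis using that[of n] by (simp add: inverse_eq_divide)
  qed
  define V where "V n = (\<Sum>h<H. u (n + h)) / of_nat H" for n
  have pair: "has_mean (\<lambda>n. u (n + h) * cnj (u (n + h'))) (if h = h' then 1 else 0)" for h h'
  proof -
    have *: "has_mean (\<lambda>n. u (n + h) * cnj (u (n + h'))) 0" if "h' < h" for h h'
    proof -
      have "has_mean (\<lambda>n. u ((n + h') + (h - h')) * cnj (u (n + h'))) 0"
        using that has_mean_shift[OF _ corr[of "h - h'"], of 1 "h'"] by (simp add: norm_mult u1)
      then show ?thesis using that by simp
    qed
    consider "h = h'" | "h' < h" | "h < h'" by linarith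
    then show ?thesis
    proof cases
      case 1
      have "u n * cnj (u n) = 1" for n
        using u1[of n] by (simp add: complex_norm_square[symmetric])
      then show ?thesis using 1 has_mean_const[of 1] by simp
    next
      case 2
      then show ?thesis using *[of h' h] by simp
    next
      case 3
      then show ?thesis using has_mean_cnj[OF *[of h h']] by (simp add: mult.commute)
    qed
  qed
  have V2: "has_mean (\<lambda>n. of_real ((norm (V n))\<^sup>2)) (1 / of_nat H)"
  proof -
    have "has_mean (\<lambda>n. (1 / of_nat H)\<^sup>2 * (\<Sum>h<H. \<Sum>h'<H. u (n + h) * cnj (u (n + h'))))
       ((1 / of_nat H)\<^sup>2 * (\<Sum>h<H. \<Sum>h'<H. if h = h' then 1 else 0))"
      by (intro has_mean_cmult has_mean_sum pair) auto
    moreover have "(1 / of_nat H)\<^sup>2 * (\<Sum>h<H. \<Sum>h'<H. if h = h' then 1 else 0) = (1 / of_nat H :: complex)"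
      using H by (simp add: power2_eq_square)
    moreover have "(1 / of_nat H)\<^sup>2 * (\<Sum>h<H. \<Sum>h'<H. u (n + h) * cnj (u (n + h'))) = of_real ((norm (V n))\<^sup>2)" for n
      by (simp only: complex_norm_square V_def)
        (simp add: sum_product power2_eq_square)
    ultimately show ?thesis by simp
  qed
  have V2': "(\<lambda>N. (\<Sum>n=1..N. (norm (V n))\<^sup>2) / real N) \<longlonglongrightarrow> 1 / real H"
    using tendsto_Re[OF V2[unfolded has_mean_def]] by simp
  \<comment> \<open>The means of \<open>(norm (V n))\<^sup>2\<close> tend to \<open>1 / H\<close>, below \<open>(e/2)\<^sup>2\<close>; those of \<open>V\<close> and \<open>u\<close> differ by \<open>o(1)\<close>.\<close>
  have ev1: "\<forall>\<^sub>F N in sequentially. (\<Sum>n=1..N. (norm (V n))\<^sup>2) / real N < (e/2)\<^sup>2"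
    using order_tendstoD(2)[OF V2' H(2)] .
  have dif: "(\<lambda>N. (\<Sum>h<H. (\<Sum>n=1..N. u (n + h) - u n) / of_nat N) / of_nat H) \<longlonglongrightarrow> (\<Sum>h<H. 0) / of_nat H"
    by (intro tendsto_intros tendsto_sum shift_mean_diff[of _ 1]) (use u1 H in auto)
  have dif': "(\<Sum>h<H. (\<Sum>n=1..N. u (n + h) - u n) / of_nat N) / of_nat H
      = (\<Sum>n=1..N. V n) / of_nat N - (\<Sum>n=1..N. u n) / of_nat N" for N
  proof -
    have "(\<Sum>h<H. (\<Sum>n=1..N. u (n + h) - u n) / of_nat N)
       = ((\<Sum>h<H. \<Sum>n=1..N. u (n + h)) - of_nat H * (\<Sum>n=1..N. u n)) / of_nat N"
      by (simp add: sum_subtractf diff_divide_distrib sum_divide_distrib[symmetric])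
    also have "(\<Sum>h<H. \<Sum>n=1..N. u (n + h)) = of_nat H * (\<Sum>n=1..N. V n)"
      using H by (subst sum.swap) (simp add: V_def sum_divide_distrib[symmetric])
    finally show ?thesis using H by (simp add: right_diff_distrib[symmetric] diff_divide_distrib)
  qed
  have ev2: "\<forall>\<^sub>F N in sequentially. norm ((\<Sum>n=1..N. V n) / of_nat N - (\<Sum>n=1..N. u n) / of_nat N) < e/2"
    using tendstoD[OF dif[unfolded dif'], of "e/2"] e by (simp only: dist_norm) simp
  show "\<forall>\<^sub>F N in sequentially. dist ((\<Sum>n=1..N. u n) / of_nat N) 0 < e"
    using ev1 ev2 eventually_gt_at_top[of 0]
  proof eventually_elim
    case (elim N)
    have "(norm (\<Sum>n=1..N. V n))\<^sup>2 \<le> (\<Sum>n=1..N. norm (V n) * 1)\<^sup>2"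
      by (intro power_mono) (auto intro: sum_norm_le)
    also have "\<dots> \<le> (\<Sum>n=1..N. (norm (V n))\<^sup>2) * (\<Sum>n=1..N. 1\<^sup>2)"
      by (rule Cauchy_Schwarz_ineq_sum)
    finally have "(norm (\<Sum>n=1..N. V n) / real N)\<^sup>2 \<le> (\<Sum>n=1..N. (norm (V n))\<^sup>2) / real N"
      using elim by (simp add: power_divide field_simps power2_eq_square)
    also have "\<dots> < (e/2)\<^sup>2" by (rule elim)
    finally have "norm (\<Sum>n=1..N. V n) / real N < e/2"
      by (rule power2_less_imp_less) (use e in simp)
    then have "norm ((\<Sum>n=1..N. V n) / of_nat N) < e/2"
      by (simp add: norm_divide)
    moreover have "norm (b - (b - a)) \<le> norm b + norm (b - a)" for a b :: complex
      by (rule norm_triangle_ineq4)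
    from this[of "(\<Sum>n=1..N. V n) / of_nat N" "(\<Sum>n=1..N. u n) / of_nat N"]
    have "norm ((\<Sum>n=1..N. u n) / of_nat N) \<le> norm ((\<Sum>n=1..N. V n) / of_nat N)
        + norm ((\<Sum>n=1..N. V n) / of_nat N - (\<Sum>n=1..N. u n) / of_nat N)"
      by simp
    ultimately have "norm ((\<Sum>n=1..N. u n) / of_nat N) < e"
      using elim(2) by linarith
    then show ?case by simp
  qed
qed

lemma has_mean_linear:
  assumes "c \<notin> \<rat>"
  shows "has_mean (\<lambda>n. ee (c * real n + b)) 0"
proof -
  define z where "z = ee c"
  have z1: "z \<noteq> 1" using assms Ints_subset_Rats by (auto simp: z_def ee_eq_1_iff)
  have zn: "ee (c * real n + b) = ee b * z ^ n" for n
  proof -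
    have "ee (c * real n) = z ^ n"
      by (induction n) (simp_all add: z_def ee_add distrib_left mult.commute)
    then show ?thesis by (simp add: ee_add mult.commute)
  qed
  have "norm (\<Sum>n=1..N. z ^ n) \<le> 2 / norm (1 - z)" for N
  proof (cases "N \<ge> 1")
    case True
    have "(1 - z) * (\<Sum>n=1..N. z ^ n) = z ^ 1 - z ^ Suc N"
      using sum_gp_multiplied[of 1 N z] True by simp
    then have "norm (1 - z) * norm (\<Sum>n=1..N. z ^ n) \<le> 2"
      by (metis norm_mult norm_triangle_ineq4 norm_power power_one one_add_one norm_ee z_def)
    then show ?thesis using z1 by (simp add: field_simps)
  qed simp
  then have bd: "norm (\<Sum>n=1..N. ee (c * real n + b)) \<le> 2 / norm (1 - z)" for N
    by (simp add: zn sum_distrib_left[symmetric] norm_mult)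
  show ?thesis unfolding has_mean_def
  proof (rule Lim_null_comparison)
    show "\<forall>\<^sub>F N in sequentially. norm ((\<Sum>n=1..N. ee (c * real n + b)) / of_nat N) \<le> (2 / norm (1 - z)) / real N"
      using bd by (intro always_eventually) (auto simp: norm_divide simp del: divide_divide_eq_left intro!: divide_right_mono)
    show "(\<lambda>N. (2 / norm (1 - z)) / real N) \<longlonglongrightarrow> 0"
      by (rule lim_const_over_n)
  qed
qed

text \<open>Differencing multiplies the leading coefficient by a nonzero rational number if \<open>h\<close>
  is a positive integer, so irrationality of the leading coefficient survives while the degree drops.\<close>

lemma poly_difference:
  fixes p :: "real poly"
  assumes "degree p = Suc d"
  shows "degree (pcompose p [:h, 1:] - p) \<le> d"
    and "coeff (pcompose p [:h, 1:] - p) d = real (Suc d) * h * lead_coeff p"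
proof -
  have co: "coeff (pcompose p [:h, 1:]) i = (\<Sum>j\<le>Suc d. coeff p j * (real (j choose i) * h ^ (j - i)))" for i
  proof -
    have "pcompose p [:h, 1:] = (\<Sum>j\<le>Suc d. smult (coeff p j) ([:h, 1:] ^ j))"
      unfolding assms[symmetric]
      by (simp add: pcompose_altdef poly_altdef degree_map_poly coeff_map_poly)
    moreover have "coeff ([:h, 1:] ^ j) i = real (j choose i) * h ^ (j - i)" for j
    proof (cases "i \<le> j")
      case True
      then show ?thesis using coeff_linear_poly_power[OF True, of h 1] by simp
    next
      case False
      then have "degree ([:h, 1:] ^ j) < i" by (simp only: degree_linear_power)
      with False show ?thesis using coeff_eq_0[of "[:h, 1:] ^ j" i] by simp
    qed
    ultimately show ?thesis by (simp add: coeff_sum del: sum.atMost_Suc power_Suc)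
  qed
  show "degree (pcompose p [:h, 1:] - p) \<le> d"
  proof (rule degree_le, intro allI impI)
    fix i assume i: "d < i"
    have "coeff (pcompose p [:h, 1:]) i = (\<Sum>j\<in>{i} \<inter> {..Suc d}. coeff p j * (real (j choose i) * h ^ (j - i)))"
      unfolding co using i by (intro sum.mono_neutral_right) auto
    also have "\<dots> = coeff p i"
      using i assms by (cases "i = Suc d") (auto simp: coeff_eq_0)
    finally show "coeff (pcompose p [:h, 1:] - p) i = 0" by simp
  qed
  have "coeff (pcompose p [:h, 1:]) d = (\<Sum>j\<in>{d, Suc d}. coeff p j * (real (j choose d) * h ^ (j - d)))"
    unfolding co by (intro sum.mono_neutral_right) auto
  then show "coeff (pcompose p [:h, 1:] - p) d = real (Suc d) * h * lead_coeff p"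
    using assms by (simp add: binomial_Suc_n)
qed

theorem Weyl_polynomial:
  fixes p :: "real poly"
  assumes "degree p = Suc d" "lead_coeff p \<notin> \<rat>"
  shows "has_mean (\<lambda>n. ee (poly p (real n))) 0"
  using assms
proof (induction d arbitrary: p)
  case 0
  obtain a b where p: "p = [:b, a:]"
    using degree1_coeffs[of p] 0 by fastforce
  show ?case using has_mean_linear[of a b] 0 by (auto simp: p algebra_simps split: if_splits)
next
  case (Suc d)
  show ?case
  proof (rule van_der_Corput)
    fix h :: nat assume h: "h \<ge> 1"
    define q where "q = pcompose p [:real h, 1:] - p"
    have cq: "coeff q (Suc d) = real (Suc (Suc d)) * real h * lead_coeff p"
      unfolding q_def by (rule poly_difference(2)) (rule Suc.prems)
    have irr: "coeff q (Suc d) \<notin> \<rat>"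
    proof
      assume "coeff q (Suc d) \<in> \<rat>"
      then have "coeff q (Suc d) / (real (Suc (Suc d)) * real h) \<in> \<rat>"
        by (intro Rats_divide Rats_mult Rats_of_nat)
      then show False using cq h Suc.prems(2) by simp
    qed
    then have "coeff q (Suc d) \<noteq> 0" by auto
    then have dq: "degree q = Suc d"
      using poly_difference(1)[OF Suc.prems(1), of "real h"] le_degree[of q "Suc d"]
      unfolding q_def by linarith
    have "has_mean (\<lambda>n. ee (poly q (real n))) 0"
      by (rule Suc.IH) (use dq irr in auto)
    moreover have "ee (poly q (real n)) = ee (poly p (real (n + h))) * cnj (ee (poly p (real n)))" for n
      by (simp add: q_def ee_minus[symmetric] ee_add[symmetric] poly_pcompose add.commute)
    ultimately show "has_mean (\<lambda>n. ee (poly p (real (n + h))) * cnj (ee (poly p (real n)))) 0"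
      by simp
  qed simp
qed

section \<open>Sequences approximable in mean by trigonometric polynomials\<close>

text \<open>Closeness in the seminorm given by the upper limit of the means of \<open>norm (g n - t
  n)\<close>.\<close>

definition near :: "(nat \<Rightarrow> complex) \<Rightarrow> (nat \<Rightarrow> complex) \<Rightarrow> real \<Rightarrow> bool" where
  "near g t \<epsilon> \<longleftrightarrow> (\<forall>\<^sub>F N in sequentially. (\<Sum>n=1..N. norm (g n - t n)) \<le> \<epsilon> * real N)"

lemma near_uniform:
  assumes "\<And>n. norm (g n - t n) \<le> \<epsilon>"
  shows "near g t \<epsilon>"
proof -
  have "(\<Sum>n=1..N. norm (g n - t n)) \<le> (\<Sum>n=1..N. \<epsilon>)" for N
    by (intro sum_mono assms)
  then show ?thesis unfolding near_def by (intro always_eventually) (simp add: mult.commute)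
qed

lemma near_trans:
  assumes "near g t \<epsilon>" "near t s \<delta>"
  shows "near g s (\<epsilon> + \<delta>)"
  using assms unfolding near_def
proof (rule eventually_elim2)
  fix N assume a: "(\<Sum>n=1..N. norm (g n - t n)) \<le> \<epsilon> * real N" "(\<Sum>n=1..N. norm (t n - s n)) \<le> \<delta> * real N"
  have "(\<Sum>n=1..N. norm (g n - s n)) \<le> (\<Sum>n=1..N. norm (g n - t n) + norm (t n - s n))"
    by (intro sum_mono) (metis norm_triangle_ineq diff_add_cancel add_diff_eq)
  with a show "(\<Sum>n=1..N. norm (g n - s n)) \<le> (\<epsilon> + \<delta>) * real N"
    by (simp add: sum.distrib distrib_right)
qed

lemma near_mult:
  assumes "near g t \<epsilon>" "\<And>n. norm (b n) \<le> B"
  shows "near (\<lambda>n. b n * g n) (\<lambda>n. b n * t n) (B * \<epsilon>)"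
  using assms(1) unfolding near_def
proof eventually_elim
  fix N assume a: "(\<Sum>n=1..N. norm (g n - t n)) \<le> \<epsilon> * real N"
  have B: "B \<ge> 0" using assms(2)[of 0] norm_ge_zero order_trans by blast
  have "(\<Sum>n=1..N. norm (b n * g n - b n * t n)) = (\<Sum>n=1..N. norm (b n) * norm (g n - t n))"
    by (simp add: norm_mult right_diff_distrib[symmetric])
  also have "\<dots> \<le> (\<Sum>n=1..N. B * norm (g n - t n))"
    by (intro sum_mono mult_right_mono assms) auto
  also have "\<dots> \<le> B * (\<epsilon> * real N)"
    using a B by (simp add: sum_distrib_left[symmetric] mult_left_mono)
  finally show "(\<Sum>n=1..N. norm (b n * g n - b n * t n)) \<le> B * \<epsilon> * real N" by simp
qed

lemma near_add:
  assumes "near g t \<epsilon>" "near g' t' \<epsilon>'"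
  shows "near (\<lambda>n. g n + g' n) (\<lambda>n. t n + t' n) (\<epsilon> + \<epsilon>')"
  using assms unfolding near_def
proof (rule eventually_elim2)
  fix N assume a: "(\<Sum>n=1..N. norm (g n - t n)) \<le> \<epsilon> * real N" "(\<Sum>n=1..N. norm (g' n - t' n)) \<le> \<epsilon>' * real N"
  have "(\<Sum>n=1..N. norm (g n + g' n - (t n + t' n))) \<le> (\<Sum>n=1..N. norm (g n - t n) + norm (g' n - t' n))"
    by (intro sum_mono) (metis norm_triangle_ineq add_diff_add)
  with a show "(\<Sum>n=1..N. norm (g n + g' n - (t n + t' n))) \<le> (\<epsilon> + \<epsilon>') * real N"
    by (simp add: sum.distrib distrib_right)
qed

lemma has_mean_approx:
  assumes "\<And>\<epsilon>. \<epsilon> > 0 \<Longrightarrow> \<exists>t c'. near g t \<epsilon> \<and> has_mean t c' \<and> norm (c' - c) \<le> \<epsilon>"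
  shows "has_mean g c"
  unfolding has_mean_def
proof (rule tendstoI)
  fix e :: real assume e: "e > 0"
  obtain t c' where t: "near g t (e/4)" "has_mean t c'" "norm (c' - c) \<le> e/4"
    using assms[of "e/4"] e by auto
  have "\<forall>\<^sub>F N in sequentially. dist ((\<Sum>n=1..N. t n) / of_nat N) c' < e/4"
    using tendstoD[OF t(2)[unfolded has_mean_def], of "e/4"] e by simp
  then show "\<forall>\<^sub>F N in sequentially. dist ((\<Sum>n=1..N. g n) / of_nat N) c < e"
    using t(1)[unfolded near_def] eventually_gt_at_top[of 0]
  proof eventually_elim
    case (elim N)
    have "norm ((\<Sum>n=1..N. g n) - (\<Sum>n=1..N. t n)) \<le> (\<Sum>n=1..N. norm (g n - t n))"
      by (simp add: sum_subtractf[symmetric] sum_norm_le)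
    then have "norm ((\<Sum>n=1..N. g n) - (\<Sum>n=1..N. t n)) / real N \<le> e/4"
      using elim by (simp add: field_simps)
    then have "dist ((\<Sum>n=1..N. g n) / of_nat N) ((\<Sum>n=1..N. t n) / of_nat N) \<le> e/4"
      by (simp add: dist_norm diff_divide_distrib[symmetric] norm_divide)
    moreover have "dist c' c \<le> e/4" using t(3) by (simp add: dist_norm)
    ultimately show ?case using elim(1) e
      using dist_triangle[of "(\<Sum>n=1..N. g n) / of_nat N" c c']
        dist_triangle[of "(\<Sum>n=1..N. g n) / of_nat N" c' "(\<Sum>n=1..N. t n) / of_nat N"]
      by linarith
  qed
qed

inductive_set trigs :: "('a \<Rightarrow> real) set \<Rightarrow> ('a \<Rightarrow> complex) set" for \<Lambda> where
  mono: "p \<in> \<Lambda> \<Longrightarrow> (\<lambda>x. c * ee (p x)) \<in> trigs \<Lambda>"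
| add: "s \<in> trigs \<Lambda> \<Longrightarrow> t \<in> trigs \<Lambda> \<Longrightarrow> (\<lambda>x. s x + t x) \<in> trigs \<Lambda>"

lemma trigs_bounded: "t \<in> trigs \<Lambda> \<Longrightarrow> \<exists>B. \<forall>x. norm (t x) \<le> B"
proof (induction rule: trigs.induct)
  case (mono p c)
  then show ?case by (intro exI[of _ "norm c"]) (simp add: norm_mult)
next
  case (add s t)
  then obtain B B' where "\<forall>x. norm (s x) \<le> B" "\<forall>x. norm (t x) \<le> B'" by blast
  then show ?case by (intro exI[of _ "B + B'"]) (auto intro: norm_triangle_mono)
qed

locale phase_group =
  fixes \<Lambda> :: "('a \<Rightarrow> real) set"
  assumes zero_phase: "(\<lambda>x. 0) \<in> \<Lambda>"
    and add_phase: "p \<in> \<Lambda> \<Longrightarrow> q \<in> \<Lambda> \<Longrightarrow> (\<lambda>x. p x + q x) \<in> \<Lambda>"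
begin

lemma trigs_const: "(\<lambda>x. c) \<in> trigs \<Lambda>"
  using trigs.mono[OF zero_phase, of c] by simp

lemma trigs_char: "p \<in> \<Lambda> \<Longrightarrow> (\<lambda>x. ee (p x)) \<in> trigs \<Lambda>"
  using trigs.mono[of p \<Lambda> 1] by simp

lemma trigs_mult_mono: "t \<in> trigs \<Lambda> \<Longrightarrow> p \<in> \<Lambda> \<Longrightarrow> (\<lambda>x. c * ee (p x) * t x) \<in> trigs \<Lambda>"
proof (induction rule: trigs.induct)
  case (mono q d)
  then have "(\<lambda>x. (c * d) * ee (p x + q x)) \<in> trigs \<Lambda>"
    by (intro trigs.mono add_phase)
  then show ?case by (simp add: ee_add mult_ac)
qed (simp add: distrib_left trigs.add)

lemma trigs_mult: "s \<in> trigs \<Lambda> \<Longrightarrow> t \<in> trigs \<Lambda> \<Longrightarrow> (\<lambda>x. s x * t x) \<in> trigs \<Lambda>"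
  by (induction rule: trigs.induct) (simp_all add: distrib_right trigs.add trigs_mult_mono)

end

text \<open>Passing to this closure is what makes bracket expressions accessible: it is an algebra, closed
  under \<open>exp\<close>, and it contains the discontinuous sequence \<open>frac (z n)\<close> as soon as
  \<open>z\<close> is equidistributed modulo one and its characters belong to the closure. On the other hand
  means against characters are still controlled by those of the trigonometric polynomials.\<close>

definition mean_closure :: "(nat \<Rightarrow> real) set \<Rightarrow> (nat \<Rightarrow> complex) set" where
  "mean_closure \<Lambda> = {g. (\<exists>B. \<forall>n. norm (g n) \<le> B) \<and> (\<forall>\<epsilon>>0. \<exists>t\<in>trigs \<Lambda>. near g t \<epsilon>)}"

lemma mean_closure_bounded: "g \<in> mean_closure \<Lambda> \<Longrightarrow> \<exists>B>0. \<forall>n. norm (g n) \<le> B"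
proof -
  assume "g \<in> mean_closure \<Lambda>"
  then obtain B where B: "\<forall>n. norm (g n) \<le> B" by (auto simp: mean_closure_def)
  have "norm (g n) \<le> \<bar>B\<bar> + 1" for n
    using B[rule_format, of n] abs_ge_self[of B] by linarith
  then show ?thesis by (intro exI[of _ "\<bar>B\<bar> + 1"]) auto
qed

lemma mean_closure_near: "g \<in> mean_closure \<Lambda> \<Longrightarrow> \<epsilon> > 0 \<Longrightarrow> \<exists>t\<in>trigs \<Lambda>. near g t \<epsilon>"
  by (simp add: mean_closure_def)

lemma trigs_mono: "t \<in> trigs \<Lambda> \<Longrightarrow> \<Lambda> \<subseteq> \<Lambda>' \<Longrightarrow> t \<in> trigs \<Lambda>'"
  by (induction rule: trigs.induct) (auto intro: trigs.intros)

lemma mean_closure_mono: "\<Lambda> \<subseteq> \<Lambda>' \<Longrightarrow> mean_closure \<Lambda> \<subseteq> mean_closure \<Lambda>'"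
  unfolding mean_closure_def using trigs_mono by blast

lemma trigs_subset_mean_closure: "t \<in> trigs \<Lambda> \<Longrightarrow> t \<in> mean_closure \<Lambda>"
proof -
  assume t: "t \<in> trigs \<Lambda>"
  then have "near t t \<epsilon>" if "\<epsilon> > 0" for \<epsilon> using near_uniform[of t t \<epsilon>] that by simp
  with t trigs_bounded[OF t] show ?thesis unfolding mean_closure_def by blast
qed

lemma mean_closure_approx:
  assumes "\<exists>B. \<forall>n. norm (g n) \<le> B" "\<And>\<epsilon>. \<epsilon> > 0 \<Longrightarrow> \<exists>h\<in>mean_closure \<Lambda>. near g h \<epsilon>"
  shows "g \<in> mean_closure \<Lambda>"
  unfolding mean_closure_def
proof (intro CollectI conjI allI impI)
  fix \<epsilon> :: real assume e: "\<epsilon> > 0"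
  obtain h where h: "h \<in> mean_closure \<Lambda>" "near g h (\<epsilon>/2)" using assms(2)[of "\<epsilon>/2"] e by auto
  then obtain t where t: "t \<in> trigs \<Lambda>" "near h t (\<epsilon>/2)"
    using mean_closure_near[of h \<Lambda> "\<epsilon>/2"] e by auto
  show "\<exists>t\<in>trigs \<Lambda>. near g t \<epsilon>"
    using near_trans[OF h(2) t(2)] t(1) by auto
qed (use assms in auto)

lemma mean_closure_add:
  fixes g :: "nat \<Rightarrow> complex"
  assumes "g \<in> mean_closure M" "h \<in> mean_closure M"
  shows "(\<lambda>n. g n + h n) \<in> mean_closure M"
  unfolding mean_closure_def
proof (intro CollectI conjI allI impI)
  obtain B B' where "\<forall>n. norm (g n) \<le> B" "\<forall>n. norm (h n) \<le> B'"
    using mean_closure_bounded[OF assms(1)] mean_closure_bounded[OF assms(2)] by blast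
  then show "\<exists>B. \<forall>n. norm (g n + h n) \<le> B" 
    by (intro exI[of _ "B + B'"]) (auto intro: norm_triangle_mono)
  fix \<epsilon> :: real assume e: "\<epsilon> > 0"
  obtain s t where st: "s \<in> trigs M" "near g s (\<epsilon>/2)" "t \<in> trigs M" "near h t (\<epsilon>/2)"
    using mean_closure_near[OF assms(1), of "\<epsilon>/2"] mean_closure_near[OF assms(2), of "\<epsilon>/2"] e by auto
  show "\<exists>t\<in>trigs M. near (\<lambda>n. g n + h n) t \<epsilon>"
    using near_add[OF st(2,4)] trigs.add[OF st(1,3)] by (intro bexI[of _ "\<lambda>x. s x + t x"]) auto
qed

locale seq_phase_group = phase_group \<Lambda> for \<Lambda> :: "(nat \<Rightarrow> real) set"
begin

lemma mc_const: "(\<lambda>n. c) \<in> mean_closure \<Lambda>"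
  by (intro trigs_subset_mean_closure trigs_const)

lemma mc_char: "p \<in> \<Lambda> \<Longrightarrow> (\<lambda>n. ee (p n)) \<in> mean_closure \<Lambda>"
  by (intro trigs_subset_mean_closure trigs_char)

lemmas mc_add = mean_closure_add[of _ \<Lambda>]

lemma mc_mult:
  assumes g: "g \<in> mean_closure \<Lambda>" and h: "h \<in> mean_closure \<Lambda>"
  shows "(\<lambda>n. g n * h n) \<in> mean_closure \<Lambda>"
  unfolding mean_closure_def
proof (intro CollectI conjI allI impI)
  obtain B B' where B: "\<forall>n. norm (g n) \<le> B" "B > 0" "\<forall>n. norm (h n) \<le> B'" "B' > 0"
    using mean_closure_bounded[OF assms(1)] mean_closure_bounded[OF assms(2)] by blast
  then show "\<exists>B. \<forall>n. norm (g n * h n) \<le> B" 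
    by (intro exI[of _ "B * B'"]) (auto simp: norm_mult intro!: mult_mono)
  fix \<epsilon> :: real assume e: "\<epsilon> > 0"
  obtain s where s: "s \<in> trigs \<Lambda>" "near g s (\<epsilon> / (2 * B'))"
    using mean_closure_near[OF g, of "\<epsilon> / (2 * B')"] e B by auto
  obtain S0 where S0: "\<And>n. norm (s n) \<le> S0" using trigs_bounded[OF s(1)] by blast
  define S where "S = S0 + 1"
  have S: "S > 0" "norm (s n) \<le> S" for n
    using S0[of n] norm_ge_zero[of "s n"] unfolding S_def by linarith+
  \<comment> \<open>The sup norm of \<open>s\<close> is not controlled by that of \<open>g\<close>, so \<open>t\<close> is chosen after \<open>s\<close>.\<close>
  obtain t where t: "t \<in> trigs \<Lambda>" "near h t (\<epsilon> / (2 * S))"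
    using mean_closure_near[OF h, of "\<epsilon> / (2 * S)"] e S by auto
  have "near (\<lambda>n. h n * g n) (\<lambda>n. h n * s n) (B' * (\<epsilon> / (2 * B')))"
    using near_mult[OF s(2)] B by blast
  moreover have "near (\<lambda>n. s n * h n) (\<lambda>n. s n * t n) (S * (\<epsilon> / (2 * S)))"
    using near_mult[OF t(2)] S by blast
  ultimately have "near (\<lambda>n. g n * h n) (\<lambda>n. s n * t n) (B' * (\<epsilon> / (2 * B')) + S * (\<epsilon> / (2 * S)))"
    using near_trans by (auto simp: mult.commute)
  then show "\<exists>t\<in>trigs \<Lambda>. near (\<lambda>n. g n * h n) t \<epsilon>"
    using trigs_mult[OF s(1) t(1)] B S by (intro bexI[of _ "\<lambda>x. s x * t x"]) auto
qed

lemma mc_cmult: "g \<in> mean_closure \<Lambda> \<Longrightarrow> (\<lambda>n. c * g n) \<in> mean_closure \<Lambda>"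
  by (rule mc_mult[OF mc_const])

lemma mc_sum: "(\<And>i. i \<in> A \<Longrightarrow> g i \<in> mean_closure \<Lambda>) \<Longrightarrow> (\<lambda>n. \<Sum>i\<in>A. g i n) \<in> mean_closure \<Lambda>"
  by (induction A rule: infinite_finite_induct) (auto intro: mc_const[of 0] mc_add)

lemma mc_power: "g \<in> mean_closure \<Lambda> \<Longrightarrow> (\<lambda>n. g n ^ i) \<in> mean_closure \<Lambda>"
  by (induction i) (auto intro: mc_const mc_mult)

lemma mc_prod: "(\<And>i. i \<in> A \<Longrightarrow> g i \<in> mean_closure \<Lambda>) \<Longrightarrow> (\<lambda>n. \<Prod>i\<in>A. g i n) \<in> mean_closure \<Lambda>"
  by (induction A rule: infinite_finite_induct) (auto intro: mc_const[of 1] mc_mult)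

text \<open>The exponential series converges uniformly on the bounded range of \<open>g\<close>. In particular
  \<open>e\<close> of a real polynomial in several members is again a member.\<close>

lemma mc_exp:
  assumes g: "g \<in> mean_closure \<Lambda>"
  shows "(\<lambda>n. exp (g n)) \<in> mean_closure \<Lambda>"
proof (rule mean_closure_approx)
  obtain B where B: "\<forall>n. norm (g n) \<le> B" "B > 0"
    using mean_closure_bounded[OF assms] by blast
  have "norm (exp (g n)) \<le> exp B" for n
    using norm_exp[of "g n"] B exp_le_cancel_iff[of "norm (g n)" B] order_trans by blast
  then show "\<exists>B. \<forall>n. norm (exp (g n)) \<le> B" by blast
  fix \<epsilon> :: real assume e: "\<epsilon> > 0"
  have "uniform_limit (cball 0 B) (\<lambda>N z. \<Sum>i<N. z ^ i /\<^sub>R fact i) (exp :: complex \<Rightarrow> complex) sequentially"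
    unfolding exp_def [abs_def]
  proof (rule Weierstrass_m_test)
    show "norm (z ^ i /\<^sub>R fact i) \<le> B ^ i /\<^sub>R fact i" if "z \<in> cball 0 B" for i and z :: complex
    proof -
      have "norm z ^ i \<le> B ^ i" using that by (intro power_mono) auto
      then show ?thesis by (simp add: norm_power)
    qed
    show "summable (\<lambda>i. B ^ i /\<^sub>R fact i)" by (rule summable_exp_generic)
  qed
  then have "\<forall>\<^sub>F N in sequentially. \<forall>z\<in>cball (0::complex) B. dist (\<Sum>i<N. z ^ i /\<^sub>R fact i) (exp z) < \<epsilon>"
    using e by (simp add: uniform_limit_iff)
  then obtain N where N: "\<forall>z\<in>cball (0::complex) B. dist (\<Sum>i<N. z ^ i /\<^sub>R fact i) (exp z) < \<epsilon>"
    using eventually_happens[of _ sequentially] by auto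
  show "\<exists>h\<in>mean_closure \<Lambda>. near (\<lambda>n. exp (g n)) h \<epsilon>"
  proof
    show "near (\<lambda>n. exp (g n)) (\<lambda>n. \<Sum>i<N. (1 / fact i) * g n ^ i) \<epsilon>"
    proof (rule near_uniform)
      fix n
      have "dist (\<Sum>i<N. g n ^ i /\<^sub>R fact i) (exp (g n)) < \<epsilon>" using N B by auto
      then show "norm (exp (g n) - (\<Sum>i<N. (1 / fact i) * g n ^ i)) \<le> \<epsilon>"
        by (simp add: dist_norm norm_minus_commute scaleR_conv_of_real inverse_eq_divide)
    qed
    show "(\<lambda>n. \<Sum>i<N. (1 / fact i) * g n ^ i) \<in> mean_closure \<Lambda>"
      by (intro mc_sum mc_cmult mc_power g)
  qed
qed

end

section \<open>From exponential means to functions on the circle\<close>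

definition int_phases :: "(real \<Rightarrow> real) set" where
  "int_phases = {\<lambda>x. of_int l * x | l. True}"

interpretation int_phases: phase_group int_phases
proof
  show "(\<lambda>x. 0) \<in> int_phases" by (auto simp: int_phases_def intro!: exI[of _ 0])
next
  fix p q assume "p \<in> int_phases" "q \<in> int_phases"
  then obtain l m where "p = (\<lambda>x. of_int l * x)" "q = (\<lambda>x. of_int m * x)"
    by (auto simp: int_phases_def)
  then have "(\<lambda>x. p x + q x) = (\<lambda>x. of_int (l + m) * x)" by (auto simp: distrib_right)
  then show "(\<lambda>x. p x + q x) \<in> int_phases" unfolding int_phases_def by blast
qed

lemma int_phases_mem: "(\<lambda>x. of_int l * x) \<in> int_phases"
  by (auto simp: int_phases_def)

lemma ee_eq: "ee x = Complex (cos (2 * pi * x)) (sin (2 * pi * x))"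
  by (simp add: ee_def complex_eq_iff)

lemma circle_polynomial:
  assumes "real_polynomial_function (p :: complex \<Rightarrow> real)"
  shows "(\<lambda>x. complex_of_real (p (ee x))) \<in> trigs int_phases"
  using assms
proof (induction rule: real_polynomial_function.induct)
  case (linear f)
  interpret bounded_linear f by fact
  define a b where "a = f 1" "b = f \<i>"
  have f: "f w = Re w * a + Im w * b" for w
  proof -
    have "w = Re w *\<^sub>R 1 + Im w *\<^sub>R \<i>" by (simp add: complex_eq_iff)
    then have "f w = Re w *\<^sub>R f 1 + Im w *\<^sub>R f \<i>" by (metis add scale)
    then show ?thesis by (simp add: a_b_def)
  qed
  have "complex_of_real (f (ee x)) =
     ((a - \<i> * b) / 2) * ee (of_int 1 * x) + ((a + \<i> * b) / 2) * ee (of_int (-1) * x)" for x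
    by (simp add: f ee_eq complex_eq_iff field_simps)
  then have "(\<lambda>x. complex_of_real (f (ee x))) = (\<lambda>x.
     ((a - \<i> * b) / 2) * ee (of_int 1 * x) + ((a + \<i> * b) / 2) * ee (of_int (-1) * x))" by (rule ext)
  then show ?case
    using trigs.add[OF trigs.mono[OF int_phases_mem] trigs.mono[OF int_phases_mem]] by (simp only:)
next
  case (const c)
  then show ?case by (rule int_phases.trigs_const)
next
  case (add f g)
  then show ?case using trigs.add by fastforce
next
  case (mult f g)
  then show ?case using int_phases.trigs_mult by fastforce
qed

lemma circle_approx:
  assumes "continuous_on (sphere 0 1) u" "\<epsilon> > 0"
  obtains \<tau> where "\<tau> \<in> trigs int_phases" "\<And>x. norm (complex_of_real (u (ee x)) - \<tau> x) \<le> \<epsilon>"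
proof -
  obtain p where p: "real_polynomial_function p" "\<And>w::complex. w \<in> sphere 0 1 \<Longrightarrow> \<bar>u w - p w\<bar> < \<epsilon>"
    using Stone_Weierstrass_real_polynomial_function[OF compact_sphere assms] by blast
  have "norm (complex_of_real (u (ee x)) - complex_of_real (p (ee x))) \<le> \<epsilon>" for x
    using p(2)[of "ee x"] by (simp add: of_real_diff[symmetric] del: of_real_diff)
  then show ?thesis using that[OF circle_polynomial[OF p(1)]] by blast
qed

lemma has_integral_ee:
  "((\<lambda>x. ee (of_int l * x)) has_integral (if l = 0 then 1 else 0)) {0..1}"
proof (cases "l = 0")
  case True
  then show ?thesis using has_integral_const_real[of "1::complex" 0 1] by simp
next
  case False
  define c where "c = 2 * pi * of_int l"
  have c: "c \<noteq> 0" using False by (simp add: c_def)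
  have "((\<lambda>x. ee (of_int l * x)) has_integral (cis (c * 1) / (\<i> * c) - cis (c * 0) / (\<i> * c))) {0..1}"
  proof (rule fundamental_theorem_of_calculus)
    fix x :: real
    have "((\<lambda>z. exp (\<i> * (c * z)) / (\<i> * c)) has_field_derivative exp (\<i> * (c * w))) (at w)" for w
      using c by (auto intro!: derivative_eq_intros simp: mult_ac)
    from has_vector_derivative_real_field[OF this[of "of_real x"], of "{0..1}"]
    have "((\<lambda>x. cis (c * x) / (\<i> * c)) has_vector_derivative cis (c * x)) (at x within {0..1})"
      by (simp add: cis_conv_exp)
    moreover have "cis (c * x) = ee (of_int l * x)"
      by (simp add: ee_def c_def mult_ac)
    ultimately show "((\<lambda>x. cis (c * x) / (\<i> * c)) has_vector_derivative ee (of_int l * x)) (at x within {0..1})"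
      by simp
  qed simp
  moreover have "cis c = 1" using ee_of_int[of l] by (simp add: ee_def c_def)
  ultimately show ?thesis using False by simp
qed

text \<open>For \<open>g = 1\<close> this is the hypothesis of Weyl's criterion. For general \<open>g\<close>
  it says that \<open>z\<close> is equidistributed modulo one and asymptotically uncorrelated with
  \<open>g\<close>.\<close>

definition equid_weight :: "(nat \<Rightarrow> complex) \<Rightarrow> complex \<Rightarrow> (nat \<Rightarrow> real) \<Rightarrow> bool" where
  "equid_weight g c z \<longleftrightarrow> (\<exists>B. \<forall>n. norm (g n) \<le> B) \<and> has_mean g c \<and>
     (\<forall>l::int. l \<noteq> 0 \<longrightarrow> has_mean (\<lambda>n. g n * ee (of_int l * z n)) 0)"

lemma mean_trigs:
  assumes "equid_weight g c z" "\<tau> \<in> trigs int_phases"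
  shows "\<exists>I. (\<tau> has_integral I) {0..1} \<and> has_mean (\<lambda>n. g n * \<tau> (z n)) (c * I)"
  using assms(2)
proof (induction rule: trigs.induct)
  case (mono p d)
  then obtain l where l: "p = (\<lambda>x. of_int l * x)" by (auto simp: int_phases_def)
  have 1: "((\<lambda>x. d * ee (p x)) has_integral (d * (if l = 0 then 1 else 0))) {0..1}"
    unfolding l by (intro has_integral_mult_right has_integral_ee)
  have "has_mean (\<lambda>n. g n * ee (of_int l * z n)) (c * (if l = 0 then 1 else 0))"
    using assms(1) by (auto simp: equid_weight_def)
  from has_mean_cmult[OF this, of d]
  have "has_mean (\<lambda>n. g n * (d * ee (p (z n)))) (c * (d * (if l = 0 then 1 else 0)))"
    by (simp add: l mult_ac)
  with 1 show ?case by blast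
next
  case (add s t)
  then obtain I J where "(s has_integral I) {0..1}" "has_mean (\<lambda>n. g n * s (z n)) (c * I)"
     "(t has_integral J) {0..1}" "has_mean (\<lambda>n. g n * t (z n)) (c * J)" by blast
  then show ?case
    using has_integral_add[of s I "{0..1}" t J] has_mean_add[of "\<lambda>n. g n * s (z n)" "c * I" "\<lambda>n. g n * t (z n)" "c * J"]
    by (auto simp: distrib_left intro!: exI[of _ "I + J"])
qed

lemma continuous_on_ee: "continuous_on S ee"
  unfolding ee_def [abs_def] by (intro continuous_intros)

lemma continuous_on_circle_comp:
  assumes "continuous_on (sphere 0 1) u"
  shows "continuous_on S (\<lambda>x. u (ee x))"
  by (rule continuous_on_compose2[OF assms continuous_on_ee]) auto

lemma mean_circle:
  assumes g: "equid_weight g c z" and u: "continuous_on (sphere 0 1) u"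
  shows "has_mean (\<lambda>n. g n * complex_of_real (u (ee (z n)))) (c * of_real (integral {0..1} (\<lambda>x. u (ee x))))"
proof (rule has_mean_approx)
  fix e :: real assume e: "e > 0"
  obtain B0 where B0: "\<And>n. norm (g n) \<le> B0" using g by (auto simp: equid_weight_def)
  define B where "B = \<bar>B0\<bar> + norm c + 1"
  have B: "B > 0" "norm (g n) \<le> B" "norm c \<le> B" for n
    using B0[of n] norm_ge_zero[of c] abs_ge_self[of B0] unfolding B_def by linarith+
  obtain \<tau> where \<tau>: "\<tau> \<in> trigs int_phases" "\<And>x. norm (complex_of_real (u (ee x)) - \<tau> x) \<le> e / B"
    using circle_approx[OF u, of "e / B"] e B by auto
  obtain I where I: "(\<tau> has_integral I) {0..1}" "has_mean (\<lambda>n. g n * \<tau> (z n)) (c * I)"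
    using mean_trigs[OF g \<tau>(1)] by blast
  have int: "((\<lambda>x. complex_of_real (u (ee x))) has_integral of_real (integral {0..1} (\<lambda>x. u (ee x)))) {0..1}"
    by (intro has_integral_of_real integrable_integral integrable_continuous_interval
        continuous_on_circle_comp u)
  have "norm (of_real (integral {0..1} (\<lambda>x. u (ee x))) - I) \<le> e / B * measure lborel (cbox 0 (1::real))"
    by (rule has_integral_bound[of "e / B" "\<lambda>x. complex_of_real (u (ee x)) - \<tau> x"])
      (use e B \<tau>(2) has_integral_diff[OF int I(1)] in auto)
  then have "norm (I - of_real (integral {0..1} (\<lambda>x. u (ee x)))) \<le> e / B"
    by (simp add: norm_minus_commute)
  then have "norm c * norm (I - of_real (integral {0..1} (\<lambda>x. u (ee x)))) \<le> B * (e / B)"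
    using B by (intro mult_mono) auto
  then have "norm (c * I - c * of_real (integral {0..1} (\<lambda>x. u (ee x)))) \<le> e"
    using B by (simp add: right_diff_distrib[symmetric] norm_mult)
  moreover have "near (\<lambda>n. g n * complex_of_real (u (ee (z n)))) (\<lambda>n. g n * \<tau> (z n)) (B * (e / B))"
    by (intro near_mult near_uniform \<tau> B)
  ultimately show "\<exists>t c'. near (\<lambda>n. g n * complex_of_real (u (ee (z n)))) t e \<and> has_mean t c'
      \<and> norm (c' - c * of_real (integral {0..1} (\<lambda>x. u (ee x)))) \<le> e"
    using I(2) B by auto
qed

text \<open>The functions \<open>1 - L * infdist w K\<close>, cut off at zero, decrease to the indicator of
  the arc \<open>K\<close> as \<open>L\<close> grows, and their integrals converge by dominated convergence.\<close>

lemma circle_bump: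
  fixes a b \<epsilon> :: real
  assumes ab: "0 \<le> a" "a \<le> b" "b \<le> 1" and e: "\<epsilon> > 0"
  obtains u where "continuous_on (sphere 0 1) u" "\<And>w. 0 \<le> u w" "\<And>t. frac t \<in> {a..b} \<Longrightarrow> 1 \<le> u (ee t)"
    "integral {0..1} (\<lambda>x. u (ee x)) \<le> b - a + \<epsilon>"
proof -
  define K where "K = ee ` {a..b}"
  have K: "compact K" "K \<noteq> {}" using ab
    unfolding K_def by (auto intro!: compact_continuous_image continuous_on_ee)
  define u where "u L w = max 0 (1 - real L * infdist w K)" for L :: nat and w
  have u0: "0 \<le> u L w" "u L w \<le> 1" for L w
    using infdist_nonneg[of w K] by (auto simp: u_def)
  have ucont: "continuous_on S (u L)" for L S
    unfolding u_def [abs_def] by (intro continuous_intros)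
  have u1: "1 \<le> u L (ee t)" if "frac t \<in> {a..b}" for L t
  proof -
    have "ee t \<in> K" using that ee_frac[of t] unfolding K_def by (metis image_eqI)
    then show ?thesis by (simp add: u_def)
  qed
  define g where "g t = (if ee t \<in> K then 1 else 0 :: real)" for t
  have lim: "(\<lambda>L. u L (ee t)) \<longlonglongrightarrow> g t" for t
  proof (cases "ee t \<in> K")
    case True
    then show ?thesis by (simp add: u_def g_def)
  next
    case False
    then have pos: "infdist (ee t) K > 0"
      using K by (metis compact_imp_closed in_closed_iff_infdist_zero infdist_nonneg less_le)
    obtain L0 :: nat where L0: "1 / infdist (ee t) K < real L0" using reals_Archimedean2 by blast
    have "u L (ee t) = 0" if "L \<ge> L0" for L
    proof -
      have "1 / infdist (ee t) K < real L" using L0 that by linarith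
      then show ?thesis using pos by (simp add: u_def field_simps)
    qed
    then have "\<forall>\<^sub>F L in sequentially. u L (ee t) = 0"
      by (rule eventually_sequentiallyI)
    then show ?thesis using False by (auto simp: g_def intro: tendsto_eventually)
  qed
  have "(g has_integral (b - a)) {0..1}"
  proof (rule has_integral_spike_finite)
    show "finite {0, 1 :: real}" by simp
    have "((\<lambda>x. 1::real) has_integral (b - a)) {a..b}"
      using has_integral_const_real[of "1::real" a b] ab by simp
    then show "((\<lambda>x. if x \<in> {a..b} then 1 else 0) has_integral (b - a)) {0..1}"
      by (subst has_integral_restrict) (use ab in auto)
    \<comment> \<open>The end points \<open>0\<close> and \<open>1\<close> are the same point of the circle and may be in \<open>K\<close> without being in \<open>[a,b]\<close>.\<close>
    fix t assume t: "t \<in> {0..1} - {0, 1 :: real}"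
    have "ee t \<in> K \<longleftrightarrow> t \<in> {a..b}"
    proof
      assume "ee t \<in> K"
      then obtain s where s: "s \<in> {a..b}" "ee t = ee s" by (auto simp: K_def)
      have "ee (t - s) = 1"
        using s(2) ee_add[of "t - s" s] ee_add[of s "- s"] norm_ee[of s]
        by (metis diff_add_cancel mult_cancel_right1 norm_zero zero_neq_one)
      then obtain m :: int where m: "t - s = of_int m" by (auto simp: ee_eq_1_iff elim: Ints_cases)
      have "\<bar>t - s\<bar> < 1" using t s ab by auto
      then have "m = 0" using m by linarith
      then show "t \<in> {a..b}" using m s by simp
    qed (auto simp: K_def)
    then show "g t = (if t \<in> {a..b} then 1 else 0)" by (simp add: g_def)
  qed
  then have ig: "integral {0..1} g = b - a" by (rule integral_unique)
  have "(\<lambda>L. integral {0..1} (\<lambda>x. u L (ee x))) \<longlonglongrightarrow> integral {0..1} g"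
  proof (rule dominated_convergence(2))
    show "(\<lambda>x. u L (ee x)) integrable_on {0..1}" for L
      by (intro integrable_continuous_interval continuous_on_circle_comp ucont)
    show "(\<lambda>x::real. 1::real) integrable_on {0..1}" by (intro integrable_continuous_interval continuous_on_const)
  qed (use u0 lim in auto)
  then have "\<forall>\<^sub>F L in sequentially. integral {0..1} (\<lambda>x. u L (ee x)) < b - a + \<epsilon>"
    using e unfolding ig by (intro order_tendstoD(2)) auto
  then obtain L where "integral {0..1} (\<lambda>x. u L (ee x)) < b - a + \<epsilon>"
    using eventually_happens[of _ sequentially] by auto
  then show ?thesis using that[of "u L"] ucont u0 u1 by auto
qed

section \<open>Intervals and continuous functions modulo one\<close>

lemma interval_mean_aux:
  assumes z: "equid_weight (\<lambda>n. 1) 1 z" and ab: "0 \<le> a" "a \<le> b" "b \<le> 1" and e: "\<epsilon> > 0"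
  shows "\<forall>\<^sub>F N in sequentially. (\<Sum>n=1..N. of_bool (frac (z n) \<in> {a..b})) / real N < b - a + \<epsilon>"
proof -
  obtain u where u: "continuous_on (sphere 0 1) u" "\<And>w. 0 \<le> u w"
    "\<And>t. frac t \<in> {a..b} \<Longrightarrow> 1 \<le> u (ee t)" "integral {0..1} (\<lambda>x. u (ee x)) \<le> b - a + \<epsilon> / 2"
    using circle_bump[OF ab, of "\<epsilon> / 2"] e by auto
  have "(\<lambda>N. (\<Sum>n=1..N. u (ee (z n))) / real N) \<longlonglongrightarrow> integral {0..1} (\<lambda>x. u (ee x))"
    using tendsto_Re[OF mean_circle[OF z u(1), unfolded has_mean_def]] by simp
  then have "\<forall>\<^sub>F N in sequentially. (\<Sum>n=1..N. u (ee (z n))) / real N < b - a + \<epsilon>"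
    using u(4) e by (intro order_tendstoD(2)) auto
  then show ?thesis
  proof eventually_elim
    case (elim N)
    have "(\<Sum>n=1..N. of_bool (frac (z n) \<in> {a..b})) \<le> (\<Sum>n=1..N. u (ee (z n)))"
      using u by (intro sum_mono) auto
    then show ?case using elim by (meson divide_right_mono le_less_trans of_nat_0_le_iff)
  qed
qed

lemma has_mean_of_real: 
  "has_mean (\<lambda>n. complex_of_real (f n)) (complex_of_real c) \<longleftrightarrow> (\<lambda>N. (\<Sum>n=1..N. f n) / real N) \<longlonglongrightarrow> c"
proof -
  have "(\<lambda>N. (\<Sum>n=1..N. complex_of_real (f n)) / of_nat N) = (\<lambda>N. complex_of_real ((\<Sum>n=1..N. f n) / real N))"
    by (intro ext) simp
  then show ?thesis unfolding has_mean_def by (simp only: tendsto_of_real_iff)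
qed

text \<open>Upper bounds for closed intervals suffice: \<open>[0,a]\<close>, \<open>[a,b)\<close> and
  \<open>[b,1]\<close> cover \<open>[0,1)\<close>, so upper bounds for the outer two give the lower bound for
  the middle one.\<close>

lemma interval_mean_real:
  assumes z: "equid_weight (\<lambda>n. 1) 1 z" and ab: "0 \<le> a" "a \<le> b" "b \<le> 1"
  shows "(\<lambda>N. (\<Sum>n=1..N. of_bool (frac (z n) \<in> {a..<b})) / real N) \<longlonglongrightarrow> b - a"
proof (rule tendstoI)
  fix e :: real assume e: "e > 0"
  have 1: "\<forall>\<^sub>F N in sequentially. (\<Sum>n=1..N. of_bool (frac (z n) \<in> {0..a})) / real N < a - 0 + e/2"
    by (rule interval_mean_aux) (use z ab e in auto)
  have 2: "\<forall>\<^sub>F N in sequentially. (\<Sum>n=1..N. of_bool (frac (z n) \<in> {a..b})) / real N < b - a + e"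
    by (rule interval_mean_aux) (use z ab e in auto)
  have 3: "\<forall>\<^sub>F N in sequentially. (\<Sum>n=1..N. of_bool (frac (z n) \<in> {b..1})) / real N < 1 - b + e/2"
    by (rule interval_mean_aux) (use z ab e in auto)
  show "\<forall>\<^sub>F N in sequentially. dist ((\<Sum>n=1..N. of_bool (frac (z n) \<in> {a..<b})) / real N) (b - a) < e"
    using 1 2 3 eventually_gt_at_top[of 0]
  proof eventually_elim
    case (elim N)
    have "(\<Sum>n=1..N. of_bool (frac (z n) \<in> {a..<b})) \<le> (\<Sum>n=1..N. of_bool (frac (z n) \<in> {a..b}) :: real)"
      by (intro sum_mono) auto
    then have up: "(\<Sum>n=1..N. of_bool (frac (z n) \<in> {a..<b})) / real N \<le> (\<Sum>n=1..N. of_bool (frac (z n) \<in> {a..b})) / real N"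
      by (intro divide_right_mono) auto
    have "real N = (\<Sum>n=1..N. 1)" by simp
    also have "\<dots> \<le> (\<Sum>n=1..N. of_bool (frac (z n) \<in> {0..a}) + of_bool (frac (z n) \<in> {a..<b}) + of_bool (frac (z n) \<in> {b..1}))"
    proof (intro sum_mono)
      fix n
      have "0 \<le> frac (z n)" "frac (z n) < 1" by (simp_all add: frac_lt_1)
      then show "(1::real) \<le> of_bool (frac (z n) \<in> {0..a}) + of_bool (frac (z n) \<in> {a..<b}) + of_bool (frac (z n) \<in> {b..1})"
        by (cases "frac (z n) \<le> a"; cases "frac (z n) < b") auto
    qed
    finally have "1 \<le> ((\<Sum>n=1..N. of_bool (frac (z n) \<in> {0..a})) + (\<Sum>n=1..N. of_bool (frac (z n) \<in> {a..<b}))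
       + (\<Sum>n=1..N. of_bool (frac (z n) \<in> {b..1}))) / real N"
      using elim by (simp add: sum.distrib)
    then have "1 \<le> (\<Sum>n=1..N. of_bool (frac (z n) \<in> {0..a})) / real N + (\<Sum>n=1..N. of_bool (frac (z n) \<in> {a..<b})) / real N
       + (\<Sum>n=1..N. of_bool (frac (z n) \<in> {b..1})) / real N"
      by (simp only: add_divide_distrib)
    then have "- e < (\<Sum>n=1..N. of_bool (frac (z n) \<in> {a..<b})) / real N - (b - a)"
      "(\<Sum>n=1..N. of_bool (frac (z n) \<in> {a..<b})) / real N - (b - a) < e"
      using elim up by linarith+
    then show ?case unfolding dist_real_def by linarith
  qed
qed

lemma interval_near:
  assumes z: "equid_weight (\<lambda>n. 1) 1 z" and ab: "0 \<le> a" "a \<le> b" "b \<le> 1" and e: "\<epsilon> > 0"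
  obtains u where "continuous_on (sphere 0 1) u"
    "near (\<lambda>n. of_bool (frac (z n) \<in> {a..<b})) (\<lambda>n. complex_of_real (u (ee (z n)))) \<epsilon>"
    "\<bar>integral {0..1} (\<lambda>x. u (ee x)) - (b - a)\<bar> \<le> \<epsilon>"
proof -
  obtain u where u: "continuous_on (sphere 0 1) u" "\<And>w. 0 \<le> u w"
    "\<And>t. frac t \<in> {a..b} \<Longrightarrow> 1 \<le> u (ee t)" "integral {0..1} (\<lambda>x. u (ee x)) \<le> b - a + \<epsilon> / 2"
    using circle_bump[OF ab, of "\<epsilon> / 2"] e by auto
  have le: "of_bool (frac (z n) \<in> {a..<b}) \<le> u (ee (z n))" for n using u by auto
  have "(\<lambda>N. (\<Sum>n=1..N. u (ee (z n))) / real N) \<longlonglongrightarrow> integral {0..1} (\<lambda>x. u (ee x))"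
    using tendsto_Re[OF mean_circle[OF z u(1), unfolded has_mean_def]] by simp
  from tendsto_diff[OF this interval_mean_real[OF z ab]]
  have lim: "(\<lambda>N. (\<Sum>n=1..N. u (ee (z n)) - of_bool (frac (z n) \<in> {a..<b})) / real N)
     \<longlonglongrightarrow> integral {0..1} (\<lambda>x. u (ee x)) - (b - a)"
    by (simp add: sum_subtractf diff_divide_distrib)
  have "0 \<le> integral {0..1} (\<lambda>x. u (ee x)) - (b - a)"
  proof (rule tendsto_lowerbound[OF lim])
    have "0 \<le> (\<Sum>n=1..N. u (ee (z n)) - of_bool (frac (z n) \<in> {a..<b})) / real N" for N
      using le by (intro divide_nonneg_nonneg sum_nonneg) (simp_all only: diff_ge_0_iff_ge of_nat_0_le_iff)
    then show "\<forall>\<^sub>F N in sequentially. 0 \<le> (\<Sum>n=1..N. u (ee (z n)) - of_bool (frac (z n) \<in> {a..<b})) / real N"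
      by simp
  qed simp
  moreover have "\<forall>\<^sub>F N in sequentially. (\<Sum>n=1..N. u (ee (z n)) - of_bool (frac (z n) \<in> {a..<b})) / real N < \<epsilon>"
    using u(4) e by (intro order_tendstoD(2)[OF lim]) auto
  then have "near (\<lambda>n. of_bool (frac (z n) \<in> {a..<b})) (\<lambda>n. complex_of_real (u (ee (z n)))) \<epsilon>"
    unfolding near_def using eventually_gt_at_top[of 0]
  proof eventually_elim
    case (elim N)
    have "norm (of_bool (frac (z n) \<in> {a..<b}) - complex_of_real (u (ee (z n)))) = u (ee (z n)) - of_bool (frac (z n) \<in> {a..<b})" for n
    proof -
      have "norm (of_bool (frac (z n) \<in> {a..<b}) - complex_of_real (u (ee (z n))))
         = norm (complex_of_real (of_bool (frac (z n) \<in> {a..<b}) - u (ee (z n))))" by simp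
      also have "\<dots> = u (ee (z n)) - of_bool (frac (z n) \<in> {a..<b})"
        using le[of n] by (simp only: norm_of_real)
      finally show ?thesis .
    qed
    then have "(\<Sum>n=1..N. norm (of_bool (frac (z n) \<in> {a..<b}) - complex_of_real (u (ee (z n)))))
        = (\<Sum>n=1..N. u (ee (z n)) - of_bool (frac (z n) \<in> {a..<b}))"
      by (simp only:)
    also have "\<dots> \<le> \<epsilon> * real N"
      using elim by (simp only: pos_divide_less_eq of_nat_0_less_iff less_imp_le)
    finally show ?case .
  qed
  ultimately show ?thesis using that[OF u(1)] u(4) e by auto
qed

text \<open>Independence of \<open>frac (z n)\<close> from the weight, obtained by replacing the indicator by
  a continuous function that is close to it in mean.\<close>

lemma interval_mean_weighted:
  assumes z: "equid_weight (\<lambda>n. 1) 1 z" and g: "equid_weight g c z" and ab: "0 \<le> a" "a \<le> b" "b \<le> 1"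
  shows "has_mean (\<lambda>n. g n * of_bool (frac (z n) \<in> {a..<b})) (c * of_real (b - a))"
proof (rule has_mean_approx)
  fix e :: real assume e: "e > 0"
  obtain B0 where B0: "\<And>n. norm (g n) \<le> B0" using g by (auto simp: equid_weight_def)
  define B where "B = \<bar>B0\<bar> + norm c + 1"
  have B: "B > 0" "norm (g n) \<le> B" "norm c \<le> B" for n
    using B0[of n] norm_ge_zero[of c] abs_ge_self[of B0] unfolding B_def by linarith+
  obtain u where u: "continuous_on (sphere 0 1) u"
    "near (\<lambda>n. of_bool (frac (z n) \<in> {a..<b})) (\<lambda>n. complex_of_real (u (ee (z n)))) (e / B)"
    "\<bar>integral {0..1} (\<lambda>x. u (ee x)) - (b - a)\<bar> \<le> e / B"
    using interval_near[OF z ab, of "e / B"] B e by auto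
  have "near (\<lambda>n. g n * of_bool (frac (z n) \<in> {a..<b})) (\<lambda>n. g n * complex_of_real (u (ee (z n)))) (B * (e / B))"
    by (rule near_mult[OF u(2)]) (rule B)
  moreover have "norm (c * of_real (integral {0..1} (\<lambda>x. u (ee x)) - (b - a))) \<le> B * (e / B)"
    unfolding norm_mult norm_of_real using B u(3) by (intro mult_mono) auto
  ultimately show "\<exists>t c'. near (\<lambda>n. g n * of_bool (frac (z n) \<in> {a..<b})) t e \<and> has_mean t c' \<and> norm (c' - c * of_real (b - a)) \<le> e"
    using mean_circle[OF g u(1)] B
    by (intro exI[of _ "\<lambda>n. g n * complex_of_real (u (ee (z n)))"] exI[of _ "c * of_real (integral {0..1} (\<lambda>x. u (ee x)))"])
      (auto simp: right_diff_distrib)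
qed

text \<open>Half-open cells, so that each point of \<open>[0,1)\<close> lies in exactly one; kept opaque so
  that sums over cells are not split by the simplifier.\<close>

definition cell :: "nat \<Rightarrow> nat \<Rightarrow> real set" where
  "cell L i = {real i / real L..<(real i + 1) / real L}"

lemma of_real_of_bool: "of_real (of_bool P) = of_bool P"
  by simp

lemma step_approx:
  fixes \<phi> :: "real \<Rightarrow> real"
  assumes \<phi>: "continuous_on {0..1} \<phi>" and e: "\<epsilon> > 0"
  obtains L :: nat where "L \<ge> 1"
    "\<And>t. t \<in> {0..<1} \<Longrightarrow> \<bar>\<phi> t - (\<Sum>i<L. \<phi> (real i / real L) * of_bool (t \<in> cell L i))\<bar> \<le> \<epsilon>"
    "\<bar>integral {0..1} \<phi> - (\<Sum>i<L. \<phi> (real i / real L) * (1 / real L))\<bar> \<le> \<epsilon>"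
proof -
  have "uniformly_continuous_on {0..1} \<phi>"
    by (rule compact_uniformly_continuous) (use \<phi> in auto)
  then obtain d where d: "d > 0" "\<And>s t. s \<in> {0..1} \<Longrightarrow> t \<in> {0..1} \<Longrightarrow> dist s t < d \<Longrightarrow> dist (\<phi> s) (\<phi> t) < \<epsilon>"
    using e unfolding uniformly_continuous_on_def by metis
  obtain L where L: "L \<noteq> 0" "inverse (real L) < d" using real_arch_inverse[of d] d by auto
  have one: "\<bar>\<phi> t - (\<Sum>i<L. \<phi> (real i / real L) * of_bool (t \<in> cell L i))\<bar> \<le> \<epsilon>" if t: "t \<in> {0..<1}" for t
  proof -
    define j where "j = nat \<lfloor>real L * t\<rfloor>"
    have fl: "\<lfloor>real L * t\<rfloor> \<ge> 0" using t by simp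
    have j1: "real j \<le> real L * t" "real L * t < real j + 1"
      using fl unfolding j_def by linarith+
    have "real L * t < real L" using t L by simp
    then have jL: "j < L" using j1 by linarith
    have iff: "t \<in> cell L i \<longleftrightarrow> i = j" for i
    proof -
      have "t \<in> cell L i \<longleftrightarrow> real i \<le> real L * t \<and> real L * t < real i + 1"
        using L by (auto simp: cell_def field_simps)
      also have "\<dots> \<longleftrightarrow> i = j" using j1 by auto
      finally show ?thesis .
    qed
    have "(\<Sum>i<L. \<phi> (real i / real L) * of_bool (t \<in> cell L i)) = (\<Sum>i\<in>{j}. \<phi> (real i / real L))"
      using jL by (intro sum.mono_neutral_cong_right) (auto simp: iff )
    then have "(\<Sum>i<L. \<phi> (real i / real L) * of_bool (t \<in> cell L i)) = \<phi> (j / L)" by simp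
    moreover have "dist (\<phi> t) (\<phi> (j / L)) < \<epsilon>"
    proof (rule d(2))
      have "t < (real j + 1) / real L" "real j / real L \<le> t"
        using j1 L by (simp_all add: pos_less_divide_eq pos_divide_le_eq mult.commute)
      then show "dist t (j / L) < d" using L by (simp add: dist_real_def inverse_eq_divide add_divide_distrib)
    qed (use t jL in auto)
    ultimately show ?thesis by (simp add: dist_real_def)
  qed
  have "((\<lambda>t. \<Sum>i<L. \<phi> (real i / real L) * of_bool (t \<in> cell L i)) has_integral (\<Sum>i<L. \<phi> (real i / real L) * (1 / real L))) {0..1}"
  proof (intro has_integral_sum has_integral_mult_right finite_lessThan)
    fix i assume i: "i \<in> {..<L}"
    show "((\<lambda>t. of_bool (t \<in> cell L i)) has_integral (1 / real L)) {0..1}"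
    proof (rule has_integral_spike_finite)
      show "finite {(real i + 1) / L}" by simp
      have "((\<lambda>x. 1::real) has_integral (1 / real L)) {real i / real L..(real i + 1) / real L}"
        using has_integral_const_real[of "1::real" "real i / real L" "(real i + 1) / real L"] L by (simp add: field_simps)
      then show "((\<lambda>x. if x \<in> {real i / real L..(real i + 1) / real L} then 1 else 0) has_integral (1 / real L)) {0..1::real}"
        by (subst has_integral_restrict) (use i L in \<open>auto simp: field_simps\<close>)
    qed (auto simp: cell_def field_simps)
  qed
  from has_integral_diff[OF integrable_integral[OF integrable_continuous_interval[OF \<phi>]] this]
  have hi: "((\<lambda>x. \<phi> x - (\<Sum>i<L. \<phi> (real i / real L) * of_bool (x \<in> cell L i))) has_integral
      (integral {0..1} \<phi> - (\<Sum>i<L. \<phi> (real i / real L) * (1 / real L)))) (cbox 0 1)"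
    by (simp only: cbox_interval)
  have "norm (integral {0..1} \<phi> - (\<Sum>i<L. \<phi> (real i / real L) * (1 / real L))) \<le> \<epsilon> * measure lborel (cbox 0 (1::real))"
  proof (rule has_integral_bound_spike_finite[OF _ _ hi, of \<epsilon> "{1}"])
    fix x :: real assume "x \<in> cbox 0 1 - {1}"
    then have "x \<in> {0..<1}" by auto
    from one[OF this] show "norm (\<phi> x - (\<Sum>i<L. \<phi> (real i / real L) * of_bool (x \<in> cell L i))) \<le> \<epsilon>"
      by (simp only: real_norm_def)
  qed (use e in auto)
  then show ?thesis using that[of L] L one by auto
qed

lemma mean_continuous:
  fixes \<phi> :: "real \<Rightarrow> real"
  assumes x: "\<And>n. x n \<in> {0..<1}" and g: "\<And>n. norm (g n) \<le> B0"
    and ind: "\<And>a b. 0 \<le> a \<Longrightarrow> a < b \<Longrightarrow> b \<le> 1 \<Longrightarrow> has_mean (\<lambda>n. g n * of_bool (x n \<in> {a..<b})) (c * of_real (b - a))"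
    and \<phi>: "continuous_on {0..1} \<phi>"
  shows "has_mean (\<lambda>n. g n * of_real (\<phi> (x n))) (c * of_real (integral {0..1} \<phi>))"
proof (rule has_mean_approx)
  fix e :: real assume e: "e > 0"
  define B where "B = \<bar>B0\<bar> + norm c + 1"
  have B: "B > 0" "norm (g n) \<le> B" "norm c \<le> B" for n
    using g[of n] norm_ge_zero[of c] abs_ge_self[of B0] unfolding B_def by linarith+
  obtain L :: nat where L: "L \<ge> 1"
    "\<And>t. t \<in> {0..<1} \<Longrightarrow> \<bar>\<phi> t - (\<Sum>i<L. \<phi> (real i / real L) * of_bool (t \<in> cell L i))\<bar> \<le> e / B"
    "\<bar>integral {0..1} \<phi> - (\<Sum>i<L. \<phi> (real i / real L) * (1 / real L))\<bar> \<le> e / B"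
    using step_approx[OF \<phi>, of "e / B"] B e by auto
  define s where "s t = (\<Sum>i<L. \<phi> (real i / real L) * of_bool (t \<in> cell L i))" for t
  have "near (\<lambda>n. g n * of_real (\<phi> (x n))) (\<lambda>n. g n * complex_of_real (s (x n))) (B * (e / B))"
  proof (intro near_mult near_uniform B)
    fix n
    have "norm (complex_of_real (\<phi> (x n) - s (x n))) \<le> e / B"
      using L(2)[OF x[of n]] unfolding s_def norm_of_real by simp
    then show "norm (of_real (\<phi> (x n)) - complex_of_real (s (x n))) \<le> e / B" by simp
  qed
  moreover have "has_mean (\<lambda>n. g n * of_real (s (x n))) (c * of_real (\<Sum>i<L. \<phi> (real i / real L) * (1 / real L)))"
  proof -
    have "has_mean (\<lambda>n. \<Sum>i<L. of_real (\<phi> (real i / real L)) * (g n * of_bool (x n \<in> cell L i)))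
      (\<Sum>i<L. of_real (\<phi> (real i / real L)) * (c * of_real ((real i + 1) / real L - real i / real L)))"
      unfolding cell_def by (intro has_mean_sum has_mean_cmult ind) (use L(1) in \<open>auto simp: field_simps\<close>)
    moreover have "of_real ((real i + 1) / real L - real i / real L) = (of_real (1 / real L) :: complex)" for i
      by (simp add: diff_divide_distrib[symmetric])
    ultimately show ?thesis
      by (simp only: s_def sum_distrib_left of_real_sum of_real_mult of_real_of_bool mult_ac)
  qed
  moreover have "norm (c * of_real ((\<Sum>i<L. \<phi> (real i / real L) * (1 / real L)) - integral {0..1} \<phi>)) \<le> B * (e / B)"
    unfolding norm_mult norm_of_real using B L(3) by (intro mult_mono) (auto simp: abs_minus_commute)
  ultimately show "\<exists>t c'. near (\<lambda>n. g n * of_real (\<phi> (x n))) t e \<and> has_mean t c' \<and> norm (c' - c * of_real (integral {0..1} \<phi>)) \<le> e"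
    using B by (intro exI[of _ "\<lambda>n. g n * complex_of_real (s (x n))"] exI[of _ "c * of_real (\<Sum>i<L. \<phi> (real i / real L) * (1 / real L))"])
      (auto simp: right_diff_distrib)
qed

context seq_phase_group begin

lemma mc_int_trigs:
  assumes "\<And>l::int. (\<lambda>n. ee (of_int l * z n)) \<in> mean_closure \<Lambda>" "\<tau> \<in> trigs int_phases"
  shows "(\<lambda>n. \<tau> (z n)) \<in> mean_closure \<Lambda>"
  using assms(2)
proof (induction rule: trigs.induct)
  case (mono p c)
  then show ?case using assms(1) by (auto simp: int_phases_def intro: mc_cmult)
qed (auto intro: mc_add)

lemma mc_circle:
  assumes z: "\<And>l::int. (\<lambda>n. ee (of_int l * z n)) \<in> mean_closure \<Lambda>" and u: "continuous_on (sphere 0 1) u"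
  shows "(\<lambda>n. complex_of_real (u (ee (z n)))) \<in> mean_closure \<Lambda>"
proof (rule mean_closure_approx)
  obtain \<tau> where \<tau>: "\<tau> \<in> trigs int_phases" "\<And>x. norm (complex_of_real (u (ee x)) - \<tau> x) \<le> 1"
    using circle_approx[OF u, of 1] by auto
  obtain B where B: "\<And>x. norm (\<tau> x) \<le> B" using trigs_bounded[OF \<tau>(1)] by blast
  have "norm (complex_of_real (u (ee (z n)))) \<le> 1 + B" for n
    using norm_triangle_mono[OF \<tau>(2)[of "z n"] B[of "z n"]] by simp
  then show "\<exists>B. \<forall>n. norm (complex_of_real (u (ee (z n)))) \<le> B" by blast
next
  fix e :: real assume "e > 0"
  then obtain \<tau> where \<tau>: "\<tau> \<in> trigs int_phases" "\<And>x. norm (complex_of_real (u (ee x)) - \<tau> x) \<le> e"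
    using circle_approx[OF u] by blast
  then show "\<exists>h\<in>mean_closure \<Lambda>. near (\<lambda>n. complex_of_real (u (ee (z n)))) h e"
    using mc_int_trigs[OF z \<tau>(1)] near_uniform[of "\<lambda>n. complex_of_real (u (ee (z n)))" "\<lambda>n. \<tau> (z n)" e] by blast
qed

lemma mc_interval:
  assumes z: "\<And>l::int. (\<lambda>n. ee (of_int l * z n)) \<in> mean_closure \<Lambda>" and eq: "equid_weight (\<lambda>n. 1) 1 z"
    and ab: "0 \<le> a" "a \<le> b" "b \<le> 1"
  shows "(\<lambda>n. of_bool (frac (z n) \<in> {a..<b})) \<in> mean_closure \<Lambda>"
proof (rule mean_closure_approx)
  show "\<exists>B. \<forall>n. norm (of_bool (frac (z n) \<in> {a..<b}) :: complex) \<le> B"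
    by (intro exI[of _ 1]) auto
  fix e :: real assume e: "e > 0"
  show "\<exists>h\<in>mean_closure \<Lambda>. near (\<lambda>n. of_bool (frac (z n) \<in> {a..<b})) h e"
  proof -
    obtain u where "continuous_on (sphere 0 1) u"
      "near (\<lambda>n. of_bool (frac (z n) \<in> {a..<b})) (\<lambda>n. complex_of_real (u (ee (z n)))) e"
      using interval_near[OF eq ab e] by blast
    then show ?thesis using mc_circle[OF z] by blast
  qed
qed

lemma mc_frac:
  assumes z: "\<And>l::int. (\<lambda>n. ee (of_int l * z n)) \<in> mean_closure \<Lambda>" and eq: "equid_weight (\<lambda>n. 1) 1 z"
  shows "(\<lambda>n. complex_of_real (frac (z n))) \<in> mean_closure \<Lambda>"
proof (rule mean_closure_approx)
  show "\<exists>B. \<forall>n. norm (complex_of_real (frac (z n))) \<le> B"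
    by (intro exI[of _ 1]) (simp add: less_imp_le[OF frac_lt_1] abs_of_nonneg)
  fix e :: real assume e: "e > 0"
  obtain L :: nat where L: "L \<ge> 1"
    "\<And>t. t \<in> {0..<1} \<Longrightarrow> \<bar>t - (\<Sum>i<L. (real i / real L) * of_bool (t \<in> cell L i))\<bar> \<le> e"
    using step_approx[of "\<lambda>t. t", OF continuous_on_id e] by blast
  define s where "s t = (\<Sum>i<L. (real i / real L) * of_bool (t \<in> cell L i))" for t
  have "near (\<lambda>n. complex_of_real (frac (z n))) (\<lambda>n. complex_of_real (s (frac (z n)))) e"
  proof (rule near_uniform)
    fix n
    have "norm (complex_of_real (frac (z n) - s (frac (z n)))) \<le> e"
      using L(2)[of "frac (z n)"] unfolding s_def norm_of_real by (simp add: frac_lt_1)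
    then show "norm (of_real (frac (z n)) - complex_of_real (s (frac (z n)))) \<le> e" by simp
  qed
  moreover have "(\<lambda>n. \<Sum>i<L. of_real (real i / real L) * of_bool (frac (z n) \<in> cell L i)) \<in> mean_closure \<Lambda>"
    unfolding cell_def by (intro mc_sum mc_cmult mc_interval z eq) (use L(1) in \<open>auto simp: field_simps\<close>)
  then have "(\<lambda>n. complex_of_real (s (frac (z n)))) \<in> mean_closure \<Lambda>"
    by (simp only: s_def of_real_sum of_real_mult of_real_of_bool)
  ultimately show "\<exists>h\<in>mean_closure \<Lambda>. near (\<lambda>n. complex_of_real (frac (z n))) h e"
    by blast
qed

end

section \<open>The power identity and its polynomial\<close>

unbundle no vec_syntax
unbundle fps_syntax

definition coeff_series :: "(nat \<Rightarrow> real) \<Rightarrow> real fps" where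
  "coeff_series f = Abs_fps (\<lambda>n. if n = 0 then 0 else f n)"

text \<open>The sum of \<open>f j\<^sub>1 * \<dots> * f j\<^sub>s\<close> over all compositions \<open>n =
  j\<^sub>1 + \<dots> + j\<^sub>s\<close>, here as a coefficient of \<open>1 / (1 - F)\<close>. The value
  \<open>f 0\<close> is ignored.\<close>

definition comp_sum :: "(nat \<Rightarrow> real) \<Rightarrow> nat \<Rightarrow> real" where
  "comp_sum f n = inverse (1 - coeff_series f) $ n"

text \<open>With \<open>k * f k\<close> added, this is \<open>k\<close> times the coefficient of
  \<open>t^k\<close> in \<open>- log (1 - F)\<close>; leaving that term out makes it a polynomial in \<open>f
  1, \<dots>, f (k - 1)\<close>.\<close>

definition cyc_poly :: "nat \<Rightarrow> (nat \<Rightarrow> real) \<Rightarrow> real" where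
  "cyc_poly k f = (\<Sum>j\<in>{1..<k}. real j * f j * comp_sum f (k - j))"

lemma coeff_series_0 [simp]: "coeff_series f $ 0 = 0"
  by (simp add: coeff_series_def)

lemma unit_coeff_series: "(1 - coeff_series f) * inverse (1 - coeff_series f) = 1"
  by (rule inverse_mult_eq_1') simp

lemma comp_sum_0 [simp]: "comp_sum f 0 = 1"
  by (simp add: comp_sum_def)

lemma comp_sum_rec:
  assumes "n \<ge> 1"
  shows "comp_sum f n = (\<Sum>j\<in>{1..n}. f j * comp_sum f (n - j))"
proof -
  have "inverse (1 - coeff_series f) = 1 + coeff_series f * inverse (1 - coeff_series f)"
    using unit_coeff_series[of f] by (simp add: algebra_simps)
  then have "comp_sum f n = (1 + coeff_series f * inverse (1 - coeff_series f)) $ n"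
    unfolding comp_sum_def by (rule arg_cong)
  also have "\<dots> = (\<Sum>j=0..n. coeff_series f $ j * comp_sum f (n - j))"
    using assms by (simp add: fps_mult_nth comp_sum_def)
  also have "\<dots> = (\<Sum>j\<in>{1..n}. f j * comp_sum f (n - j))"
    by (rule sum.mono_neutral_cong_right) (auto simp: coeff_series_def)
  finally show ?thesis .
qed

lemma log_deriv_nth:
  assumes "k \<ge> 1"
  shows "(fps_X * fps_deriv (coeff_series f) * inverse (1 - coeff_series f)) $ k = real k * f k + cyc_poly k f"
proof -
  have X: "(fps_X * fps_deriv (coeff_series f)) $ j = real j * f j" for j
    by (cases j) (simp_all add: coeff_series_def)
  have "(fps_X * fps_deriv (coeff_series f) * inverse (1 - coeff_series f)) $ k
      = (\<Sum>j=0..k. real j * f j * comp_sum f (k - j))"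
    by (simp only: fps_mult_nth[of "fps_X * fps_deriv (coeff_series f)"] X comp_sum_def)
  also have "\<dots> = (\<Sum>j\<in>{1..k}. real j * f j * comp_sum f (k - j))"
    by (rule sum.mono_neutral_right) auto
  also have "{1..k} = insert k {1..<k}" using assms by auto
  finally show ?thesis by (simp add: cyc_poly_def)
qed

text \<open>Newton's identities for the power sums belonging to the series \<open>M = \<Sum> m\<^sub>j
  t^j\<close>: these are the coefficients of \<open>t M' / M\<close>, and the recursion shows that they are
  integers.\<close>

fun newton_sum :: "(nat \<Rightarrow> int) \<Rightarrow> nat \<Rightarrow> int" where
  "newton_sum m k = int k * m k - (\<Sum>j\<in>{1..<k}. newton_sum m j * m (k - j))"

declare newton_sum.simps [simp del]

text \<open>The coefficient of \<open>t^k\<close> in the logarithmic derivative, multiplied by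
  \<open>t\<close>, of \<open>(1 - x t) M = 1 - F\<close>. The proof multiplies through by \<open>1 -
  F\<close> to stay with power series.\<close>

theorem power_decomposition:
  fixes x :: real and m :: "nat \<Rightarrow> int" and f :: "nat \<Rightarrow> real"
  assumes m0: "m 0 = 1" and rec: "\<And>j. of_int (m (Suc j)) + f (Suc j) = x * of_int (m j)"
    and k: "k \<ge> 1"
  shows "x ^ k = of_int (newton_sum m k) + real k * f k + cyc_poly k f"
proof -
  define M where "M = Abs_fps (\<lambda>n. real_of_int (m n))"
  define W where "W = 1 - fps_const x * fps_X"
  define F where "F = coeff_series f"
  define N where "N = Abs_fps (\<lambda>n. if n = 0 then 0 else real_of_int (newton_sum m n))"
  define G where "G = fps_X * fps_deriv F * inverse (1 - F)"
  define Y where "Y = Abs_fps (\<lambda>n. if n = 0 then 0 else x ^ n)"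
  have WM: "W * M = 1 - F"
  proof (rule fps_ext)
    fix n
    show "(W * M) $ n = (1 - F) $ n"
    proof (cases n)
      case 0
      then show ?thesis by (simp add: W_def M_def F_def m0)
    next
      case (Suc j)
      then show ?thesis using rec[of j]
        by (simp add: W_def M_def F_def left_diff_distrib mult.assoc coeff_series_def)
    qed
  qed
  have NM: "N * M = fps_X * fps_deriv M"
  proof (rule fps_ext)
    fix n
    show "(N * M) $ n = (fps_X * fps_deriv M) $ n"
    proof (cases "n = 0")
      case True
      then show ?thesis by (simp add: N_def)
    next
      case False
      have "(N * M) $ n = (\<Sum>i=0..n. N $ i * M $ (n - i))" by (simp add: fps_mult_nth)
      also have "\<dots> = (\<Sum>i\<in>{1..n}. real_of_int (newton_sum m i * m (n - i)))"
        by (rule sum.mono_neutral_cong_right) (auto simp: N_def M_def)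
      also have "{1..n} = insert n {1..<n}" using False by auto
      also have "(\<Sum>i\<in>insert n {1..<n}. real_of_int (newton_sum m i * m (n - i)))
          = real_of_int (newton_sum m n + (\<Sum>i\<in>{1..<n}. newton_sum m i * m (n - i)))"
        by (simp add: m0)
      also have "newton_sum m n + (\<Sum>i\<in>{1..<n}. newton_sum m i * m (n - i)) = int n * m n"
        by (subst newton_sum.simps) simp
      finally show ?thesis using False by (cases n) (simp_all add: M_def)
    qed
  qed
  have YW: "Y * W = fps_const x * fps_X"
  proof (rule fps_ext)
    fix n
    have "Y * W = Y - fps_const x * (fps_X * Y)" by (simp add: W_def algebra_simps)
    then have "(Y * W) $ n = Y $ n - x * (fps_X * Y) $ n" by simp
    then show "(Y * W) $ n = (fps_const x * fps_X) $ n"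
      by (cases n; cases "n - 1") (auto simp: Y_def)
  qed
  have GF: "G * (1 - F) = fps_X * fps_deriv F"
  proof -
    have "G * (1 - F) = fps_X * fps_deriv F * ((1 - F) * inverse (1 - F))"
      by (simp add: G_def mult_ac)
    then show ?thesis using unit_coeff_series[of f] by (simp add: F_def)
  qed
  have D: "W * fps_deriv M - fps_const x * M = - fps_deriv F"
  proof -
    have "fps_deriv (W * M) = fps_deriv (1 - F)" by (simp add: WM)
    then show ?thesis by (simp add: W_def algebra_simps)
  qed
  have "(N + G) * (1 - F) = N * M * W + G * (1 - F)"
    by (simp add: WM[symmetric] algebra_simps)
  also have "\<dots> = fps_X * (W * fps_deriv M + fps_deriv F)"
    by (simp only: NM GF) (simp add: algebra_simps)
  also have "W * fps_deriv M + fps_deriv F = fps_const x * M"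
    using D by (simp add: algebra_simps)
  also have "fps_X * (fps_const x * M) = Y * W * M"
    unfolding YW by (simp only: mult_ac)
  also have "\<dots> = Y * (1 - F)" by (simp add: WM mult.assoc)
  finally have "(N + G) * (1 - F) = Y * (1 - F)" .
  moreover have "1 - F \<noteq> 0" unfolding F_def using unit_coeff_series[of f] by auto
  ultimately have "N + G = Y" by simp
  then have "Y $ k = N $ k + G $ k" by auto
  then show ?thesis using k log_deriv_nth[OF k, of f] by (simp add: Y_def N_def G_def F_def)
qed

lemma comp_sum_cong:
  "(\<And>j. j \<in> {1..n} \<Longrightarrow> f j = g j) \<Longrightarrow> comp_sum f n = comp_sum g n"
proof (induction n rule: less_induct)
  case (less n)
  show ?case
  proof (cases "n \<ge> 1")
    case True
    then show ?thesis
      unfolding comp_sum_rec[OF True] using less.prems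
      by (intro sum.cong refl arg_cong2[of _ _ _ _ "(*)"] less.IH) auto
  next
    case False
    then have "n = 0" by simp
    then show ?thesis by simp
  qed
qed

lemma cyc_poly_cong:
  "(\<And>j. j \<in> {1..<k} \<Longrightarrow> f j = g j) \<Longrightarrow> cyc_poly k f = cyc_poly k g"
  unfolding cyc_poly_def by (intro sum.cong refl arg_cong2[of _ _ _ _ "(*)"] comp_sum_cong) auto

definition lo_part :: "nat \<Rightarrow> (nat \<Rightarrow> real) \<Rightarrow> nat \<Rightarrow> real" where
  "lo_part h f j = (if j \<le> h then f j else 0)"

definition hi_part :: "nat \<Rightarrow> (nat \<Rightarrow> real) \<Rightarrow> nat \<Rightarrow> real" where
  "hi_part h f j = (if j \<le> h then 0 else f j)"

text \<open>A monomial of \<open>cyc_poly k\<close> has weight \<open>k\<close>, so it contains at most one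
  coordinate of index above \<open>k/2\<close>, once. In terms of series, with \<open>F = Fl + Fh\<close>
  split into low and high part and \<open>K = 1 / (1 - Fl)\<close>, the logarithmic derivative is \<open>t Fl'
  K + t (Fh K)'\<close> up to a multiple of \<open>Fh^2\<close>, which has no terms up to degree
  \<open>k\<close>.\<close>

theorem cyc_poly_affine:
  assumes k: "k \<ge> 1"
  defines "h \<equiv> k div 2"
  shows "cyc_poly k f = cyc_poly k (lo_part h f) + (\<Sum>j\<in>{h+1..<k}. f j * (real k * comp_sum f (k - j)))"
proof -
  define Fl where "Fl = coeff_series (lo_part h f)"
  define Fh where "Fh = coeff_series (hi_part h f)"
  define F where "F = coeff_series f"
  define K where "K = inverse (1 - Fl)"
  define G where "G = fps_X * fps_deriv F * inverse (1 - F)"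
  define D where "D = G - fps_X * fps_deriv Fl * K - fps_X * fps_deriv (Fh * K)"
  have F: "F = Fl + Fh"
    by (rule fps_ext) (simp add: F_def Fl_def Fh_def coeff_series_def lo_part_def hi_part_def)
  have KE: "(1 - Fl) * K = 1" unfolding K_def Fl_def by (rule unit_coeff_series)
  have GF: "G * (1 - F) = fps_X * fps_deriv F"
  proof -
    have "G * (1 - F) = fps_X * fps_deriv F * ((1 - F) * inverse (1 - F))"
      by (simp add: G_def mult_ac)
    then show ?thesis using unit_coeff_series[of f] by (simp add: F_def)
  qed
  have dK: "fps_deriv K = fps_deriv Fl * K * K"
  proof -
    have "fps_deriv ((1 - Fl) * K) = 0" by (simp add: KE)
    then have "(1 - Fl) * fps_deriv K = fps_deriv Fl * K" by (simp add: algebra_simps)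
    then have "K * ((1 - Fl) * fps_deriv K) = K * (fps_deriv Fl * K)" by simp
    moreover have "K * ((1 - Fl) * fps_deriv K) = (1 - Fl) * K * fps_deriv K" by (simp only: mult_ac)
    ultimately have "fps_deriv K = K * (fps_deriv Fl * K)" using KE by simp
    then show ?thesis by (simp only: mult_ac)
  qed
  have KE': "X * K * (1 - Fl) = X" for X
  proof -
    have "X * K * (1 - Fl) = X * ((1 - Fl) * K)" by (simp only: mult_ac)
    then show ?thesis using KE by simp
  qed
  \<comment> \<open>\<open>D\<close> is the error of the first-order expansion in \<open>Fh\<close>.\<close>
  have main: "D * (1 - F) = Fh * (fps_X * fps_deriv (Fh * K))"
  proof -
    define A where "A = fps_X * fps_deriv Fl"
    have dFhK: "fps_deriv (Fh * K) = fps_deriv Fh * K + Fh * (fps_deriv Fl * K * K)"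
      by (simp add: dK algebra_simps)
    have 1: "A * K * (1 - F) = A - A * K * Fh"
    proof -
      have "A * K * (1 - F) = A * K * (1 - Fl) - A * K * Fh" by (simp add: F algebra_simps)
      then show ?thesis by (simp add: KE')
    qed
    have 2: "fps_X * fps_deriv (Fh * K) * (1 - Fl) = fps_X * fps_deriv Fh + A * K * Fh"
    proof -
      have "fps_X * fps_deriv (Fh * K) * (1 - Fl)
         = (fps_X * fps_deriv Fh) * K * (1 - Fl) + (Fh * A * K) * K * (1 - Fl)"
        unfolding dFhK A_def by (simp only: distrib_left distrib_right mult_ac)
      then show ?thesis unfolding KE' by (simp only: mult_ac)
    qed
    have 3: "fps_X * fps_deriv (Fh * K) * (1 - F) = fps_X * fps_deriv Fh + A * K * Fh - Fh * (fps_X * fps_deriv (Fh * K))"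
    proof -
      have "Z * (1 - (Fl + Fh)) = Z * (1 - Fl) - Fh * Z" for Z by (simp add: algebra_simps)
      then show ?thesis unfolding F using 2 by simp
    qed
    have "D * (1 - F) = fps_X * fps_deriv F - A * K * (1 - F) - fps_X * fps_deriv (Fh * K) * (1 - F)"
      unfolding D_def A_def using GF by (simp add: left_diff_distrib)
    then show ?thesis unfolding 1 3 by (simp add: F A_def algebra_simps)
  qed
  have Fh0: "Fh $ i = 0" if "i \<le> h" for i
    using that by (simp add: Fh_def coeff_series_def hi_part_def)
  have FhK0: "(Fh * K) $ i = 0" if "i \<le> h" for i
    using that by (auto simp: fps_mult_nth Fh0 intro!: sum.neutral)
  have XFhK: "(fps_X * fps_deriv (Fh * K)) $ i = real i * (Fh * K) $ i" for i
    by (cases i) (simp_all del: fps_deriv_mult)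
  have small: "(Fh * (fps_X * fps_deriv (Fh * K))) $ n = 0" if "n \<le> k" for n
    unfolding fps_mult_nth[of Fh "fps_X * fps_deriv (Fh * K)"]
  proof (intro sum.neutral ballI)
    fix i assume i: "i \<in> {0..n}"
    show "Fh $ i * (fps_X * fps_deriv (Fh * K)) $ (n - i) = 0"
    proof (cases "i \<le> h")
      case True
      then show ?thesis by (simp add: Fh0)
    next
      case False
      then have "n - i \<le> h" using that by (simp add: h_def)
      then show ?thesis unfolding XFhK by (simp add: FhK0)
    qed
  qed
  have D: "D = Fh * (fps_X * fps_deriv (Fh * K)) * inverse (1 - F)"
  proof -
    have "D = D * ((1 - F) * inverse (1 - F))" using unit_coeff_series[of f] by (simp add: F_def)
    then show ?thesis using main by (simp add: mult.assoc[symmetric])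
  qed
  have "D $ k = 0"
    unfolding D fps_mult_nth[of _ "inverse (1 - F)"] by (intro sum.neutral ballI) (simp add: small del: fps_deriv_mult)
  then have "G $ k = (fps_X * fps_deriv Fl * K) $ k + (fps_X * fps_deriv (Fh * K)) $ k"
    by (simp add: D_def)
  moreover have "G $ k = real k * f k + cyc_poly k f"
    unfolding G_def F_def by (rule log_deriv_nth) (rule k)
  moreover have "(fps_X * fps_deriv Fl * K) $ k = cyc_poly k (lo_part h f)"
    unfolding Fl_def K_def using k by (simp add: log_deriv_nth lo_part_def h_def)
  moreover have "(Fh * K) $ k = f k + (\<Sum>j\<in>{h+1..<k}. f j * comp_sum f (k - j))"
  proof -
    have "(Fh * K) $ k = (\<Sum>j=0..k. Fh $ j * K $ (k - j))" by (rule fps_mult_nth)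
    also have "\<dots> = (\<Sum>j\<in>insert k {h+1..<k}. f j * comp_sum f (k - j))"
    proof (rule sum.mono_neutral_cong_right)
      show "insert k {h + 1..<k} \<subseteq> {0..k}" by auto
      show "\<forall>i\<in>{0..k} - insert k {h + 1..<k}. Fh $ i * K $ (k - i) = 0"
        by (auto simp: Fh0)
      fix j assume j: "j \<in> insert k {h + 1..<k}"
      have "j \<ge> h + 1" using j k by (auto simp: h_def)
      have "comp_sum (lo_part h f) (k - j) = comp_sum f (k - j)"
        using \<open>j \<ge> h + 1\<close> by (intro comp_sum_cong) (auto simp: lo_part_def h_def)
      then show "Fh $ j * K $ (k - j) = f j * comp_sum f (k - j)"
        using \<open>j \<ge> h + 1\<close> by (simp add: Fh_def K_def Fl_def comp_sum_def coeff_series_def hi_part_def)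
    qed simp
    also have "\<dots> = f k + (\<Sum>j\<in>{h+1..<k}. f j * comp_sum f (k - j))" by simp
    finally show ?thesis .
  qed
  ultimately have "real k * f k + cyc_poly k f
      = cyc_poly k (lo_part h f) + real k * (f k + (\<Sum>j\<in>{h+1..<k}. f j * comp_sum f (k - j)))"
    by (simp only: XFhK)
  then show ?thesis
    by (simp add: distrib_left sum_distrib_left mult_ac)
qed

lemma comp_sum_nonneg:
  "(\<And>j. 1 \<le> j \<Longrightarrow> j \<le> n \<Longrightarrow> 0 \<le> f j) \<Longrightarrow> 0 \<le> comp_sum f n"
proof (induction n rule: less_induct)
  case (less n)
  show ?case
  proof (cases "n \<ge> 1")
    case True
    then show ?thesis
      unfolding comp_sum_rec[OF True] using less.prems
      by (intro sum_nonneg mult_nonneg_nonneg less.IH) auto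
  next
    case False
    then have "n = 0" by simp
    then show ?thesis by simp
  qed
qed

lemma comp_sum_term_le:
  assumes "\<And>j. 1 \<le> j \<Longrightarrow> j \<le> n \<Longrightarrow> 0 \<le> f j" "1 \<le> j" "j \<le> n"
  shows "f j * comp_sum f (n - j) \<le> comp_sum f n"
proof -
  have n: "n \<ge> 1" using assms by simp
  show ?thesis unfolding comp_sum_rec[OF n]
    by (rule member_le_sum[of j "{1..n}" "\<lambda>j. f j * comp_sum f (n - j)"])
      (use assms in \<open>auto intro!: mult_nonneg_nonneg comp_sum_nonneg\<close>)
qed

lemma comp_sum_ge:
  assumes "\<And>j. 1 \<le> j \<Longrightarrow> j \<le> n \<Longrightarrow> 0 \<le> f j" "1 \<le> n"
  shows "f n \<le> comp_sum f n"
  using comp_sum_term_le[of n f n] assms by simp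

lemma comp_sum_mono:
  "(\<And>j. 1 \<le> j \<Longrightarrow> j \<le> n \<Longrightarrow> 0 \<le> f j) \<Longrightarrow> (\<And>j. 1 \<le> j \<Longrightarrow> j \<le> n \<Longrightarrow> f j \<le> g j) \<Longrightarrow> comp_sum f n \<le> comp_sum g n"
proof (induction n rule: less_induct)
  case (less n)
  show ?case
  proof (cases "n \<ge> 1")
    case True
    have g0: "0 \<le> g j" if "1 \<le> j" "j \<le> n" for j
      using less.prems that order_trans by blast
    show ?thesis
      unfolding comp_sum_rec[OF True] using less.prems g0
      by (intro sum_mono mult_mono less.IH comp_sum_nonneg) auto
  next
    case False
    then have "n = 0" by simp
    then show ?thesis by simp
  qed
qed

text \<open>There are at most \<open>2 ^ n\<close> compositions, and each contributes a term of weight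
  \<open>n\<close>.\<close>

lemma comp_sum_le:
  assumes "\<delta> \<ge> 0"
  shows "(\<And>j. 1 \<le> j \<Longrightarrow> j \<le> n \<Longrightarrow> 0 \<le> f j \<and> f j \<le> \<delta> ^ j) \<Longrightarrow> comp_sum f n \<le> 2 ^ n * \<delta> ^ n"
proof (induction n rule: less_induct)
  case (less n)
  show ?case
  proof (cases "n \<ge> 1")
    case True
    have "comp_sum f n \<le> (\<Sum>j\<in>{1..n}. \<delta> ^ j * (2 ^ (n - j) * \<delta> ^ (n - j)))"
      unfolding comp_sum_rec[OF True] using less.prems assms
      by (intro sum_mono mult_mono less.IH comp_sum_nonneg) auto
    also have "\<dots> = (\<Sum>j\<in>{1..n}. \<delta> ^ n * 2 ^ (n - j))"
      by (rule sum.cong) (auto simp: mult_ac power_add[symmetric])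
    also have "\<dots> = \<delta> ^ n * (\<Sum>j\<in>{1..n}. 2 ^ (n - j))" by (simp add: sum_distrib_left)
    also have "(\<Sum>j\<in>{1..n}. 2 ^ (n - j)) = (\<Sum>i<n. (2::real) ^ i)"
      by (rule sum.reindex_bij_witness[of _ "\<lambda>i. n - i" "\<lambda>i. n - i"]) auto
    also have "(\<Sum>i<n. (2::real) ^ i) = 2 ^ n - 1" by (simp add: sum_gp_strict)
    also have "\<delta> ^ n * (2 ^ n - 1) \<le> \<delta> ^ n * 2 ^ n" using assms by (intro mult_left_mono) auto
    finally show ?thesis by (simp add: mult.commute)
  next
    case False
    then have "n = 0" by simp
    then show ?thesis by simp
  qed
qed

lemma cyc_poly_nonneg: "(\<And>j. 1 \<le> j \<Longrightarrow> j < k \<Longrightarrow> 0 \<le> f j) \<Longrightarrow> 0 \<le> cyc_poly k f"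
  unfolding cyc_poly_def by (intro sum_nonneg mult_nonneg_nonneg comp_sum_nonneg) auto

lemma cyc_poly_le:
  assumes "\<delta> \<ge> 0" "\<And>j. 1 \<le> j \<Longrightarrow> j < k \<Longrightarrow> 0 \<le> f j \<and> f j \<le> \<delta> ^ j"
  shows "cyc_poly k f \<le> (real k)\<^sup>2 * 2 ^ k * \<delta> ^ k"
proof -
  have "cyc_poly k f \<le> (\<Sum>j\<in>{1..<k}. real k * \<delta> ^ j * (2 ^ k * \<delta> ^ (k - j)))"
    unfolding cyc_poly_def
  proof (intro sum_mono mult_mono)
    fix j assume j: "j \<in> {1..<k}"
    have "comp_sum f (k - j) \<le> 2 ^ (k - j) * \<delta> ^ (k - j)"
      by (rule comp_sum_le) (use assms j in auto)
    also have "\<dots> \<le> 2 ^ k * \<delta> ^ (k - j)"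
      using assms by (intro mult_right_mono power_increasing) auto
    finally show "comp_sum f (k - j) \<le> 2 ^ k * \<delta> ^ (k - j)" .
    show "0 \<le> comp_sum f (k - j)" by (rule comp_sum_nonneg) (use assms j in auto)
  qed (use assms in auto)
  also have "\<dots> = (\<Sum>j\<in>{1..<k}. real k * (2 ^ k * \<delta> ^ k))"
    by (rule sum.cong) (auto simp: mult_ac power_add[symmetric])
  also have "\<dots> = real (k - 1) * (real k * (2 ^ k * \<delta> ^ k))" by simp
  also have "\<dots> \<le> real k * (real k * (2 ^ k * \<delta> ^ k))"
    using assms by (intro mult_right_mono) auto
  finally show ?thesis by (simp add: power2_eq_square mult_ac)
qed

text \<open>All coefficients are nonnegative, so the increase of the summand \<open>j = i\<close> of the
  definition bounds the whole increase from below.\<close>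

lemma cyc_poly_increment:
  assumes f: "\<And>j. 1 \<le> j \<Longrightarrow> j < k \<Longrightarrow> 0 \<le> f j" and i: "1 \<le> i" "i < k" and s: "f i \<le> s"
  shows "cyc_poly k f + (s - f i) * comp_sum f (k - i) \<le> cyc_poly k (f(i := s))"
proof -
  let ?g = "f(i := s)"
  have le: "f j \<le> ?g j" for j using s by auto
  have cm: "comp_sum f (k - j) \<le> comp_sum ?g (k - j)" "0 \<le> comp_sum f (k - j)" if "1 \<le> j" for j
    using that f le by (auto intro!: comp_sum_mono comp_sum_nonneg)
  have split: "{1..<k} = insert i ({1..<k} - {i})" using i by auto
  have a: "(\<Sum>j\<in>{1..<k} - {i}. real j * f j * comp_sum f (k - j)) \<le> (\<Sum>j\<in>{1..<k} - {i}. real j * ?g j * comp_sum ?g (k - j))"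
    using f cm by (intro sum_mono mult_mono) (auto intro: le)
  have "(s - f i) * comp_sum f (k - i) \<le> real i * ((s - f i) * comp_sum f (k - i))"
    using i s cm(2)[OF i(1)] mult_right_mono[of 1 "real i" "(s - f i) * comp_sum f (k - i)"] by simp
  then have "real i * f i * comp_sum f (k - i) + (s - f i) * comp_sum f (k - i) \<le> real i * s * comp_sum f (k - i)"
    by (simp add: algebra_simps)
  also have "\<dots> \<le> real i * s * comp_sum ?g (k - i)"
    using cm(1)[OF i(1)] i s f[OF i] by (intro mult_left_mono) auto
  finally have b: "real i * f i * comp_sum f (k - i) + (s - f i) * comp_sum f (k - i) \<le> real i * ?g i * comp_sum ?g (k - i)"
    by simp
  have "cyc_poly k f = real i * f i * comp_sum f (k - i) + (\<Sum>j\<in>{1..<k} - {i}. real j * f j * comp_sum f (k - j))"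
    unfolding cyc_poly_def by (subst split) (rule sum.insert; simp)
  moreover have "cyc_poly k ?g = real i * ?g i * comp_sum ?g (k - i) + (\<Sum>j\<in>{1..<k} - {i}. real j * ?g j * comp_sum ?g (k - j))"
    unfolding cyc_poly_def by (subst split) (rule sum.insert; simp)
  ultimately show ?thesis using a b by linarith
qed

lemma exists_large_term:
  fixes g :: "nat \<Rightarrow> real"
  assumes "finite A" "(\<Sum>j\<in>A. g j) \<ge> c" "card A \<le> n" "c > 0"
  shows "\<exists>j\<in>A. g j \<ge> c / real n"
proof (rule ccontr)
  assume "\<not> ?thesis"
  then have less: "\<forall>j\<in>A. g j < c / real n" by auto
  have ne: "A \<noteq> {}" using assms by auto
  then have card: "card A > 0" using assms by (simp add: card_gt_0_iff)
  have "(\<Sum>j\<in>A. g j) < (\<Sum>j\<in>A. c / real n)" using less ne assms by (intro sum_strict_mono) auto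
  also have "\<dots> = real (card A) * (c / real n)" by simp
  also have "\<dots> \<le> real n * (c / real n)" using assms by (intro mult_right_mono) auto
  also have "\<dots> = c" using card assms by simp
  finally show False using assms by simp
qed

text \<open>If the polynomial is not small, one of its summands \<open>j * f j * comp_sum f (k - j)\<close> is
  not small, and then neither are its factors. If \<open>j\<close> is a high index, a summand of
  \<open>comp_sum f (k - j)\<close> provides a low index \<open>i \<le> k - j\<close> instead, and \<open>f j
  * comp_sum f (k - j - i)\<close> is a part of \<open>comp_sum f (k - i)\<close>. The second conclusion
  bounds the slope of \<open>cyc_poly k\<close> in the direction of that coordinate.\<close>

lemma low_coordinate:
  fixes c0 :: real
  assumes k: "k \<ge> 1" and c0: "c0 > 0"
  obtains c where "c > 0"
    "\<And>f. (\<And>j. 1 \<le> j \<Longrightarrow> j < k \<Longrightarrow> 0 \<le> f j \<and> f j \<le> 1) \<Longrightarrow> cyc_poly k f \<ge> c0 \<Longrightarrow>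
       \<exists>i\<in>{1..k div 2}. f i \<ge> c \<and> comp_sum f (k - i) \<ge> c"
proof -
  define a where "a = c0 / real k / real k / 2 ^ k"
  define b where "b = c0 / real k / real k / real k / 2 ^ k"
  have ab: "a > 0" "b > 0" using c0 k by (simp_all add: a_def b_def)
  show ?thesis
  proof (rule that[of "min a (min b (a * b))"])
    show "min a (min b (a * b)) > 0" using ab by simp
    fix f :: "nat \<Rightarrow> real" assume f: "\<And>j. 1 \<le> j \<Longrightarrow> j < k \<Longrightarrow> 0 \<le> f j \<and> f j \<le> 1"
      and P: "cyc_poly k f \<ge> c0"
    have H0: "0 \<le> comp_sum f n" if "n < k" for n
      using f that by (intro comp_sum_nonneg) auto
    have H1: "comp_sum f n \<le> 2 ^ k" if "n < k" for n
    proof -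
      have "comp_sum f n \<le> 2 ^ n * 1 ^ n" using f that by (intro comp_sum_le) auto
      also have "\<dots> \<le> 2 ^ k" using that by simp
      finally show ?thesis .
    qed
    have prod: "u \<ge> t / 2 ^ k" "v \<ge> t" if "u * v \<ge> t" "0 \<le> u" "u \<le> 1" "0 \<le> v" "v \<le> 2 ^ k" for u v t :: real
    proof -
      have "u * v \<le> u * 2 ^ k" "u * v \<le> v"
        using that mult_left_le_one_le[of v u] by (auto intro!: mult_left_mono)
      then show "u \<ge> t / 2 ^ k" "v \<ge> t" using that by (auto simp: field_simps)
    qed
    have shrink: "t / 2 ^ k \<le> t" if "t \<ge> 0" for t :: real
      using that divide_left_mono[of 1 "2 ^ k" t] by simp
    obtain j where j: "j \<in> {1..<k}" "real j * f j * comp_sum f (k - j) \<ge> c0 / real k"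
      using exists_large_term[of "{1..<k}" c0 "\<lambda>j. real j * f j * comp_sum f (k - j)" k] P c0
      by (auto simp: cyc_poly_def)
    have "f j * comp_sum f (k - j) \<ge> c0 / real k / real k"
    proof -
      have "c0 / real k \<le> real j * (f j * comp_sum f (k - j))" using j by (simp add: mult.assoc)
      also have "\<dots> \<le> real k * (f j * comp_sum f (k - j))"
        using j f[of j] H0[of "k - j"] by (intro mult_right_mono) auto
      finally show ?thesis using k by (simp add: field_simps)
    qed
    note pj = prod[OF this]
    have fj: "f j \<ge> a" and Hj: "comp_sum f (k - j) \<ge> c0 / real k / real k"
      using pj f[of j] H0[of "k - j"] H1[of "k - j"] j by (auto simp: a_def)
    show "\<exists>i\<in>{1..k div 2}. f i \<ge> min a (min b (a * b)) \<and> comp_sum f (k - i) \<ge> min a (min b (a * b))"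
    proof (cases "j \<le> k div 2")
      case True
      have "comp_sum f (k - j) \<ge> a" using Hj shrink[of "c0 / real k / real k"] c0 by (simp add: a_def)
      then show ?thesis using fj True j by (intro bexI[of _ j]) auto
    next
      case False
      define n where "n = k - j"
      have n: "1 \<le> n" "n \<le> k div 2" "n < k" using j False by (auto simp: n_def)
      obtain i where i: "i \<in> {1..n}" "f i * comp_sum f (n - i) \<ge> c0 / real k / real k / real k"
        using exists_large_term[of "{1..n}" "c0 / real k / real k" "\<lambda>i. f i * comp_sum f (n - i)" k]
          Hj c0 k n comp_sum_rec[OF n(1), of f] by (auto simp: n_def)
      note pi = prod[OF i(2)]
      have fi: "f i \<ge> b" and Hi: "comp_sum f (n - i) \<ge> c0 / real k / real k / real k"
        using pi f[of i] H0[of "n - i"] H1[of "n - i"] i n by (auto simp: b_def)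
      have Hi': "comp_sum f (n - i) \<ge> b"
        using Hi shrink[of "c0 / real k / real k / real k"] c0 by (simp add: b_def)
      have eq: "n - i = k - i - j" using i by (auto simp: n_def)
      have "a * b \<le> f j * comp_sum f (n - i)"
        using fj Hi' ab by (intro mult_mono) auto
      also have "\<dots> \<le> comp_sum f (k - i)"
        unfolding eq by (rule comp_sum_term_le) (use f i j n in \<open>auto simp: n_def\<close>)
      finally show ?thesis using fi i n by (intro bexI[of _ i]) auto
    qed
  qed
qed

section \<open>Phases with coefficients in the rational multiples of the powers of one number\<close>

lemma ee_of_nat_mult: "ee (real l * y) = ee y ^ l"
  by (induction l) (simp_all add: ee_add distrib_right)

definition power_phases :: "real \<Rightarrow> nat \<Rightarrow> (nat \<Rightarrow> real) set" where
  "power_phases \<alpha> d = {\<lambda>n. poly p (real n) | p. degree p \<le> d \<and> (\<forall>i. \<exists>r\<in>\<rat>. coeff p i = r * \<alpha> ^ i)}"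

lemma power_phases_monom:
  assumes "r \<in> \<rat>" "i \<le> d"
  shows "(\<lambda>n. r * \<alpha> ^ i * real n ^ i) \<in> power_phases \<alpha> d"
proof -
  have "degree (monom (r * \<alpha> ^ i) i) \<le> d"
    using degree_monom_le[of "r * \<alpha> ^ i" i] assms by linarith
  moreover have "\<exists>s\<in>\<rat>. coeff (monom (r * \<alpha> ^ i) i) j = s * \<alpha> ^ j" for j
  proof (rule bexI)
    show "coeff (monom (r * \<alpha> ^ i) i) j = (if j = i then r else 0) * \<alpha> ^ j" by simp
    show "(if j = i then r else 0) \<in> \<rat>" using assms(1) by simp
  qed
  moreover have "(\<lambda>n. r * \<alpha> ^ i * real n ^ i) = (\<lambda>n. poly (monom (r * \<alpha> ^ i) i) (real n))"
    by (simp add: poly_monom)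
  ultimately show ?thesis unfolding power_phases_def by blast
qed

interpretation power_phases: seq_phase_group "power_phases \<alpha> d" for \<alpha> d
proof
  show "(\<lambda>x. 0) \<in> power_phases \<alpha> d"
    using power_phases_monom[of 0 0 d \<alpha>] by simp
next
  fix p q assume "p \<in> power_phases \<alpha> d" "q \<in> power_phases \<alpha> d"
  then obtain P Q where P: "p = (\<lambda>n. poly P (real n))" "degree P \<le> d" "\<forall>i. \<exists>r\<in>\<rat>. coeff P i = r * \<alpha> ^ i"
    and Q: "q = (\<lambda>n. poly Q (real n))" "degree Q \<le> d" "\<forall>i. \<exists>r\<in>\<rat>. coeff Q i = r * \<alpha> ^ i"
    unfolding power_phases_def by blast
  have "\<exists>r\<in>\<rat>. coeff (P + Q) i = r * \<alpha> ^ i" for i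
  proof -
    obtain r s where "r \<in> \<rat>" "s \<in> \<rat>" "coeff P i = r * \<alpha> ^ i" "coeff Q i = s * \<alpha> ^ i"
      using P(3)[rule_format, of i] Q(3)[rule_format, of i] by blast
    then show ?thesis by (intro bexI[of _ "r + s"]) (simp_all add: distrib_right)
  qed
  moreover have "degree (P + Q) \<le> d" using P(2) Q(2) by (rule degree_add_le)
  moreover have "(\<lambda>x. p x + q x) = (\<lambda>n. poly (P + Q) (real n))" by (simp add: P(1) Q(1))
  ultimately show "(\<lambda>x. p x + q x) \<in> power_phases \<alpha> d" unfolding power_phases_def by blast
qed

lemma power_phases_mono:
  assumes "d \<le> d'"
  shows "power_phases \<alpha> d \<subseteq> power_phases \<alpha> d'"
proof
  fix p assume "p \<in> power_phases \<alpha> d"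
  then obtain P where P: "p = (\<lambda>n. poly P (real n))" "degree P \<le> d" "\<forall>i. \<exists>r\<in>\<rat>. coeff P i = r * \<alpha> ^ i"
    unfolding power_phases_def by blast
  moreover have "degree P \<le> d'" using P(2) assms by simp
  ultimately show "p \<in> power_phases \<alpha> d'" unfolding power_phases_def by blast
qed

text \<open>Adding a phase of lower degree leaves the irrational leading coefficient of \<open>q\<close>
  alone.\<close>

lemma orthogonal_trigs:
  assumes "t \<in> trigs (power_phases \<alpha> d)" "degree q = Suc e" "d < Suc e" "lead_coeff q \<notin> \<rat>"
  shows "has_mean (\<lambda>n. t n * ee (poly q (real n))) 0"
  using assms(1)
proof (induction rule: trigs.induct)
  case (mono p c)
  then obtain P where P: "p = (\<lambda>n. poly P (real n))" "degree P \<le> d"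
    unfolding power_phases_def by blast
  have "degree P < degree q" using P(2) assms(2,3) by simp
  then have "degree (P + q) = Suc e" "lead_coeff (P + q) = lead_coeff q"
    using assms(2) by (simp_all add: degree_add_eq_right coeff_eq_0)
  then have "has_mean (\<lambda>n. ee (poly (P + q) (real n))) 0"
    using assms(4) by (intro Weyl_polynomial[of _ e]) auto
  from has_mean_cmult[OF this, of c] show ?case
    by (simp add: P(1) ee_add mult.assoc)
next
  case (add s t)
  from has_mean_add[OF add.IH] show ?case by (simp add: distrib_right)
qed

lemma orthogonal_mean_closure:
  assumes "g \<in> mean_closure (power_phases \<alpha> d)" "degree q = Suc e" "d < Suc e" "lead_coeff q \<notin> \<rat>"
  shows "has_mean (\<lambda>n. g n * ee (poly q (real n))) 0"
proof (rule has_mean_approx)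
  fix \<epsilon> :: real assume "\<epsilon> > 0"
  then obtain t where t: "t \<in> trigs (power_phases \<alpha> d)" "near g t \<epsilon>"
    using mean_closure_near[OF assms(1)] by blast
  have "near (\<lambda>n. ee (poly q (real n)) * g n) (\<lambda>n. ee (poly q (real n)) * t n) (1 * \<epsilon>)"
    by (rule near_mult[OF t(2)]) simp
  then show "\<exists>t c'. near (\<lambda>n. g n * ee (poly q (real n))) t \<epsilon> \<and> has_mean t c' \<and> norm (c' - 0) \<le> \<epsilon>"
    using orthogonal_trigs[OF t(1) assms(2-4)] \<open>\<epsilon> > 0\<close>
    by (intro exI[of _ "\<lambda>n. t n * ee (poly q (real n))"] exI[of _ 0] conjI) (simp_all add: mult.commute)
qed

text \<open>Characters of a product of two integer sequences are not products of characters of the factors.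
  Working with residues to all moduli instead gives a class that is closed under ring operations and still
  yields the rational characters.\<close>

definition residue_closure :: "(nat \<Rightarrow> real) set \<Rightarrow> (nat \<Rightarrow> int) set" where
  "residue_closure \<Lambda> = {R. \<forall>D>0. \<forall>c. (\<lambda>n. of_bool (R n mod D = c)) \<in> mean_closure \<Lambda>}"

context seq_phase_group begin

lemma mc_ee_real:
  assumes "(\<lambda>n. complex_of_real (y n)) \<in> mean_closure \<Lambda>"
  shows "(\<lambda>n. ee (y n)) \<in> mean_closure \<Lambda>"
proof -
  have "(\<lambda>n. exp ((\<i> * of_real (2 * pi)) * complex_of_real (y n))) \<in> mean_closure \<Lambda>"
    by (intro mc_exp mc_cmult assms)
  then show ?thesis by (simp add: ee_def cis_conv_exp mult.assoc)
qed

lemma residue_closure_op: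
  assumes R: "R \<in> residue_closure \<Lambda>" and S: "S \<in> residue_closure \<Lambda>"
    and f: "\<And>D x y. f (x mod D) (y mod D) mod D = f x y mod (D::int)"
  shows "(\<lambda>n. f (R n) (S n)) \<in> residue_closure \<Lambda>"
  unfolding residue_closure_def
proof (intro CollectI allI impI)
  fix D c :: int assume D: "D > 0"
  have one: "(\<Sum>a\<in>{0..<D}. of_bool (x mod D = a) * h a) = h (x mod D)" for x and h :: "int \<Rightarrow> complex"
  proof -
    have "(\<Sum>a\<in>{0..<D}. of_bool (x mod D = a) * h a) = (\<Sum>a\<in>{x mod D}. h a)"
      using D by (intro sum.mono_neutral_cong_right) auto
    then show ?thesis by simp
  qed
  have "(\<lambda>n. \<Sum>a\<in>{0..<D}. of_bool (R n mod D = a) * (\<Sum>b\<in>{0..<D}. of_bool (S n mod D = b) * of_bool (f a b mod D = c)))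
     \<in> mean_closure \<Lambda>"
    using R S D by (intro mc_sum mc_mult mc_const) (auto simp: residue_closure_def)
  then show "(\<lambda>n. of_bool (f (R n) (S n) mod D = c)) \<in> mean_closure \<Lambda>"
    by (simp only: one f)
qed

lemma residue_closure_add: "R \<in> residue_closure \<Lambda> \<Longrightarrow> S \<in> residue_closure \<Lambda> \<Longrightarrow> (\<lambda>n. R n + S n) \<in> residue_closure \<Lambda>"
  by (rule residue_closure_op[where f = "(+)"]) (simp_all add: mod_simps)

lemma residue_closure_diff: "R \<in> residue_closure \<Lambda> \<Longrightarrow> S \<in> residue_closure \<Lambda> \<Longrightarrow> (\<lambda>n. R n - S n) \<in> residue_closure \<Lambda>"
  by (rule residue_closure_op[where f = "(-)"]) (simp_all add: mod_simps)

lemma residue_closure_mult: "R \<in> residue_closure \<Lambda> \<Longrightarrow> S \<in> residue_closure \<Lambda> \<Longrightarrow> (\<lambda>n. R n * S n) \<in> residue_closure \<Lambda>"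
  by (rule residue_closure_op[where f = "(*)"]) (simp_all add: mod_simps)

lemma residue_closure_const: "(\<lambda>n. c) \<in> residue_closure \<Lambda>"
  by (simp add: residue_closure_def mc_const)

lemma residue_closure_sum:
  "(\<And>i. i \<in> A \<Longrightarrow> R i \<in> residue_closure \<Lambda>) \<Longrightarrow> (\<lambda>n. \<Sum>i\<in>A. R i n) \<in> residue_closure \<Lambda>"
  by (induction A rule: infinite_finite_induct) (simp_all add: residue_closure_const residue_closure_add)

lemma residue_closure_char:
  assumes R: "R \<in> residue_closure \<Lambda>" and s: "s \<in> \<rat>"
  shows "(\<lambda>n. ee (s * of_int (R n))) \<in> mean_closure \<Lambda>"
proof -
  obtain p D :: int where D: "D > 0" "s = of_int p / of_int D"
    using s by (blast elim: Rats_cases')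
  have eq: "ee (s * of_int r) = (\<Sum>a\<in>{0..<D}. of_bool (r mod D = a) * ee (s * of_int a))" for r
  proof -
    have sD: "s * of_int D = of_int p" using D by simp
    have "s * of_int r = s * (of_int (r mod D) + of_int D * of_int (r div D))"
      by (simp only: of_int_add[symmetric] of_int_mult[symmetric] mod_mult_div_eq)
    also have "\<dots> = s * of_int (r mod D) + (s * of_int D) * of_int (r div D)"
      by (simp only: distrib_left mult.assoc)
    also have "\<dots> = s * of_int (r mod D) + of_int (p * (r div D))"
      by (simp only: sD of_int_mult)
    finally have "ee (s * of_int r) = ee (s * of_int (r mod D))"
      by (simp only: ee_add_int)
    also have "\<dots> = (\<Sum>a\<in>{r mod D}. ee (s * of_int a))" by simp
    also have "\<dots> = (\<Sum>a\<in>{0..<D}. of_bool (r mod D = a) * ee (s * of_int a))"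
      using D(1) by (intro sum.mono_neutral_cong_left) auto
    finally show ?thesis .
  qed
  have "(\<lambda>n. \<Sum>a\<in>{0..<D}. of_bool (R n mod D = a) * ee (s * of_int a)) \<in> mean_closure \<Lambda>"
    using R D by (intro mc_sum mc_mult mc_const) (auto simp: residue_closure_def)
  then show ?thesis by (simp only: eq[of "R _", symmetric])
qed

text \<open>The indicator of a residue class modulo \<open>D\<close> is a combination of characters of order
  \<open>D\<close>.\<close>

lemma residue_closureI:
  assumes R: "\<And>s. s \<in> \<rat> \<Longrightarrow> (\<lambda>n. ee (s * of_int (R n))) \<in> mean_closure \<Lambda>"
  shows "R \<in> residue_closure \<Lambda>"
  unfolding residue_closure_def
proof (intro CollectI allI impI)
  fix D c :: int assume D: "D > 0"
  show "(\<lambda>n. of_bool (R n mod D = c)) \<in> mean_closure \<Lambda>"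
  proof (cases "c mod D = c")
    case False
    then have "R n mod D \<noteq> c" for n by auto
    then show ?thesis by (simp add: mc_const)
  next
    case c: True
    define N where "N = nat D"
    have N: "N > 0" "real_of_int D = real N" using D by (simp_all add: N_def)
    have "of_bool (r mod D = c) = (1 / of_nat N) * (\<Sum>l<N. ee (- (real l / real N * of_int c)) * ee (real l / real N * of_int r))" for r
    proof -
      define z where "z = ee (of_int (r - c) / real N)"
      have pow: "z ^ l = ee (real l * (of_int (r - c) / real N))" for l
        unfolding z_def by (rule ee_of_nat_mult[symmetric])
      have "ee (- (real l / real N * of_int c)) * ee (real l / real N * of_int r) = z ^ l" for l
        unfolding pow ee_add[symmetric] by (simp add: algebra_simps diff_divide_distrib)
      then have eq: "(\<Sum>l<N. ee (- (real l / real N * of_int c)) * ee (real l / real N * of_int r)) = (\<Sum>l<N. z ^ l)"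
        by simp
      have "real N * (of_int (r - c) / real N) = of_int (r - c)" using N by simp
      then have zN: "z ^ N = 1" by (simp only: pow ee_of_int)
      have "z = 1 \<longleftrightarrow> r mod D = c"
      proof -
        have "z = 1 \<longleftrightarrow> (\<exists>t. real_of_int (r - c) / real N = of_int t)"
          unfolding z_def ee_eq_1_iff by (auto elim: Ints_cases)
        also have "\<dots> \<longleftrightarrow> (\<exists>t. real_of_int (r - c) = of_int (D * t))"
          using N by (simp add: field_simps del: of_int_diff)
        also have "\<dots> \<longleftrightarrow> D dvd r - c" by (auto simp: dvd_def simp del: of_int_diff of_int_mult)
        also have "\<dots> \<longleftrightarrow> r mod D = c" using c by (metis mod_eq_dvd_iff)
        finally show ?thesis .
      qed
      moreover have "(\<Sum>l<N. z ^ l) = (if z = 1 then of_nat N else 0)"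
        using zN by (auto simp: geometric_sum)
      ultimately show ?thesis unfolding eq using N by simp
    qed
    moreover have "(\<lambda>n. (1 / of_nat N) * (\<Sum>l<N. ee (- (real l / real N * of_int c)) * ee (real l / real N * of_int (R n)))) \<in> mean_closure \<Lambda>"
      by (intro mc_cmult mc_sum R) auto
    ultimately show ?thesis by simp
  qed
qed

lemma residue_closure_newton_sum:
  "(\<And>j. j \<le> k \<Longrightarrow> (\<lambda>n. m n j) \<in> residue_closure \<Lambda>) \<Longrightarrow> (\<lambda>n. newton_sum (m n) k) \<in> residue_closure \<Lambda>"
proof (induction k rule: less_induct)
  case (less k)
  have eq: "(\<lambda>n. newton_sum (m n) k) = (\<lambda>n. int k * m n k - (\<Sum>j\<in>{1..<k}. newton_sum (m n) j * m n (k - j)))"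
    by (rule ext) (rule newton_sum.simps)
  have "(\<lambda>n. newton_sum (m n) j * m n (k - j)) \<in> residue_closure \<Lambda>" if j: "j \<in> {1..<k}" for j
  proof (rule residue_closure_mult)
    show "(\<lambda>n. newton_sum (m n) j) \<in> residue_closure \<Lambda>"
    proof (rule less.IH)
      show "j < k" using j by simp
      fix i assume "i \<le> j"
      then show "(\<lambda>n. m n i) \<in> residue_closure \<Lambda>" using j by (intro less.prems) simp
    qed
    show "(\<lambda>n. m n (k - j)) \<in> residue_closure \<Lambda>" by (rule less.prems) simp
  qed
  then have "(\<lambda>n. \<Sum>j\<in>{1..<k}. newton_sum (m n) j * m n (k - j)) \<in> residue_closure \<Lambda>"
    by (rule residue_closure_sum)
  moreover have "(\<lambda>n. int k * m n k) \<in> residue_closure \<Lambda>"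
    by (rule residue_closure_mult[OF residue_closure_const less.prems]) simp
  ultimately show ?case unfolding eq by (intro residue_closure_diff)
qed

lemma mc_comp_sum:
  "(\<And>j. j \<in> {1..k} \<Longrightarrow> (\<lambda>n. complex_of_real (f n j)) \<in> mean_closure \<Lambda>) \<Longrightarrow> (\<lambda>n. complex_of_real (comp_sum (f n) k)) \<in> mean_closure \<Lambda>"
proof (induction k rule: less_induct)
  case (less k)
  show ?case
  proof (cases "k \<ge> 1")
    case True
    have "(\<lambda>n. \<Sum>j\<in>{1..k}. complex_of_real (f n j) * complex_of_real (comp_sum (f n) (k - j))) \<in> mean_closure \<Lambda>"
    proof (intro mc_sum mc_mult)
      fix j assume j: "j \<in> {1..k}"
      show "(\<lambda>n. complex_of_real (f n j)) \<in> mean_closure \<Lambda>" by (rule less.prems) (rule j)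
      show "(\<lambda>n. complex_of_real (comp_sum (f n) (k - j))) \<in> mean_closure \<Lambda>"
      proof (rule less.IH)
        show "k - j < k" using j by simp
        fix i assume "i \<in> {1..k - j}"
        then show "(\<lambda>n. complex_of_real (f n i)) \<in> mean_closure \<Lambda>" by (intro less.prems) auto
      qed
    qed
    then show ?thesis by (simp add: comp_sum_rec[OF True])
  next
    case False
    then have "k = 0" by simp
    then show ?thesis by (simp add: mc_const)
  qed
qed

lemma mc_cyc_poly:
  assumes "\<And>j. j \<in> {1..<k} \<Longrightarrow> (\<lambda>n. complex_of_real (f n j)) \<in> mean_closure \<Lambda>"
  shows "(\<lambda>n. complex_of_real (cyc_poly k (f n))) \<in> mean_closure \<Lambda>"
proof -
  have "(\<lambda>n. \<Sum>j\<in>{1..<k}. of_real (real j) * complex_of_real (f n j) * complex_of_real (comp_sum (f n) (k - j))) \<in> mean_closure \<Lambda>"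
    by (intro mc_sum mc_mult mc_comp_sum mc_const assms) auto
  then show ?thesis by (simp add: cyc_poly_def)
qed

end

section \<open>Bracket powers: the irrational case and joint equidistribution\<close>

definition bfloor :: "real \<Rightarrow> nat \<Rightarrow> nat \<Rightarrow> int" where
  "bfloor \<alpha> n j = \<lfloor>floor_pow (\<alpha> * real n) j\<rfloor>"

definition bfrac :: "real \<Rightarrow> nat \<Rightarrow> nat \<Rightarrow> real" where
  "bfrac \<alpha> n j = frac (floor_pow (\<alpha> * real n) j)"

lemma bfrac_bounds: "bfrac \<alpha> n j \<in> {0..<1}"
  by (simp add: bfrac_def frac_lt_1)

lemma floor_pow_split: "floor_pow (\<alpha> * real n) j = of_int (bfloor \<alpha> n j) + bfrac \<alpha> n j"
  by (simp add: bfloor_def bfrac_def frac_def)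

lemma bfloor_0 [simp]: "bfloor \<alpha> n 0 = 1"
  by (simp add: bfloor_def)

lemma bracket_power:
  assumes "k \<ge> 1"
  shows "(\<alpha> * real n) ^ k = of_int (newton_sum (bfloor \<alpha> n) k) + real k * bfrac \<alpha> n k + cyc_poly k (bfrac \<alpha> n)"
proof (rule power_decomposition[OF _ _ assms])
  fix j
  have "floor_pow (\<alpha> * real n) (Suc j) = \<alpha> * real n * of_int (bfloor \<alpha> n j)"
    by (simp add: bfloor_def)
  then show "of_int (bfloor \<alpha> n (Suc j)) + bfrac \<alpha> n (Suc j) = \<alpha> * real n * of_int (bfloor \<alpha> n j)"
    by (simp only: floor_pow_split)
qed simp

definition cross_sum :: "real \<Rightarrow> nat \<Rightarrow> nat \<Rightarrow> int" where
  "cross_sum \<alpha> n k = (\<Sum>j\<in>{1..<k}. newton_sum (bfloor \<alpha> n) j * bfloor \<alpha> n (k - j))"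

lemma floor_pow_formula:
  assumes "k \<ge> 1"
  shows "real k * floor_pow (\<alpha> * real n) k
    = (\<alpha> * real n) ^ k - cyc_poly k (bfrac \<alpha> n) + of_int (cross_sum \<alpha> n k)"
proof -
  have "real_of_int (newton_sum (bfloor \<alpha> n) k) = real k * of_int (bfloor \<alpha> n k) - of_int (cross_sum \<alpha> n k)"
    by (subst newton_sum.simps) (simp add: cross_sum_def)
  then show ?thesis
    using bracket_power[OF assms, of \<alpha> n] by (simp add: floor_pow_split distrib_left)
qed

abbreviation bracket_closure :: "real \<Rightarrow> nat \<Rightarrow> (nat \<Rightarrow> complex) set" where
  "bracket_closure \<alpha> d \<equiv> mean_closure (power_phases \<alpha> d)"

text \<open>The leading phase of a bracket power, with everything of lower degree absorbed in the closure of
  the phases of degree below \<open>k\<close>.\<close>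

definition bracket_char :: "real \<Rightarrow> nat \<Rightarrow> bool" where
  "bracket_char \<alpha> k \<longleftrightarrow> (\<forall>r\<in>\<rat>. \<exists>g\<in>bracket_closure \<alpha> (k - 1).
      \<forall>n. ee (r * floor_pow (\<alpha> * real n) k) = ee (r / real k * \<alpha> ^ k * real n ^ k) * g n)"

lemma bracket_closure_mono: "d \<le> d' \<Longrightarrow> bracket_closure \<alpha> d \<subseteq> bracket_closure \<alpha> d'"
  by (intro mean_closure_mono power_phases_mono)

lemma bracket_closure_mem: "g \<in> bracket_closure \<alpha> d \<Longrightarrow> d \<le> d' \<Longrightarrow> g \<in> bracket_closure \<alpha> d'"
  using bracket_closure_mono by blast

lemma bracket_char_closure:
  assumes "bracket_char \<alpha> k" "r \<in> \<rat>"
  shows "(\<lambda>n. ee (r * floor_pow (\<alpha> * real n) k)) \<in> bracket_closure \<alpha> k"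
proof -
  obtain g where g: "g \<in> bracket_closure \<alpha> (k - 1)"
    "\<And>n. ee (r * floor_pow (\<alpha> * real n) k) = ee (r / real k * \<alpha> ^ k * real n ^ k) * g n"
    using assms unfolding bracket_char_def by blast
  have "(\<lambda>n. ee (r / real k * \<alpha> ^ k * real n ^ k) * g n) \<in> bracket_closure \<alpha> k"
  proof (intro power_phases.mc_mult power_phases.mc_char power_phases_monom)
    show "r / real k \<in> \<rat>" using assms(2) by simp
    show "g \<in> bracket_closure \<alpha> k" using g(1) bracket_closure_mono[of "k - 1" k] by auto
  qed simp
  then show ?thesis by (simp only: g(2)[symmetric])
qed

lemma bracket_char_orthogonal:
  assumes "bracket_char \<alpha> k" "k \<ge> 1" "\<alpha> ^ k \<notin> \<rat>" "h \<in> bracket_closure \<alpha> (k - 1)" "(l::int) \<noteq> 0"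
  shows "has_mean (\<lambda>n. h n * ee (of_int l * floor_pow (\<alpha> * real n) k)) 0"
proof -
  obtain g where g: "g \<in> bracket_closure \<alpha> (k - 1)"
    "\<And>n. ee (of_int l * floor_pow (\<alpha> * real n) k) = ee (of_int l / real k * \<alpha> ^ k * real n ^ k) * g n"
    using assms(1) unfolding bracket_char_def by (metis Rats_of_int)
  obtain d where d: "k = Suc d" using assms(2) by (cases k) auto
  define q where "q = monom (of_int l / real k * \<alpha> ^ k) k"
  have irr: "of_int l / real k * \<alpha> ^ k \<notin> \<rat>"
  proof
    assume "of_int l / real k * \<alpha> ^ k \<in> \<rat>"
    then have "(real k / of_int l) * (of_int l / real k * \<alpha> ^ k) \<in> \<rat>" by (rule Rats_mult[rotated]) simp
    moreover have "(real k / of_int l) * (of_int l / real k * \<alpha> ^ k) = \<alpha> ^ k" using assms by simp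
    ultimately show False using assms by (simp only:)
  qed
  then have nz: "of_int l / real k * \<alpha> ^ k \<noteq> 0" by (metis Rats_0)
  have q: "degree q = k" "lead_coeff q = of_int l / real k * \<alpha> ^ k"
    unfolding q_def degree_monom_eq[OF nz] by simp_all
  have "has_mean (\<lambda>n. (h n * g n) * ee (poly q (real n))) 0"
  proof (rule orthogonal_mean_closure)
    show "(\<lambda>n. h n * g n) \<in> bracket_closure \<alpha> (k - 1)"
      by (rule power_phases.mc_mult) (fact assms g(1))+
    show "degree q = Suc d" using q(1) d by simp
    show "k - 1 < Suc d" using d by simp
    show "lead_coeff q \<notin> \<rat>" unfolding q(2) by (rule irr)
  qed
  then show ?thesis by (simp add: g(2) q_def poly_monom mult_ac)
qed

lemma bracket_char_equid:
  assumes "bracket_char \<alpha> k" "k \<ge> 1" "\<alpha> ^ k \<notin> \<rat>" "h \<in> bracket_closure \<alpha> (k - 1)" "has_mean h c"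
  shows "equid_weight h c (\<lambda>n. floor_pow (\<alpha> * real n) k)"
  unfolding equid_weight_def
  using bracket_char_orthogonal[OF assms(1-4)] assms(5) mean_closure_bounded[OF assms(4)] by blast

lemma bracket_char_equid_1:
  assumes "bracket_char \<alpha> k" "k \<ge> 1" "\<alpha> ^ k \<notin> \<rat>"
  shows "equid_weight (\<lambda>n. 1) 1 (\<lambda>n. floor_pow (\<alpha> * real n) k)"
  by (intro bracket_char_equid assms power_phases.mc_const has_mean_const)

lemma bfrac_closure:
  assumes "bracket_char \<alpha> k" "k \<ge> 1" "\<alpha> ^ k \<notin> \<rat>"
  shows "(\<lambda>n. complex_of_real (bfrac \<alpha> n k)) \<in> bracket_closure \<alpha> k"
  unfolding bfrac_def
  by (intro power_phases.mc_frac bracket_char_closure bracket_char_equid_1 assms) simp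

lemma bfloor_closure:
  assumes "bracket_char \<alpha> k" "k \<ge> 1" "\<alpha> ^ k \<notin> \<rat>"
  shows "(\<lambda>n. bfloor \<alpha> n k) \<in> residue_closure (power_phases \<alpha> k)"
proof (rule power_phases.residue_closureI)
  fix s :: real assume s: "s \<in> \<rat>"
  have "ee (s * of_int (bfloor \<alpha> n k)) = ee (s * floor_pow (\<alpha> * real n) k) * ee (- s * bfrac \<alpha> n k)" for n
    by (simp add: floor_pow_split ee_add[symmetric] algebra_simps)
  moreover have "(\<lambda>n. ee (s * floor_pow (\<alpha> * real n) k) * ee (- s * bfrac \<alpha> n k)) \<in> bracket_closure \<alpha> k"
  proof (intro power_phases.mc_mult bracket_char_closure assms s power_phases.mc_ee_real)
    show "(\<lambda>n. complex_of_real (- s * bfrac \<alpha> n k)) \<in> bracket_closure \<alpha> k"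
      using power_phases.mc_cmult[OF bfrac_closure[OF assms], of "- of_real s"] by simp
  qed
  ultimately show "(\<lambda>n. ee (s * of_int (bfloor \<alpha> n k))) \<in> bracket_closure \<alpha> k" by simp
qed

lemma residue_closure_mono: "\<Lambda> \<subseteq> \<Lambda>' \<Longrightarrow> residue_closure \<Lambda> \<subseteq> residue_closure \<Lambda>'"
  unfolding residue_closure_def using mean_closure_mono by blast

text \<open>\<open>floor_pow_formula\<close> divided by \<open>k\<close>. By the induction hypothesis the
  lower fractional parts lie in the closure and the lower integer parts in the residue closure; the latter
  matters since division by \<open>k\<close> turns the integer \<open>cross_sum\<close> into a rational
  number.\<close>

theorem bracket_char_all:
  assumes "k \<ge> 1" "\<And>j. 1 \<le> j \<Longrightarrow> j < k \<Longrightarrow> \<alpha> ^ j \<notin> \<rat>"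
  shows "bracket_char \<alpha> k"
  using assms
proof (induction k rule: less_induct)
  case (less k)
  have IH: "bracket_char \<alpha> j" if "1 \<le> j" "j < k" for j
    using less that by auto
  have f: "(\<lambda>n. complex_of_real (bfrac \<alpha> n j)) \<in> bracket_closure \<alpha> (k - 1)" if "j \<in> {1..<k}" for j
    by (rule bracket_closure_mem[OF bfrac_closure]) (use IH[of j] less.prems(2)[of j] that in auto)
  have m: "(\<lambda>n. bfloor \<alpha> n j) \<in> residue_closure (power_phases \<alpha> (k - 1))" if "j < k" for j
  proof (cases "j = 0")
    case True
    then show ?thesis by (simp add: power_phases.residue_closure_const)
  next
    case False
    then show ?thesis
      by (intro subsetD[OF residue_closure_mono[OF power_phases_mono] bfloor_closure])
        (use IH[of j] less.prems(2)[of j] that in auto)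
  qed
  show ?case unfolding bracket_char_def
  proof (intro ballI bexI allI)
    fix r :: real assume r: "r \<in> \<rat>"
    let ?g = "\<lambda>n. ee (- (r / real k) * cyc_poly k (bfrac \<alpha> n)) * ee (r / real k * of_int (cross_sum \<alpha> n k))"
    show "?g \<in> bracket_closure \<alpha> (k - 1)"
    proof (rule power_phases.mc_mult[OF power_phases.mc_ee_real power_phases.residue_closure_char])
      show "(\<lambda>n. complex_of_real (- (r / real k) * cyc_poly k (bfrac \<alpha> n))) \<in> bracket_closure \<alpha> (k - 1)"
        using power_phases.mc_cmult[where c = "- of_real (r / real k)", OF power_phases.mc_cyc_poly[OF f]] by simp
      show "r / real k \<in> \<rat>" using r by simp
      show "(\<lambda>n. cross_sum \<alpha> n k) \<in> residue_closure (power_phases \<alpha> (k - 1))"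
        unfolding cross_sum_def
        by (intro power_phases.residue_closure_sum power_phases.residue_closure_mult
            power_phases.residue_closure_newton_sum m) auto
    qed
    fix n
    have "r * floor_pow (\<alpha> * real n) k = r / real k * (real k * floor_pow (\<alpha> * real n) k)"
      using less.prems(1) by simp
    also have "\<dots> = r / real k * \<alpha> ^ k * real n ^ k + (- (r / real k) * cyc_poly k (bfrac \<alpha> n)
         + r / real k * of_int (cross_sum \<alpha> n k))"
      by (simp only: floor_pow_formula[OF less.prems(1)] power_mult_distrib) (simp add: algebra_simps)
    finally show "ee (r * floor_pow (\<alpha> * real n) k) = ee (r / real k * \<alpha> ^ k * real n ^ k) * ?g n"
      by (simp only: ee_add)
  qed
qed

lemma card_eq_sum_of_bool: "real (card {n \<in> {1..N::nat}. P n}) = (\<Sum>n=1..N. of_bool (P n))"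
proof -
  have "(\<Sum>n=1..N. of_bool (P n)) = (\<Sum>n\<in>{n \<in> {1..N}. P n}. 1 :: real)"
    by (intro sum.mono_neutral_cong_right) auto
  then show ?thesis by simp
qed

theorem equidistributed_if_irrational:
  assumes "k \<ge> 1" "\<And>j. 1 \<le> j \<Longrightarrow> j \<le> k \<Longrightarrow> \<alpha> ^ j \<notin> \<rat>"
  shows "uniformly_distributed (\<lambda>n. frac (floor_pow (\<alpha> * real n) k))"
  unfolding uniformly_distributed_def card_eq_sum_of_bool
proof (intro conjI allI impI)
  fix a b :: real assume ab: "0 \<le> a \<and> a < b \<and> b \<le> 1"
  have "bracket_char \<alpha> k" by (rule bracket_char_all) (use assms in auto)
  then have "equid_weight (\<lambda>n. 1) 1 (\<lambda>n. floor_pow (\<alpha> * real n) k)"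
    by (rule bracket_char_equid_1) (use assms in auto)
  from interval_mean_real[OF this, of a b] ab
  show "(\<lambda>N. (\<Sum>n=1..N. of_bool (frac (floor_pow (\<alpha> * real n) k) \<in> {a..<b})) / real N) \<longlonglongrightarrow> b - a"
    by auto
qed (simp add: frac_lt_1)

lemma integral_power_01: "integral {0..1} (\<lambda>t::real. t ^ e) = 1 / real (e + 1)"
proof (rule integral_unique)
  have "((\<lambda>t::real. t ^ e) has_integral (1 ^ Suc e / real (Suc e) - 0 ^ Suc e / real (Suc e))) {0..1}"
  proof (rule fundamental_theorem_of_calculus)
    fix x :: real
    have "((\<lambda>t. t ^ Suc e / real (Suc e)) has_field_derivative x ^ e) (at x within {0..1})"
      by (auto intro!: derivative_eq_intros simp del: power_Suc) 
    then show "((\<lambda>t. t ^ Suc e / real (Suc e)) has_vector_derivative x ^ e) (at x within {0..1})"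
      by (simp add: has_real_derivative_iff_has_vector_derivative)
  qed simp
  then show "((\<lambda>t::real. t ^ e) has_integral 1 / real (e + 1)) {0..1}" by simp
qed

text \<open>One coordinate at a time: the product over the coordinates below \<open>i\<close> lies in the
  closure of the phases of degree below \<open>i\<close>, so it is uncorrelated with the \<open>i\<close>-th
  bracket power modulo one, whose leading phase has degree \<open>i\<close>.\<close>

theorem joint_moments:
  assumes irr: "\<And>j. 1 \<le> j \<Longrightarrow> j < k \<Longrightarrow> \<alpha> ^ j \<notin> \<rat>" and "k \<ge> 1"
  shows "has_mean (\<lambda>n. complex_of_real (\<Prod>j\<in>{1..<k}. bfrac \<alpha> n j ^ e j)) (of_real (\<Prod>j\<in>{1..<k}. 1 / real (e j + 1)))"
proof -
  have "has_mean (\<lambda>n. complex_of_real (\<Prod>j\<in>{1..<i}. bfrac \<alpha> n j ^ e j)) (of_real (\<Prod>j\<in>{1..<i}. 1 / real (e j + 1)))"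
    if "1 \<le> i" "i \<le> k" for i
    using that
  proof (induction i rule: nat_induct_at_least)
    case base
    then show ?case using has_mean_const[of 1] by simp
  next
    case (Suc i)
    have bc: "bracket_char \<alpha> j" if "1 \<le> j" "j \<le> i" for j
      by (rule bracket_char_all) (use that Suc.prems irr in auto)
    let ?g = "\<lambda>n. complex_of_real (\<Prod>j\<in>{1..<i}. bfrac \<alpha> n j ^ e j)"
    let ?c = "complex_of_real (\<Prod>j\<in>{1..<i}. 1 / real (e j + 1))"
    let ?z = "\<lambda>n. floor_pow (\<alpha> * real n) i"
    have "(\<lambda>n. complex_of_real (bfrac \<alpha> n j)) \<in> bracket_closure \<alpha> (i - 1)" if "j \<in> {1..<i}" for j
      by (rule bracket_closure_mem[OF bfrac_closure]) (use bc[of j] irr[of j] that Suc.prems in auto)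
    then have "(\<lambda>n. \<Prod>j\<in>{1..<i}. complex_of_real (bfrac \<alpha> n j) ^ e j) \<in> bracket_closure \<alpha> (i - 1)"
      by (intro power_phases.mc_prod power_phases.mc_power)
    then have g: "?g \<in> bracket_closure \<alpha> (i - 1)" by simp
    have irri: "\<alpha> ^ i \<notin> \<rat>" using irr[of i] Suc by simp
    have eq1: "equid_weight (\<lambda>n. 1) 1 ?z" and eqg: "equid_weight ?g ?c ?z"
      using bracket_char_equid_1[OF bc _ irri] bracket_char_equid[OF bc _ irri g Suc.IH] Suc by auto
    obtain B where B: "\<And>n. norm (?g n) \<le> B" using mean_closure_bounded[OF g] by blast
    have "has_mean (\<lambda>n. ?g n * of_real (bfrac \<alpha> n i ^ e i)) (?c * of_real (integral {0..1} (\<lambda>t. t ^ e i)))"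
    proof (rule mean_continuous[OF bfrac_bounds B, where \<phi> = "\<lambda>t. t ^ e i"])
      fix a b :: real assume "0 \<le> a" "a < b" "b \<le> 1"
      then show "has_mean (\<lambda>n. ?g n * of_bool (bfrac \<alpha> n i \<in> {a..<b})) (?c * of_real (b - a))"
        unfolding bfrac_def[of \<alpha> _ i] by (intro interval_mean_weighted[OF eq1 eqg]) auto
    qed (intro continuous_intros)
    moreover have "{1..<Suc i} = insert i {1..<i}" using Suc.hyps by auto
    ultimately show ?case unfolding integral_power_01 by (simp add: mult.commute)
  qed
  then show ?thesis using assms(2) by auto
qed

section \<open>The unit cube\<close>

text \<open>Restricting the space instead of conditioning makes the coordinates of a point of the cube lie in
  \<open>[0,1]\<close> everywhere, not just almost everywhere.\<close>

definition unit_measure :: "real measure" where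
  "unit_measure = restrict_space lborel {0..1}"

abbreviation cube :: "nat set \<Rightarrow> (nat \<Rightarrow> real) measure" where
  "cube I \<equiv> Pi\<^sub>M I (\<lambda>_. unit_measure)"

lemma space_unit_measure [simp]: "space unit_measure = {0..1}"
  by (simp add: unit_measure_def space_restrict_space)

lemma emeasure_unit_measure [simp]: "emeasure unit_measure {0..1} = 1"
  by (simp add: unit_measure_def emeasure_restrict_space)

lemma sigma_finite_unit_measure: "sigma_finite_measure unit_measure"
proof -
  have "finite_measure unit_measure" by (rule finite_measureI) simp
  then interpret finite_measure unit_measure .
  show ?thesis by unfold_locales
qed

interpretation unit_product: product_sigma_finite "\<lambda>_::nat. unit_measure"
  by (intro product_sigma_finite.intro sigma_finite_unit_measure)

lemma measurable_unit_measure [measurable (raw)]: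
  "f \<in> M \<rightarrow>\<^sub>M unit_measure \<Longrightarrow> f \<in> borel_measurable M"
  using measurable_restrict_space2_iff[of f M lborel "{0..1}"] by (simp add: unit_measure_def)

lemma borel_measurable_unit_measure:
  "f \<in> borel_measurable borel \<Longrightarrow> f \<in> borel_measurable unit_measure"
  unfolding unit_measure_def by (intro measurable_restrict_space1) simp

lemma measurable_coordinate [measurable]:
  "i \<in> I \<Longrightarrow> (\<lambda>x. x i) \<in> borel_measurable (cube I)"
  by (rule measurable_unit_measure) (rule measurable_component_singleton)

lemma emeasure_cube:
  assumes "finite I"
  shows "emeasure (cube I) (space (cube I)) = 1"
  using unit_product.emeasure_PiM[OF assms, of "\<lambda>_. {0..1}"]
  by (simp add: space_PiM unit_measure_def sets_restrict_space_iff emeasure_restrict_space)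

lemma finite_measure_cube: "finite I \<Longrightarrow> finite_measure (cube I)"
  by (intro finite_measureI) (simp add: emeasure_cube)

lemma integrable_cube:
  fixes f :: "_ \<Rightarrow> real"
  assumes "finite I" "f \<in> borel_measurable (cube I)" "\<And>x. x \<in> space (cube I) \<Longrightarrow> \<bar>f x\<bar> \<le> B"
  shows "integrable (cube I) f"
  by (rule finite_measure.integrable_const_bound[OF finite_measure_cube[OF assms(1)], of _ B])
    (use assms in \<open>auto intro: AE_I2\<close>)

lemma integral_cube_bound:
  fixes f :: "_ \<Rightarrow> real"
  assumes "finite I" "f \<in> borel_measurable (cube I)" "\<And>x. x \<in> space (cube I) \<Longrightarrow> \<bar>f x\<bar> \<le> B"
  shows "\<bar>integral\<^sup>L (cube I) f\<bar> \<le> B"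
proof -
  have int: "integrable (cube I) f" by (rule integrable_cube[OF assms])
  interpret finite_measure "cube I" by (rule finite_measure_cube) (rule assms(1))
  have "\<bar>integral\<^sup>L (cube I) f\<bar> \<le> (\<integral>x. \<bar>f x\<bar> \<partial>cube I)" by (rule integral_abs_bound)
  also have "\<dots> \<le> (\<integral>x. B \<partial>cube I)" using int assms(3) by (intro integral_mono) auto
  also have "\<dots> = B" using emeasure_cube[OF assms(1)] by (simp add: measure_def)
  finally show ?thesis .
qed

lemma cube_coordinate: "x \<in> space (cube I) \<Longrightarrow> i \<in> I \<Longrightarrow> x i \<in> {0..1}"
  by (auto simp: space_PiM PiE_iff)

lemma integral_unit_measure:
  fixes f :: "real \<Rightarrow> real"
  assumes "continuous_on {0..1} f"
  shows "integral\<^sup>L unit_measure f = integral {0..1} f"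
proof -
  have "integral\<^sup>L unit_measure f = (LINT x:{0..1}|lborel. f x)"
    by (simp add: unit_measure_def integral_restrict_space set_lebesgue_integral_def)
  also have "\<dots> = integral {0..1} f"
    by (intro set_borel_integral_eq_integral borel_integrable_atLeastAtMost' assms)
  finally show ?thesis .
qed

lemma integrable_unit_measure:
  fixes f :: "real \<Rightarrow> real"
  assumes "continuous_on {0..1} f"
  shows "integrable unit_measure f"
  using borel_integrable_atLeastAtMost'[OF assms]
  by (simp add: unit_measure_def integrable_restrict_space set_integrable_def)

lemma cube_moments:
  assumes "finite I"
  shows "integrable (cube I) (\<lambda>x. \<Prod>j\<in>I. x j ^ e j)"
    "(\<integral>x. (\<Prod>j\<in>I. x j ^ e j) \<partial>cube I) = (\<Prod>j\<in>I. 1 / real (e j + 1))"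
proof -
  have c: "continuous_on {0..1} (\<lambda>t::real. t ^ m)" for m by (intro continuous_intros)
  show "integrable (cube I) (\<lambda>x. \<Prod>j\<in>I. x j ^ e j)"
    by (rule unit_product.product_integrable_prod[OF assms]) (rule integrable_unit_measure[OF c])
  show "(\<integral>x. (\<Prod>j\<in>I. x j ^ e j) \<partial>cube I) = (\<Prod>j\<in>I. 1 / real (e j + 1))"
    by (subst unit_product.product_integral_prod[OF assms integrable_unit_measure[OF c]])
      (simp only: integral_unit_measure[OF c] integral_power_01)
qed

inductive_set poly_funs :: "nat set \<Rightarrow> ((nat \<Rightarrow> real) \<Rightarrow> real) set" for I where
  mono: "(\<lambda>x. c * (\<Prod>j\<in>I. x j ^ e j)) \<in> poly_funs I"
| add: "p \<in> poly_funs I \<Longrightarrow> q \<in> poly_funs I \<Longrightarrow> (\<lambda>x. p x + q x) \<in> poly_funs I"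

lemma poly_funs_const: "(\<lambda>x. c) \<in> poly_funs I"
  using poly_funs.mono[of c "\<lambda>_. 0" I] by simp

lemma poly_funs_coordinate:
  assumes "finite I" "i \<in> I"
  shows "(\<lambda>x. x i) \<in> poly_funs I"
proof -
  have "(\<Prod>j\<in>I. x j ^ (if j = i then 1 else 0)) = x i" for x :: "nat \<Rightarrow> real"
  proof -
    have "(\<Prod>j\<in>I. x j ^ (if j = i then 1 else 0)) = (\<Prod>j\<in>{i}. x j)"
      using assms by (intro prod.mono_neutral_cong_right) auto
    then show ?thesis by simp
  qed
  then show ?thesis using poly_funs.mono[of 1 "\<lambda>j. if j = i then 1 else 0" I] by simp
qed

lemma poly_funs_mult_mono: "q \<in> poly_funs I \<Longrightarrow> (\<lambda>x. (c * (\<Prod>j\<in>I. x j ^ e j)) * q x) \<in> poly_funs I"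
proof (induction rule: poly_funs.induct)
  case (mono d e')
  have "(\<lambda>x. (c * (\<Prod>j\<in>I. x j ^ e j)) * (d * (\<Prod>j\<in>I. x j ^ e' j)))
      = (\<lambda>x. (c * d) * (\<Prod>j\<in>I. x j ^ (e j + e' j)))"
    by (rule ext) (simp only: power_add prod.distrib mult_ac)
  then show ?case by (simp only: poly_funs.mono)
next
  case (add p q)
  from poly_funs.add[OF add.IH] show ?case by (simp only: distrib_left)
qed

lemma poly_funs_mult: "p \<in> poly_funs I \<Longrightarrow> q \<in> poly_funs I \<Longrightarrow> (\<lambda>x. p x * q x) \<in> poly_funs I"
proof (induction rule: poly_funs.induct)
  case (mono c e)
  then show ?case by (rule poly_funs_mult_mono)
next
  case (add p p')
  from poly_funs.add[OF add.IH(1)[OF add.prems] add.IH(2)[OF add.prems]]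
  show ?case by (simp only: distrib_right)
qed

lemma poly_funs_sum: "(\<And>i. i \<in> A \<Longrightarrow> p i \<in> poly_funs I) \<Longrightarrow> (\<lambda>x. \<Sum>i\<in>A. p i x) \<in> poly_funs I"
  by (induction A rule: infinite_finite_induct) (simp_all add: poly_funs_const poly_funs.add)

lemma poly_funs_comp_sum:
  assumes "finite I"
  shows "{1..n} \<subseteq> I \<Longrightarrow> (\<lambda>x. comp_sum x n) \<in> poly_funs I"
proof (induction n rule: less_induct)
  case (less n)
  show ?case
  proof (cases "n \<ge> 1")
    case True
    have "(\<lambda>x. \<Sum>j\<in>{1..n}. x j * comp_sum x (n - j)) \<in> poly_funs I"
    proof (intro poly_funs_sum poly_funs_mult poly_funs_coordinate assms)
      fix j assume j: "j \<in> {1..n}"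
      then show "j \<in> I" using less.prems by auto
      show "(\<lambda>x. comp_sum x (n - j)) \<in> poly_funs I"
      proof (rule less.IH)
        show "n - j < n" using j by simp
        have "{1..n - j} \<subseteq> {1..n}" by auto
        then show "{1..n - j} \<subseteq> I" using less.prems by (rule order_trans)
      qed
    qed
    then show ?thesis by (simp only: comp_sum_rec[OF True])
  next
    case False
    then have "n = 0" by simp
    then show ?thesis by (simp add: poly_funs_const)
  qed
qed

lemma poly_funs_cyc_poly:
  assumes "finite I" "{1..<k} \<subseteq> I"
  shows "cyc_poly k \<in> poly_funs I"
proof -
  have "(\<lambda>x. \<Sum>j\<in>{1..<k}. real j * x j * comp_sum x (k - j)) \<in> poly_funs I"
  proof (intro poly_funs_sum poly_funs_mult poly_funs_const poly_funs_coordinate poly_funs_comp_sum assms(1))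
    fix j assume j: "j \<in> {1..<k}"
    then show "j \<in> I" using assms(2) by auto
    have "{1..k - j} \<subseteq> {1..<k}" using j by auto
    then show "{1..k - j} \<subseteq> I" using assms(2) by (rule order_trans)
  qed
  moreover have "cyc_poly k = (\<lambda>x. \<Sum>j\<in>{1..<k}. real j * x j * comp_sum x (k - j))"
    by (rule ext) (rule cyc_poly_def)
  ultimately show ?thesis by simp
qed

lemma poly_funs_measurable:
  assumes "p \<in> poly_funs I"
  shows "p \<in> borel_measurable (cube I)"
  using assms
proof (induction rule: poly_funs.induct)
  case (mono c e)
  show ?case by measurable
next
  case (add p q)
  then show ?case by measurable
qed

lemma poly_funs_mean:
  assumes irr: "\<And>j. 1 \<le> j \<Longrightarrow> j < k \<Longrightarrow> \<alpha> ^ j \<notin> \<rat>" and k: "k \<ge> 1"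
    and p: "p \<in> poly_funs {1..<k}"
  shows "integrable (cube {1..<k}) p \<and>
    has_mean (\<lambda>n. complex_of_real (p (bfrac \<alpha> n))) (of_real (integral\<^sup>L (cube {1..<k}) p))"
  using p
proof (induction rule: poly_funs.induct)
  case (mono c e)
  have "has_mean (\<lambda>n. complex_of_real (\<Prod>j\<in>{1..<k}. bfrac \<alpha> n j ^ e j)) (of_real (\<Prod>j\<in>{1..<k}. 1 / real (e j + 1)))"
    by (rule joint_moments[OF irr k])
  from has_mean_cmult[OF this, of "of_real c"]
  show ?case using cube_moments[of "{1..<k}" e] by simp
next
  case (add p q)
  then show ?case
    using has_mean_add[of "\<lambda>n. complex_of_real (p (bfrac \<alpha> n))" _ "\<lambda>n. complex_of_real (q (bfrac \<alpha> n))"] by simp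
qed

lemma poly_funs_real_polynomial:
  assumes "real_polynomial_function (\<phi> :: real \<Rightarrow> real)" "p \<in> poly_funs I"
  shows "(\<lambda>x. \<phi> (p x)) \<in> poly_funs I"
  using assms(1)
proof (induction rule: real_polynomial_function.induct)
  case (linear f)
  interpret bounded_linear f by fact
  have "f y = f 1 * y" for y using scaleR[of y 1] by simp
  then have "(\<lambda>x. f (p x)) = (\<lambda>x. f 1 * p x)" by (rule ext)
  then show ?case using poly_funs_mult[OF poly_funs_const assms(2), of "f 1"] by (simp only:)
qed (auto intro: poly_funs_const poly_funs.add poly_funs_mult)

text \<open>Means of polynomials in the fractional parts are known from the moments, and one-dimensional
  Weierstrass approximation on the range of \<open>p\<close> passes from polynomials to continuous
  \<open>\<psi>\<close>.\<close>

theorem joint_mean_continuous: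
  assumes irr: "\<And>j. 1 \<le> j \<Longrightarrow> j < k \<Longrightarrow> \<alpha> ^ j \<notin> \<rat>" and k: "k \<ge> 1"
    and p: "p \<in> poly_funs {1..<k}" and pb: "\<And>x. (\<And>j. j \<in> {1..<k} \<Longrightarrow> x j \<in> {0..1}) \<Longrightarrow> p x \<in> {a..b}"
    and \<psi>: "continuous_on UNIV \<psi>"
  shows "has_mean (\<lambda>n. complex_of_real (\<psi> (p (bfrac \<alpha> n)))) (of_real (\<integral>x. \<psi> (p x) \<partial>cube {1..<k}))"
proof (rule has_mean_approx)
  fix \<epsilon> :: real assume e: "\<epsilon> > 0"
  obtain \<phi> where \<phi>: "real_polynomial_function \<phi>" "\<And>y. y \<in> {a..b} \<Longrightarrow> \<bar>\<psi> y - \<phi> y\<bar> < \<epsilon>"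
    using Stone_Weierstrass_real_polynomial_function[of "{a..b}" \<psi> \<epsilon>] e continuous_on_subset[OF \<psi>] by blast
  have \<phi>p: "(\<lambda>x. \<phi> (p x)) \<in> poly_funs {1..<k}" by (rule poly_funs_real_polynomial[OF \<phi>(1) p])
  have m: "integrable (cube {1..<k}) (\<lambda>x. \<phi> (p x))"
    "has_mean (\<lambda>n. complex_of_real (\<phi> (p (bfrac \<alpha> n)))) (of_real (\<integral>x. \<phi> (p x) \<partial>cube {1..<k}))"
    using poly_funs_mean[OF irr k \<phi>p] by auto
  have pm: "p \<in> borel_measurable (cube {1..<k})" by (rule poly_funs_measurable[OF p])
  have psim: "(\<lambda>x. \<psi> (p x)) \<in> borel_measurable (cube {1..<k})"
    using measurable_compose[OF pm borel_measurable_continuous_onI[OF \<psi>]] by simp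
  have phim: "(\<lambda>x. \<phi> (p x)) \<in> borel_measurable (cube {1..<k})" using m(1) by simp
  have pin: "p x \<in> {a..b}" if "x \<in> space (cube {1..<k})" for x
    by (rule pb) (use cube_coordinate[OF that] in auto)
  obtain M where M: "\<And>y. y \<in> {a..b} \<Longrightarrow> \<bar>\<psi> y\<bar> \<le> M"
  proof -
    have "bounded (\<psi> ` {a..b})"
      by (intro compact_imp_bounded compact_continuous_image continuous_on_subset[OF \<psi>]) auto
    then obtain M where "\<forall>z\<in>\<psi> ` {a..b}. norm z \<le> M" unfolding bounded_iff by blast
    then have "\<bar>\<psi> y\<bar> \<le> M" if "y \<in> {a..b}" for y using that by simp
    then show ?thesis by (rule that)
  qed
  have intpsi: "integrable (cube {1..<k}) (\<lambda>x. \<psi> (p x))"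
    by (rule integrable_cube[OF _ psim, of M]) (use M pin in auto)
  have "\<bar>\<integral>x. \<phi> (p x) - \<psi> (p x) \<partial>cube {1..<k}\<bar> \<le> \<epsilon>"
  proof (rule integral_cube_bound)
    fix x assume "x \<in> space (cube {1..<k})"
    from \<phi>(2)[OF pin[OF this]] show "\<bar>\<phi> (p x) - \<psi> (p x)\<bar> \<le> \<epsilon>" by linarith
  qed (use psim phim in auto)
  then have "\<bar>(\<integral>x. \<phi> (p x) \<partial>cube {1..<k}) - (\<integral>x. \<psi> (p x) \<partial>cube {1..<k})\<bar> \<le> \<epsilon>"
    using m(1) intpsi by simp
  then have "norm (of_real (\<integral>x. \<phi> (p x) \<partial>cube {1..<k}) - complex_of_real (\<integral>x. \<psi> (p x) \<partial>cube {1..<k})) \<le> \<epsilon>"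
    by (simp only: of_real_diff[symmetric] norm_of_real)
  moreover have "near (\<lambda>n. complex_of_real (\<psi> (p (bfrac \<alpha> n)))) (\<lambda>n. complex_of_real (\<phi> (p (bfrac \<alpha> n)))) \<epsilon>"
  proof (rule near_uniform)
    fix n
    have "p (bfrac \<alpha> n) \<in> {a..b}"
    proof (rule pb)
      fix j show "bfrac \<alpha> n j \<in> {0..1}" using bfrac_bounds[of \<alpha> n j] by auto
    qed
    from \<phi>(2)[OF this]
    show "norm (complex_of_real (\<psi> (p (bfrac \<alpha> n))) - of_real (\<phi> (p (bfrac \<alpha> n)))) \<le> \<epsilon>"
      by (simp only: of_real_diff[symmetric] norm_of_real)
  qed
  ultimately show "\<exists>t c'. near (\<lambda>n. complex_of_real (\<psi> (p (bfrac \<alpha> n)))) t \<epsilon> \<and> has_mean t c' \<and>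
      norm (c' - of_real (\<integral>x. \<psi> (p x) \<partial>cube {1..<k})) \<le> \<epsilon>"
    using m(2) by blast
qed

section \<open>Bump functions and linear forms on the cube\<close>

lemma antiderivative_exists:
  fixes f :: "real \<Rightarrow> real"
  assumes f: "continuous_on UNIV f"
  obtains F where "\<And>x. (F has_real_derivative f x) (at x)"
proof (rule that)
  fix x :: real
  define a where "a = \<bar>x\<bar> + 1"
  have "((\<lambda>u. LBINT y=ereal 0..u. f y) has_vector_derivative f x) (at x within {-a..a})"
    by (rule interval_integral_FTC2) (use continuous_on_subset[OF f] in \<open>auto simp: a_def\<close>)
  moreover have "at x within {-a..a} = at x"
    by (rule at_within_interior) (auto simp: a_def)
  ultimately show "((\<lambda>u. LBINT y=ereal 0..u. f y) has_real_derivative f x) (at x)"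
    by (simp add: has_real_derivative_iff_has_vector_derivative)
qed

text \<open>A test function \<open>\<tau> 0\<close> together with \<open>n\<close> successive antiderivatives
  that still have compact support. The last clause keeps \<open>\<tau> 0\<close> nonnegative on the half-line
  that matters at level \<open>0\<close>.\<close>

definition bump_family :: "nat \<Rightarrow> (nat \<Rightarrow> real \<Rightarrow> real) \<Rightarrow> real \<Rightarrow> real \<Rightarrow> bool" where
  "bump_family n \<tau> c B \<longleftrightarrow> 0 \<le> c \<and> 0 \<le> B \<and>
     (\<forall>m\<le>n. continuous_on UNIV (\<tau> m) \<and> (\<forall>v. \<bar>\<tau> m v\<bar> \<le> B) \<and> (\<forall>v. v < - c \<or> 1 \<le> v \<longrightarrow> \<tau> m v = 0)) \<and>
     (\<forall>m<n. \<forall>v. (\<tau> (Suc m) has_real_derivative \<tau> m v) (at v)) \<and>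
     (\<forall>v\<ge>0. \<tau> 0 v = max 0 (1 - v))"

text \<open>Subtracting the translate \<open>\<tau> m (v + 1)\<close> changes nothing for \<open>v \<ge>
  0\<close>, because the translate lives on \<open>v < 0\<close>, and makes the integral vanish, so that one
  more antiderivative has compact support.\<close>

lemma bump_family_exists: "\<exists>\<tau> c B. bump_family n \<tau> c B"
proof (induction n)
  case 0
  have "bump_family 0 (\<lambda>_ v. max 0 (1 - \<bar>v\<bar>)) 1 1"
    unfolding bump_family_def by (auto intro!: continuous_intros)
  then show ?case by blast
next
  case (Suc n)
  then obtain \<tau> c B where \<tau>: "bump_family n \<tau> c B" by blast
  then have c: "0 \<le> c" "0 \<le> B" and cont: "\<And>m. m \<le> n \<Longrightarrow> continuous_on UNIV (\<tau> m)"
    and bd: "\<And>m v. m \<le> n \<Longrightarrow> \<bar>\<tau> m v\<bar> \<le> B"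
    and supp: "\<And>m v. m \<le> n \<Longrightarrow> v < - c \<or> 1 \<le> v \<Longrightarrow> \<tau> m v = 0"
    and der: "\<And>m v. m < n \<Longrightarrow> (\<tau> (Suc m) has_real_derivative \<tau> m v) (at v)"
    and hat: "\<And>v. v \<ge> 0 \<Longrightarrow> \<tau> 0 v = max 0 (1 - v)"
    by (auto simp: bump_family_def)
  obtain \<Gamma> where \<Gamma>: "\<And>v. (\<Gamma> has_real_derivative \<tau> n v) (at v)"
    using antiderivative_exists[OF cont[of n]] by auto
  define \<sigma> where "\<sigma> m v = (if m \<le> n then \<tau> m v - \<tau> m (v + 1) else \<Gamma> v - \<Gamma> (v + 1))" for m v
  have mvt: "\<exists>z>v. z < v + 1 \<and> \<Gamma> v - \<Gamma> (v + 1) = - \<tau> n z" for v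
  proof -
    have "\<exists>z>v. z < v + 1 \<and> \<Gamma> (v + 1) - \<Gamma> v = (v + 1 - v) * \<tau> n z"
      by (rule MVT2) (use \<Gamma> in auto)
    then obtain z where "z > v" "z < v + 1" "\<Gamma> (v + 1) - \<Gamma> v = \<tau> n z" by auto
    then show ?thesis by (intro exI[of _ z]) auto
  qed
  have shift: "((\<lambda>v. G (v + 1)) has_real_derivative g (v + 1)) (at v)"
    if "\<And>v. (G has_real_derivative g v) (at v)" for G g :: "real \<Rightarrow> real" and v
    using that[of "v + 1"] by (simp add: DERIV_shift)
  have der': "(\<sigma> (Suc m) has_real_derivative \<sigma> m v) (at v)" if "m < Suc n" for m v
  proof (cases "m < n")
    case True
    have "((\<lambda>v. \<tau> (Suc m) v - \<tau> (Suc m) (v + 1)) has_real_derivative \<tau> m v - \<tau> m (v + 1)) (at v)"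
      by (rule DERIV_diff[OF der[OF True] shift[OF der[OF True]]])
    then show ?thesis using True by (simp add: \<sigma>_def[abs_def])
  next
    case False
    then have "m = n" using that by simp
    have "((\<lambda>v. \<Gamma> v - \<Gamma> (v + 1)) has_real_derivative \<tau> n v - \<tau> n (v + 1)) (at v)"
      by (rule DERIV_diff[OF \<Gamma> shift[OF \<Gamma>]])
    then show ?thesis using \<open>m = n\<close> by (simp add: \<sigma>_def[abs_def])
  qed
  have cont': "continuous_on UNIV (\<sigma> m)" if "m \<le> Suc n" for m
  proof (cases "m \<le> n")
    case True
    have "continuous_on UNIV (\<lambda>v. \<tau> m v - \<tau> m (v + 1))"
      by (intro continuous_intros cont True continuous_on_compose2[OF cont[OF True], of _ "\<lambda>v. v + 1"]) auto
    then show ?thesis using True by (simp add: \<sigma>_def[abs_def])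
  next
    case False
    then have "m = Suc n" using that by simp
    then show ?thesis using der'[of n] by (auto intro!: DERIV_continuous_on)
  qed
  have bd': "\<bar>\<sigma> m v\<bar> \<le> 2 * B" if "m \<le> Suc n" for m v
  proof (cases "m \<le> n")
    case True
    then show ?thesis using bd[of m v] bd[of m "v + 1"] by (simp add: \<sigma>_def)
  next
    case False
    obtain z where "\<Gamma> v - \<Gamma> (v + 1) = - \<tau> n z" using mvt by blast
    then show ?thesis using bd[of n z] c False by (simp add: \<sigma>_def)
  qed
  have supp': "\<sigma> m v = 0" if "m \<le> Suc n" "v < - (c + 1) \<or> 1 \<le> v" for m v
  proof (cases "m \<le> n")
    case True
    then show ?thesis using supp[of m v] supp[of m "v + 1"] that by (auto simp: \<sigma>_def)
  next
    case False
    obtain z where z: "v < z" "z < v + 1" "\<Gamma> v - \<Gamma> (v + 1) = - \<tau> n z" using mvt by blast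
    then have "\<tau> n z = 0" using supp[of n z] that by auto
    then show ?thesis using False z by (simp add: \<sigma>_def)
  qed
  have hat': "\<sigma> 0 v = max 0 (1 - v)" if "v \<ge> 0" for v
    using that hat[of v] supp[of 0 "v + 1"] by (simp add: \<sigma>_def)
  have "bump_family (Suc n) \<sigma> (c + 1) (2 * B)"
    unfolding bump_family_def using c cont' bd' supp' der' hat' by auto
  then show ?case by blast
qed

text \<open>The minimum of \<open>1\<close> and \<open>\<epsilon> / b\<close> for nonnegative
  \<open>b\<close>; the case distinction gives the value \<open>1\<close> at \<open>b = 0\<close>, where the
  quotient would be \<open>0\<close>.\<close>

definition decay :: "real \<Rightarrow> real \<Rightarrow> real" where
  "decay \<epsilon> b = (if b \<le> \<epsilon> then 1 else \<epsilon> / b)"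

lemma decay_nonneg: "\<epsilon> > 0 \<Longrightarrow> 0 \<le> decay \<epsilon> b"
  by (simp add: decay_def)

lemma decay_antimono: "\<epsilon> > 0 \<Longrightarrow> a \<le> b \<Longrightarrow> decay \<epsilon> b \<le> decay \<epsilon> a"
  by (auto simp: decay_def field_simps mult_left_mono intro: order_trans)

lemma sum_Pow_insert:
  assumes "finite I" "i \<notin> I"
  shows "(\<Sum>S\<in>Pow (insert i I). h S) = (\<Sum>S\<in>Pow I. h S) + (\<Sum>S\<in>Pow I. h (insert i S))"
proof -
  have "(\<Sum>S\<in>Pow (insert i I). h S) = (\<Sum>S\<in>Pow I. h S) + (\<Sum>S\<in>insert i ` Pow I. h S)"
    unfolding Pow_insert using assms by (intro sum.union_disjoint) auto
  also have "(\<Sum>S\<in>insert i ` Pow I. h S) = (\<Sum>S\<in>Pow I. h (insert i S))"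
    using assms by (intro sum.reindex_cong[of "insert i"]) (auto simp: inj_on_def)
  finally show ?thesis .
qed

lemma linear_form_measurable:
  assumes "continuous_on UNIV (f :: real \<Rightarrow> real)"
  shows "(\<lambda>x. f ((A + (\<Sum>i\<in>I. b i * x i)) / \<epsilon>)) \<in> borel_measurable (cube I)"
proof -
  have "(\<lambda>x. (A + (\<Sum>i\<in>I. b i * x i)) / \<epsilon>) \<in> borel_measurable (cube I)"
    by measurable
  from measurable_compose[OF this borel_measurable_continuous_onI[OF assms]] show ?thesis .
qed

text \<open>Integrating \<open>\<tau> m\<close> over a coordinate of slope \<open>b > \<epsilon>\<close> gives
  \<open>\<epsilon> / b\<close> times the difference of \<open>\<tau> (Suc m)\<close> at the two end points; a
  coordinate of slope at most \<open>\<epsilon>\<close> is bounded trivially and moves the argument by at most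
  \<open>\<epsilon>\<close>. In both cases what remains is supported where the form is small at a vertex
  \<open>S\<close>.\<close>

theorem high_integral_bound:
  assumes \<tau>: "bump_family n \<tau> c B" and \<epsilon>: "\<epsilon> > 0" and "finite I"
  shows "(\<And>i. i \<in> I \<Longrightarrow> 0 \<le> b i) \<Longrightarrow> m + card I \<le> n \<Longrightarrow>
    \<bar>\<integral>x. \<tau> m ((A + (\<Sum>i\<in>I. b i * x i)) / \<epsilon>) \<partial>cube I\<bar>
    \<le> B * (\<Prod>i\<in>I. decay \<epsilon> (b i)) * (\<Sum>S\<in>Pow I. of_bool (\<bar>A + (\<Sum>i\<in>S. b i)\<bar> \<le> (c + 1 + card I) * \<epsilon>))"
  using \<open>finite I\<close>
proof (induction I arbitrary: m A rule: finite_induct)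
  case empty
  have cB: "0 \<le> c" "0 \<le> B" using \<tau> by (auto simp: bump_family_def)
  have "\<bar>\<tau> m (A / \<epsilon>)\<bar> \<le> B * of_bool (\<bar>A\<bar> \<le> (c + 1) * \<epsilon>)"
  proof (cases "\<bar>A\<bar> \<le> (c + 1) * \<epsilon>")
    case True
    then show ?thesis using \<tau> empty by (simp add: bump_family_def)
  next
    case False
    then have "\<bar>A / \<epsilon>\<bar> > c + 1" using \<epsilon> by (simp add: field_simps)
    then have "A / \<epsilon> < - c \<or> 1 \<le> A / \<epsilon>" using cB by linarith
    then show ?thesis using \<tau> empty False by (auto simp: bump_family_def)
  qed
  moreover have "continuous_on UNIV (\<tau> m)" using \<tau> empty by (auto simp: bump_family_def)
  ultimately show ?case
    by (intro integral_cube_bound linear_form_measurable) auto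
next
  case (insert i I)
  have cB: "0 \<le> c" "0 \<le> B" using \<tau> by (auto simp: bump_family_def)
  have mn: "m \<le> n" "Suc m + card I \<le> n" "m + card I \<le> n" "m < n" using insert by auto
  have cont: "continuous_on UNIV (\<tau> m)" and bd: "\<And>v. \<bar>\<tau> m v\<bar> \<le> B"
    using \<tau> mn by (auto simp: bump_family_def)
  have cont1: "continuous_on UNIV (\<tau> (Suc m))" and bd1: "\<And>v. \<bar>\<tau> (Suc m) v\<bar> \<le> B"
    using \<tau> mn by (auto simp: bump_family_def)
  have b: "0 \<le> b i" "\<And>j. j \<in> I \<Longrightarrow> 0 \<le> b j" using insert.prems by auto
  define P where "P = (\<Prod>j\<in>I. decay \<epsilon> (b j))"
  have P: "P \<ge> 0" unfolding P_def by (intro prod_nonneg) (simp add: decay_nonneg \<epsilon>)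
  define w where "w = (c + 1 + card (insert i I)) * \<epsilon>"
  define N where "N A = (\<Sum>S\<in>Pow I. of_bool (\<bar>A + (\<Sum>j\<in>S. b j)\<bar> \<le> w) :: real)" for A
  have w: "(c + 1 + card I) * \<epsilon> + \<epsilon> = w"
    using insert.hyps by (simp add: w_def algebra_simps)
  have IH: "\<bar>\<integral>x. \<tau> m' ((A' + (\<Sum>j\<in>I. b j * x j)) / \<epsilon>) \<partial>cube I\<bar> \<le> B * P * N A''"
    if "m' + card I \<le> n" "\<bar>A' - A''\<bar> \<le> \<epsilon>" for m' A' A''
  proof -
    have "\<bar>\<integral>x. \<tau> m' ((A' + (\<Sum>j\<in>I. b j * x j)) / \<epsilon>) \<partial>cube I\<bar>
      \<le> B * P * (\<Sum>S\<in>Pow I. of_bool (\<bar>A' + (\<Sum>i\<in>S. b i)\<bar> \<le> (c + 1 + card I) * \<epsilon>))"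
      unfolding P_def by (rule insert.IH[OF b(2) that(1)])
    also have "\<dots> \<le> B * P * N A''"
      unfolding N_def using cB P
    proof (intro mult_left_mono sum_mono)
      fix S
      show "of_bool (\<bar>A' + (\<Sum>i\<in>S. b i)\<bar> \<le> (c + 1 + card I) * \<epsilon>) \<le> (of_bool (\<bar>A'' + (\<Sum>j\<in>S. b j)\<bar> \<le> w) :: real)"
      proof (cases "\<bar>A' + (\<Sum>i\<in>S. b i)\<bar> \<le> (c + 1 + card I) * \<epsilon>")
        case True
        then have "\<bar>A'' + (\<Sum>j\<in>S. b j)\<bar> \<le> w" using that(2) w by linarith
        then show ?thesis by simp
      qed simp
    qed auto
    finally show ?thesis .
  qed
  have split: "(\<Sum>S\<in>Pow (insert i I). of_bool (\<bar>A + (\<Sum>j\<in>S. b j)\<bar> \<le> w)) = N A + N (A + b i)"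
  proof -
    have "(\<Sum>j\<in>insert i S. b j) = b i + (\<Sum>j\<in>S. b j)" if "S \<in> Pow I" for S
      using that insert.hyps by (intro sum.insert) (auto intro: finite_subset)
    then show ?thesis unfolding sum_Pow_insert[OF insert.hyps] N_def
      by (intro arg_cong2[of _ _ _ _ "(+)"] sum.cong refl) (auto simp: add.assoc)
  qed
  have N0: "0 \<le> N A" for A unfolding N_def by (intro sum_nonneg) auto
  let ?f = "\<lambda>x. \<tau> m ((A + (\<Sum>j\<in>insert i I. b j * x j)) / \<epsilon>)"
  have int: "integrable (cube (insert i I)) ?f"
    by (rule integrable_cube[OF _ linear_form_measurable[OF cont], where B = B]) (use insert.hyps bd in auto)
  have "\<bar>integral\<^sup>L (cube (insert i I)) ?f\<bar> \<le> B * (decay \<epsilon> (b i) * P) * (N A + N (A + b i))"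
  proof (cases "b i \<le> \<epsilon>")
    case True
    have "integral\<^sup>L (cube (insert i I)) ?f = integral\<^sup>L (cube ({i} \<union> I)) ?f" by simp
    also have "\<dots> = (\<integral>x. (\<integral>y. ?f (merge {i} I (x, y)) \<partial>cube I) \<partial>cube {i})"
      by (rule unit_product.product_integral_fold) (use insert.hyps int in auto)
    also have "\<dots> = (\<integral>x. (\<integral>y. \<tau> m ((A + b i * x i + (\<Sum>j\<in>I. b j * y j)) / \<epsilon>) \<partial>cube I) \<partial>cube {i})"
    proof -
      have "(\<Sum>j\<in>insert i I. b j * merge {i} I (x, y) j) = b i * x i + (\<Sum>j\<in>I. b j * y j)" for x y
        using insert.hyps by (subst sum.insert) (auto simp: merge_def intro!: sum.cong)
      then show ?thesis by (simp only: add.assoc)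
    qed
    finally have eq: "integral\<^sup>L (cube (insert i I)) ?f
      = (\<integral>x. (\<integral>y. \<tau> m ((A + b i * x i + (\<Sum>j\<in>I. b j * y j)) / \<epsilon>) \<partial>cube I) \<partial>cube {i})" .
    have meas: "(\<lambda>x. \<integral>y. \<tau> m ((A + b i * x i + (\<Sum>j\<in>I. b j * y j)) / \<epsilon>) \<partial>cube I) \<in> borel_measurable (cube {i})"
    proof -
      interpret sigma_finite_measure "cube I"
        by (rule unit_product.sigma_finite) (rule insert.hyps)
      have [measurable]: "\<tau> m \<in> borel_measurable borel" by (rule borel_measurable_continuous_onI[OF cont])
      show ?thesis by measurable
    qed
    have "\<bar>integral\<^sup>L (cube (insert i I)) ?f\<bar> \<le> B * P * N A"
      unfolding eq
    proof (rule integral_cube_bound[OF _ meas])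
      fix x assume "x \<in> space (cube {i})"
      then have "x i \<in> {0..1}" using cube_coordinate[of x "{i}" i] by simp
      then have "\<bar>b i * x i\<bar> \<le> \<epsilon>" using b(1) True mult_left_le[of "x i" "b i"] by auto
      then show "\<bar>\<integral>y. \<tau> m ((A + b i * x i + (\<Sum>j\<in>I. b j * y j)) / \<epsilon>) \<partial>cube I\<bar> \<le> B * P * N A"
        using IH[OF mn(3), of "A + b i * x i" A] by simp
    qed simp
    also have "\<dots> \<le> B * P * (N A + N (A + b i))"
      using cB P N0 by (intro mult_left_mono) auto
    finally show ?thesis using True by (simp add: decay_def)
  next
    case False
    then have bi: "b i > \<epsilon>" "b i > 0" using \<epsilon> by auto
    have inner: "(\<integral>y. ?f (x(i := y)) \<partial>unit_measure)
       = \<epsilon> / b i * (\<tau> (Suc m) ((A + b i + (\<Sum>j\<in>I. b j * x j)) / \<epsilon>) - \<tau> (Suc m) ((A + (\<Sum>j\<in>I. b j * x j)) / \<epsilon>))" for x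
    proof -
      define A' where "A' = A + (\<Sum>j\<in>I. b j * x j)"
      have "(\<Sum>j\<in>insert i I. b j * (x(i := y)) j) = b i * y + (\<Sum>j\<in>I. b j * x j)" for y
        using insert.hyps by (subst sum.insert) (auto intro!: sum.cong)
      then have f: "?f (x(i := y)) = \<tau> m ((A' + b i * y) / \<epsilon>)" for y
        by (simp only: A'_def add_ac)
      have c1: "continuous_on {0..1} (\<lambda>y. \<tau> m ((A' + b i * y) / \<epsilon>))"
        by (rule continuous_on_compose2[OF cont]) (use \<epsilon> in \<open>auto intro!: continuous_intros\<close>)
      have "((\<lambda>y. \<tau> m ((A' + b i * y) / \<epsilon>)) has_integral
         (\<epsilon> / b i * \<tau> (Suc m) ((A' + b i * 1) / \<epsilon>) - \<epsilon> / b i * \<tau> (Suc m) ((A' + b i * 0) / \<epsilon>))) {0..1}"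
      proof (rule fundamental_theorem_of_calculus)
        fix y :: real
        have d: "(\<tau> (Suc m) has_real_derivative \<tau> m v) (at v)" for v
          using \<tau> mn(4) by (auto simp: bump_family_def)
        have "((\<lambda>y. \<tau> (Suc m) ((A' + b i * y) / \<epsilon>)) has_real_derivative \<tau> m ((A' + b i * y) / \<epsilon>) * (b i / \<epsilon>)) (at y within {0..1})"
          by (rule DERIV_chain'[OF _ d]) (use \<epsilon> in \<open>auto intro!: derivative_eq_intros\<close>)
        from DERIV_cmult[OF this, of "\<epsilon> / b i"]
        show "((\<lambda>y. \<epsilon> / b i * \<tau> (Suc m) ((A' + b i * y) / \<epsilon>)) has_vector_derivative \<tau> m ((A' + b i * y) / \<epsilon>)) (at y within {0..1})"
          using \<epsilon> bi by (simp add: has_real_derivative_iff_has_vector_derivative)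
      qed simp
      then have "integral {0..1} (\<lambda>y. \<tau> m ((A' + b i * y) / \<epsilon>))
         = \<epsilon> / b i * \<tau> (Suc m) ((A' + b i * 1) / \<epsilon>) - \<epsilon> / b i * \<tau> (Suc m) ((A' + b i * 0) / \<epsilon>)"
        by (rule integral_unique)
      then show ?thesis unfolding f integral_unit_measure[OF c1]
        by (simp add: A'_def right_diff_distrib add_ac)
    qed
    have i1: "integrable (cube I) (\<lambda>x. \<tau> (Suc m) ((A'' + (\<Sum>j\<in>I. b j * x j)) / \<epsilon>))" for A''
      by (rule integrable_cube[OF _ linear_form_measurable[OF cont1], where B = B]) (use insert.hyps bd1 in auto)
    have "integral\<^sup>L (cube (insert i I)) ?f = (\<integral>x. (\<integral>y. ?f (x(i := y)) \<partial>unit_measure) \<partial>cube I)"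
      by (rule unit_product.product_integral_insert[OF insert.hyps int])
    also have "\<dots> = \<epsilon> / b i * ((\<integral>x. \<tau> (Suc m) ((A + b i + (\<Sum>j\<in>I. b j * x j)) / \<epsilon>) \<partial>cube I)
        - (\<integral>x. \<tau> (Suc m) ((A + (\<Sum>j\<in>I. b j * x j)) / \<epsilon>) \<partial>cube I))"
      unfolding inner by (simp add: i1)
    finally have "\<bar>integral\<^sup>L (cube (insert i I)) ?f\<bar> = \<epsilon> / b i * \<bar>(\<integral>x. \<tau> (Suc m) ((A + b i + (\<Sum>j\<in>I. b j * x j)) / \<epsilon>) \<partial>cube I)
        - (\<integral>x. \<tau> (Suc m) ((A + (\<Sum>j\<in>I. b j * x j)) / \<epsilon>) \<partial>cube I)\<bar>"
      using \<epsilon> bi by (simp add: abs_mult)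
    also have "\<dots> \<le> \<epsilon> / b i * (B * P * N (A + b i) + B * P * N A)"
      using \<epsilon> bi IH[OF mn(2), of "A + b i" "A + b i"] IH[OF mn(2), of A A]
      by (intro mult_left_mono order_trans[OF abs_triangle_ineq4] add_mono) auto
    also have "\<dots> = B * (decay \<epsilon> (b i) * P) * (N A + N (A + b i))"
      using bi by (simp add: decay_def algebra_simps add_divide_distrib)
    finally show ?thesis .
  qed
  then show ?case
    unfolding w_def[symmetric] split using insert.hyps by (simp add: P_def)
qed

section \<open>Windows around a nonzero level\<close>

lemma comp_sum_measurable:
  "(\<And>j. 1 \<le> j \<Longrightarrow> j \<le> n \<Longrightarrow> (\<lambda>x. g x j) \<in> borel_measurable M) \<Longrightarrow> (\<lambda>x. comp_sum (g x) n) \<in> borel_measurable M"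
proof (induction n rule: less_induct)
  case (less n)
  show ?case
  proof (cases "n \<ge> 1")
    case True
    have "(\<lambda>x. comp_sum (g x) (n - j)) \<in> borel_measurable M" if "j \<in> {1..n}" for j
      by (rule less.IH) (use that less.prems in auto)
    then have "(\<lambda>x. \<Sum>j\<in>{1..n}. g x j * comp_sum (g x) (n - j)) \<in> borel_measurable M"
      using less.prems by (intro borel_measurable_sum borel_measurable_times) auto
    then show ?thesis by (simp only: comp_sum_rec[OF True])
  next
    case False
    then have "n = 0" by simp
    then show ?thesis by simp
  qed
qed

lemma cyc_poly_measurable:
  assumes "\<And>j. 1 \<le> j \<Longrightarrow> j < k \<Longrightarrow> (\<lambda>x. g x j) \<in> borel_measurable M"
  shows "(\<lambda>x. cyc_poly k (g x)) \<in> borel_measurable M"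
  unfolding cyc_poly_def
  using assms by (intro borel_measurable_sum borel_measurable_times borel_measurable_const comp_sum_measurable) auto

definition corner :: "nat \<Rightarrow> nat set \<Rightarrow> (nat \<Rightarrow> real) \<Rightarrow> nat \<Rightarrow> real" where
  "corner h S x j = (if j \<le> h then x j else of_bool (j \<in> S))"

lemma index_split:
  fixes k :: nat
  assumes "k \<ge> 1"
  shows "{1..<k} = {1..k div 2} \<union> {k div 2 + 1..<k}" "{1..k div 2} \<inter> {k div 2 + 1..<k} = {}"
  using assms by auto

lemma integrate_high:
  fixes q k :: nat
  assumes k: "k \<ge> 1" and q: "q \<ge> 1" and \<epsilon>: "\<epsilon> > 0" and \<tau>: "bump_family n \<tau> c B" and n: "k - 1 - k div 2 \<le> n"
    and x: "x \<in> space (cube {1..k div 2})"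
  shows "\<bar>\<integral>y. \<tau> 0 ((real q * cyc_poly k (merge {1..k div 2} {k div 2 + 1..<k} (x, y)) - u) / \<epsilon>) \<partial>cube {k div 2 + 1..<k}\<bar>
    \<le> B * (\<Prod>l\<in>{1..k - 1 - k div 2}. decay \<epsilon> (x l)) *
      (\<Sum>S\<in>Pow {k div 2 + 1..<k}. of_bool (\<bar>real q * cyc_poly k (corner (k div 2) S x) - u\<bar> \<le> (c + 1 + real (k - 1 - k div 2)) * \<epsilon>))"
proof -
  define h where "h = k div 2"
  define hi where "hi = {h + 1..<k}"
  define r where "r = k - 1 - h"
  have x01: "x j \<in> {0..1}" if "1 \<le> j" "j \<le> h" for j
    using cube_coordinate[OF x, of j] that by (simp add: h_def)
  define A where "A = real q * cyc_poly k (lo_part h x) - u"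
  define b where "b j = real q * (real k * comp_sum x (k - j))" for j
  have aff: "real q * cyc_poly k z - u = A + (\<Sum>j\<in>hi. b j * z j)"
    if z: "\<And>j. 1 \<le> j \<Longrightarrow> j \<le> h \<Longrightarrow> z j = x j" for z
  proof -
    have "cyc_poly k z = cyc_poly k (lo_part h z) + (\<Sum>j\<in>hi. z j * (real k * comp_sum z (k - j)))"
      unfolding hi_def h_def by (rule cyc_poly_affine[OF k])
    also have "cyc_poly k (lo_part h z) = cyc_poly k (lo_part h x)"
      by (rule cyc_poly_cong) (auto simp: lo_part_def z)
    also have "(\<Sum>j\<in>hi. z j * (real k * comp_sum z (k - j))) = (\<Sum>j\<in>hi. z j * (real k * comp_sum x (k - j)))"
    proof (rule sum.cong)
      fix j assume "j \<in> hi"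
      then have "comp_sum z (k - j) = comp_sum x (k - j)"
        by (intro comp_sum_cong z) (auto simp: hi_def h_def)
      then show "z j * (real k * comp_sum z (k - j)) = z j * (real k * comp_sum x (k - j))" by simp
    qed simp
    finally show ?thesis
      by (simp add: A_def b_def distrib_left sum_distrib_left mult_ac)
  qed
  have xb: "x (k - j) \<le> b j" "0 \<le> b j" if "j \<in> hi" for j
  proof -
    have kj: "1 \<le> k - j" "k - j \<le> h" using that by (auto simp: hi_def h_def)
    have 1: "x (k - j) \<le> comp_sum x (k - j)"
      by (rule comp_sum_ge) (use x01 kj in auto)
    have 2: "0 \<le> comp_sum x (k - j)"
      by (rule comp_sum_nonneg) (use x01 kj in auto)
    have "1 * comp_sum x (k - j) \<le> real q * real k * comp_sum x (k - j)"
      using 2 k q mult_mono[of 1 "real q" 1 "real k"] by (intro mult_right_mono) auto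
    then show "x (k - j) \<le> b j" "0 \<le> b j" using 1 2 by (simp_all add: b_def mult.assoc)
  qed
  have "(\<integral>y. \<tau> 0 ((real q * cyc_poly k (merge {1..h} hi (x, y)) - u) / \<epsilon>) \<partial>cube hi)
      = (\<integral>y. \<tau> 0 ((A + (\<Sum>j\<in>hi. b j * y j)) / \<epsilon>) \<partial>cube hi)"
  proof -
    have "real q * cyc_poly k (merge {1..h} hi (x, y)) - u = A + (\<Sum>j\<in>hi. b j * y j)" for y
    proof -
      have "real q * cyc_poly k (merge {1..h} hi (x, y)) - u = A + (\<Sum>j\<in>hi. b j * merge {1..h} hi (x, y) j)"
        by (rule aff) (auto simp: merge_def)
      also have "(\<Sum>j\<in>hi. b j * merge {1..h} hi (x, y) j) = (\<Sum>j\<in>hi. b j * y j)"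
        by (rule sum.cong) (auto simp: merge_def hi_def)
      finally show ?thesis .
    qed
    then show ?thesis by simp
  qed
  also have "\<bar>\<dots>\<bar> \<le> B * (\<Prod>j\<in>hi. decay \<epsilon> (b j)) *
     (\<Sum>S\<in>Pow hi. of_bool (\<bar>A + (\<Sum>i\<in>S. b i)\<bar> \<le> (c + 1 + card hi) * \<epsilon>))"
    by (rule high_integral_bound[OF \<tau> \<epsilon>]) (use xb n in \<open>auto simp: hi_def h_def\<close>)
  also have "(\<Sum>S\<in>Pow hi. of_bool (\<bar>A + (\<Sum>i\<in>S. b i)\<bar> \<le> (c + 1 + card hi) * \<epsilon>))
     = (\<Sum>S\<in>Pow hi. of_bool (\<bar>real q * cyc_poly k (corner h S x) - u\<bar> \<le> (c + 1 + real r) * \<epsilon>) :: real)"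
  proof (rule sum.cong)
    fix S assume S: "S \<in> Pow hi"
    have "(\<Sum>i\<in>S. b i) = (\<Sum>j\<in>hi. b j * corner h S x j)"
      using S by (intro sum.mono_neutral_cong_left) (auto simp: corner_def hi_def)
    also have "A + \<dots> = real q * cyc_poly k (corner h S x) - u"
      by (rule aff[symmetric]) (simp add: corner_def)
    finally show "of_bool (\<bar>A + (\<Sum>i\<in>S. b i)\<bar> \<le> (c + 1 + card hi) * \<epsilon>)
      = (of_bool (\<bar>real q * cyc_poly k (corner h S x) - u\<bar> \<le> (c + 1 + real r) * \<epsilon>) :: real)"
      by (simp add: hi_def r_def)
  qed simp
  also have "B * (\<Prod>j\<in>hi. decay \<epsilon> (b j)) * (\<Sum>S\<in>Pow hi. of_bool (\<bar>real q * cyc_poly k (corner h S x) - u\<bar> \<le> (c + 1 + real r) * \<epsilon>))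
    \<le> B * (\<Prod>l\<in>{1..r}. decay \<epsilon> (x l)) * (\<Sum>S\<in>Pow hi. of_bool (\<bar>real q * cyc_poly k (corner h S x) - u\<bar> \<le> (c + 1 + real r) * \<epsilon>))"
  proof (intro mult_right_mono mult_left_mono sum_nonneg)
    have "(\<Prod>j\<in>hi. decay \<epsilon> (b j)) \<le> (\<Prod>j\<in>hi. decay \<epsilon> (x (k - j)))"
      using xb \<epsilon> by (intro prod_mono) (auto simp: decay_nonneg decay_antimono)
    also have "\<dots> = (\<Prod>l\<in>{1..r}. decay \<epsilon> (x l))"
      by (rule prod.reindex_bij_witness[of _ "\<lambda>l. k - l" "\<lambda>j. k - j"]) (auto simp: hi_def r_def h_def)
    finally show "(\<Prod>j\<in>hi. decay \<epsilon> (b j)) \<le> (\<Prod>l\<in>{1..r}. decay \<epsilon> (x l))" .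
    show "0 \<le> B" using \<tau> by (simp add: bump_family_def)
  qed simp
  finally show ?thesis unfolding h_def hi_def r_def .
qed

lemma decay_le_far:
  assumes "\<epsilon> > 0" "y \<ge> c" "c > 0"
  shows "decay \<epsilon> y \<le> \<epsilon> / c"
  using assms by (auto simp: decay_def field_simps mult_left_mono)

lemma unit_interval_indicator:
  assumes "\<delta> \<ge> 0"
  shows "(\<integral>\<^sup>+y. indicator {y0 - \<delta>..y0 + \<delta>} y \<partial>unit_measure) \<le> ennreal (2 * \<delta>)"
proof -
  have "(\<integral>\<^sup>+y. indicator {y0 - \<delta>..y0 + \<delta>} y \<partial>unit_measure)
     = (\<integral>\<^sup>+y. indicator {y0 - \<delta>..y0 + \<delta>} y * indicator {0..1} y \<partial>lborel)"
    unfolding unit_measure_def by (rule nn_integral_restrict_space) simp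
  also have "\<dots> \<le> (\<integral>\<^sup>+y. indicator {y0 - \<delta>..y0 + \<delta>} y \<partial>lborel)"
    by (intro nn_integral_mono) (auto simp: indicator_def)
  also have "\<dots> = ennreal (2 * \<delta>)" using assms by simp
  finally show ?thesis .
qed

lemma decay_measurable: "decay \<epsilon> \<in> borel_measurable borel"
  unfolding decay_def [abs_def] by measurable

text \<open>The slope in the \<open>i\<close>-th coordinate is at least \<open>c\<close> at the smaller of the
  two points, and the polynomial is convex and increasing in that coordinate.\<close>

lemma cyc_poly_window_diameter:
  fixes q k :: nat
  assumes q: "q \<ge> 1" and i: "1 \<le> i" "i < k" and c: "c > 0" and z: "\<And>j. 1 \<le> j \<Longrightarrow> j < k \<Longrightarrow> 0 \<le> z j"
    and y: "0 \<le> y" "0 \<le> y'"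
    and Y: "\<bar>real q * cyc_poly k (z(i := y)) - u\<bar> \<le> w" "comp_sum (z(i := y)) (k - i) \<ge> c"
    and Y': "\<bar>real q * cyc_poly k (z(i := y')) - u\<bar> \<le> w" "comp_sum (z(i := y')) (k - i) \<ge> c"
  shows "\<bar>y - y'\<bar> \<le> 2 * w / c"
proof -
  have *: "s' - s \<le> 2 * w / c"
    if s: "0 \<le> s" "s \<le> s'" "\<bar>real q * cyc_poly k (z(i := s)) - u\<bar> \<le> w" "comp_sum (z(i := s)) (k - i) \<ge> c"
      "\<bar>real q * cyc_poly k (z(i := s')) - u\<bar> \<le> w" for s s'
  proof -
    have "cyc_poly k (z(i := s)) + (s' - (z(i := s)) i) * comp_sum (z(i := s)) (k - i) \<le> cyc_poly k ((z(i := s))(i := s'))"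
      by (rule cyc_poly_increment) (use z i s in auto)
    then have inc: "(s' - s) * comp_sum (z(i := s)) (k - i) \<le> cyc_poly k (z(i := s')) - cyc_poly k (z(i := s))"
      by simp
    have "(s' - s) * c \<le> (s' - s) * comp_sum (z(i := s)) (k - i)"
      using s by (intro mult_left_mono) auto
    also have "\<dots> \<le> cyc_poly k (z(i := s')) - cyc_poly k (z(i := s))" by (rule inc)
    finally have pos: "(s' - s) * c \<le> cyc_poly k (z(i := s')) - cyc_poly k (z(i := s))" .
    also have "\<dots> \<le> real q * (cyc_poly k (z(i := s')) - cyc_poly k (z(i := s)))"
    proof -
      have "0 \<le> (s' - s) * c" using s c by simp
      then have "0 \<le> cyc_poly k (z(i := s')) - cyc_poly k (z(i := s))" using pos by linarith
      from mult_right_mono[OF _ this, of 1 "real q"] show ?thesis using q by simp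
    qed
    also have "\<dots> \<le> 2 * w" using s(3,5) unfolding right_diff_distrib by linarith
    finally show ?thesis using c by (simp add: field_simps)
  qed
  show ?thesis
    using *[of y y'] *[of y' y] y Y Y' by (cases "y \<le> y'") auto
qed

text \<open>The bound left after integrating out the high coordinates, restricted to the points at which the
  low coordinate \<open>i\<close> has large value and large slope.\<close>

definition low_weight :: "nat \<Rightarrow> nat \<Rightarrow> real \<Rightarrow> real \<Rightarrow> real \<Rightarrow> real \<Rightarrow> nat set \<Rightarrow> nat \<Rightarrow> (nat \<Rightarrow> real) \<Rightarrow> real" where
  "low_weight k q \<epsilon> w c u S i x = (\<Prod>l\<in>{1..k - 1 - k div 2}. decay \<epsilon> (x l)) *
      of_bool (\<bar>real q * cyc_poly k (corner (k div 2) S x) - u\<bar> \<le> w * \<epsilon> \<and> x i \<ge> c \<and> comp_sum (corner (k div 2) S x) (k - i) \<ge> c)"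

lemma low_weight_measurable:
  assumes "k \<ge> 1" "i \<in> {1..k div 2}"
  shows "low_weight k q \<epsilon> w c u S i \<in> borel_measurable (cube {1..k div 2})"
proof -
  have cm: "(\<lambda>x. corner (k div 2) S x j) \<in> borel_measurable (cube {1..k div 2})" if "1 \<le> j" for j
    using that by (cases "j \<le> k div 2") (auto simp: corner_def intro!: measurable_coordinate)
  have [measurable]: "(\<lambda>x. cyc_poly k (corner (k div 2) S x)) \<in> borel_measurable (cube {1..k div 2})"
    by (rule cyc_poly_measurable) (rule cm)
  have [measurable]: "(\<lambda>x. comp_sum (corner (k div 2) S x) (k - i)) \<in> borel_measurable (cube {1..k div 2})"
    by (rule comp_sum_measurable) (rule cm)
  have [measurable]: "(\<lambda>x. x i) \<in> borel_measurable (cube {1..k div 2})"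
    by (rule measurable_coordinate) (rule assms)
  have "(\<lambda>x. decay \<epsilon> (x l)) \<in> borel_measurable (cube {1..k div 2})" if "l \<in> {1..k - 1 - k div 2}" for l
    by (rule measurable_compose[OF measurable_coordinate decay_measurable]) (use that assms in auto)
  then have [measurable]: "(\<lambda>x. \<Prod>l\<in>{1..k - 1 - k div 2}. decay \<epsilon> (x l)) \<in> borel_measurable (cube {1..k div 2})"
    by (rule borel_measurable_prod)
  show ?thesis unfolding low_weight_def [abs_def] by measurable
qed

text \<open>The coordinate \<open>i\<close> runs through an interval of length of order
  \<open>\<epsilon>\<close>, on which its own decay factor, if there is one, is at most \<open>\<epsilon> /
  c\<close>. Every other decay factor integrates to at most \<open>L\<close>.\<close>

lemma integrate_low_coordinate:
  fixes q k :: nat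
  assumes k: "k \<ge> 1" and q: "q \<ge> 1" and \<epsilon>: "\<epsilon> > 0" and c: "0 < c" "c \<le> 1" and w: "w \<ge> 0"
    and i: "i \<in> {1..k div 2}"
    and L: "\<epsilon> \<le> L" "(\<integral>\<^sup>+y. ennreal (decay \<epsilon> y) \<partial>unit_measure) \<le> ennreal L"
  defines "r \<equiv> k - 1 - k div 2"
  shows "(\<integral>\<^sup>+x. ennreal (low_weight k q \<epsilon> w c u S i x) \<partial>cube {1..k div 2}) \<le> ennreal (4 * w / c\<^sup>2 * \<epsilon> * L ^ r)"
proof -
  define h where "h = k div 2"
  define E where "E x \<longleftrightarrow> \<bar>real q * cyc_poly k (corner h S x) - u\<bar> \<le> w * \<epsilon> \<and> x i \<ge> c \<and> comp_sum (corner h S x) (k - i) \<ge> c" for x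
  define F where "F x = ennreal ((\<Prod>l\<in>{1..r}. decay \<epsilon> (x l)) * of_bool (E x))" for x
  have FE: "F x = ennreal (low_weight k q \<epsilon> w c u S i x)" for x
    by (simp only: F_def E_def low_weight_def r_def h_def)
  define J where "J = {1..h} - {i}"
  define W where "W x = (\<Prod>l\<in>J. if l \<le> r then decay \<epsilon> (x l) else 1)" for x :: "nat \<Rightarrow> real"
  define D where "D = (if i \<le> r then \<epsilon> / c else 1)"
  define \<delta> where "\<delta> = 2 * (w * \<epsilon>) / c"
  have L0: "L > 0" using L \<epsilon> by simp
  have \<delta>0: "\<delta> \<ge> 0" using c w \<epsilon> by (simp add: \<delta>_def)
  have rh: "r \<le> h" using k by (auto simp: r_def h_def)
  have ih: "1 \<le> i" "i \<le> h" "i < k" using i k by (auto simp: h_def)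
  have ins: "{1..h} = insert i J" using ih by (auto simp: J_def)
  have J: "finite J" "i \<notin> J" by (auto simp: J_def)
  have decay_prod: "(\<Prod>l\<in>{1..r}. decay \<epsilon> ((x(i := y)) l)) \<le> W x * D" if "y \<ge> c" for x y
  proof -
    have W: "W x = (\<Prod>l\<in>{1..r} - {i}. decay \<epsilon> (x l))"
      unfolding W_def using rh by (intro prod.mono_neutral_cong_right) (auto simp: J_def)
    have W0: "W x \<ge> 0" unfolding W by (intro prod_nonneg) (simp add: decay_nonneg \<epsilon>)
    have pc: "(\<Prod>l\<in>{1..r} - {i}. decay \<epsilon> ((x(i := y)) l)) = W x"
      unfolding W by (rule prod.cong) auto
    show ?thesis
    proof (cases "i \<le> r")
      case True
      have "(\<Prod>l\<in>{1..r}. decay \<epsilon> ((x(i := y)) l))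
          = decay \<epsilon> ((x(i := y)) i) * (\<Prod>l\<in>{1..r} - {i}. decay \<epsilon> ((x(i := y)) l))"
        by (rule prod.remove) (use ih True in auto)
      also have "\<dots> = decay \<epsilon> y * W x" by (simp only: pc fun_upd_same)
      also have "\<dots> \<le> \<epsilon> / c * W x"
        using decay_le_far[OF \<epsilon> that c(1)] W0 by (intro mult_right_mono)
      finally show ?thesis using True by (simp add: D_def mult.commute)
    next
      case False
      then have "{1..r} - {i} = {1..r}" by auto
      then show ?thesis using pc False by (simp add: D_def)
    qed
  qed
  have Fm: "F \<in> borel_measurable (cube (insert i J))"
    unfolding ins[symmetric] FE[abs_def] h_def using low_weight_measurable[OF k i] by measurable
  have inner: "(\<integral>\<^sup>+y. F (x(i := y)) \<partial>unit_measure) \<le> ennreal (W x * D * (2 * \<delta>))"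
    if x: "x \<in> space (cube J)" for x
  proof (cases "\<exists>y\<in>{0..1}. E (x(i := y))")
    case False
    then have "(\<integral>\<^sup>+y. F (x(i := y)) \<partial>unit_measure) = (\<integral>\<^sup>+y. 0 \<partial>unit_measure)"
      by (intro nn_integral_cong) (simp add: F_def)
    then show ?thesis by simp
  next
    case True
    then obtain y0 where y0: "y0 \<in> {0..1}" "E (x(i := y0))" by blast
    have W0: "W x * D \<ge> 0" unfolding W_def D_def using \<epsilon> c
      by (intro mult_nonneg_nonneg prod_nonneg) (auto simp: decay_nonneg)
    have xc: "corner h S (x(i := y)) = (corner h S x)(i := y)" for y
      using ih by (auto simp: corner_def)
    have "(\<integral>\<^sup>+y. F (x(i := y)) \<partial>unit_measure)
       \<le> (\<integral>\<^sup>+y. ennreal (W x * D) * indicator {y0 - \<delta>..y0 + \<delta>} y \<partial>unit_measure)"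
    proof (rule nn_integral_mono)
      fix y assume "y \<in> space unit_measure"
      then have y: "y \<in> {0..1}" by simp
      show "F (x(i := y)) \<le> ennreal (W x * D) * indicator {y0 - \<delta>..y0 + \<delta>} y"
      proof (cases "E (x(i := y))")
        case False
        then show ?thesis by (simp add: F_def)
      next
        case True
        have "\<bar>y - y0\<bar> \<le> 2 * (w * \<epsilon>) / c"
        proof (rule cyc_poly_window_diameter[OF q ih(1,3) c(1), of "(corner h S x)(i := 0)"])
          fix j assume j: "1 \<le> j" "j < k"
          show "0 \<le> ((corner h S x)(i := 0)) j"
            using cube_coordinate[OF x, of j] j by (auto simp: corner_def J_def)
        qed (use y y0 True in \<open>auto simp: E_def xc\<close>)
        then have "y \<in> {y0 - \<delta>..y0 + \<delta>}" unfolding \<delta>_def by (auto simp: abs_le_iff)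
        moreover have "y \<ge> c" using True by (simp add: E_def)
        ultimately show ?thesis using decay_prod[of y x] True
          by (simp add: F_def ennreal_leI)
      qed
    qed
    also have "\<dots> = ennreal (W x * D) * (\<integral>\<^sup>+y. indicator {y0 - \<delta>..y0 + \<delta>} y \<partial>unit_measure)"
      by (intro nn_integral_cmult borel_measurable_unit_measure) simp
    also have "\<dots> \<le> ennreal (W x * D) * ennreal (2 * \<delta>)"
      by (intro mult_left_mono unit_interval_indicator \<delta>0) simp
    also have "\<dots> = ennreal (W x * D * (2 * \<delta>))" using W0 \<delta>0 by (simp add: ennreal_mult)
    finally show ?thesis .
  qed
  have D0: "D \<ge> 0" using \<epsilon> c by (simp add: D_def)
  have gm: "(\<lambda>y. ennreal (if l \<le> r then decay \<epsilon> y else 1)) \<in> borel_measurable unit_measure" for l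
    using borel_measurable_unit_measure[OF decay_measurable[of \<epsilon>]] by (cases "l \<le> r") auto
  have Wi: "(\<integral>\<^sup>+x. ennreal (W x) \<partial>cube J) \<le> ennreal (\<Prod>l\<in>J. if l \<le> r then L else 1)"
  proof -
    have "(\<integral>\<^sup>+x. ennreal (W x) \<partial>cube J) = (\<integral>\<^sup>+x. (\<Prod>l\<in>J. ennreal (if l \<le> r then decay \<epsilon> (x l) else 1)) \<partial>cube J)"
      unfolding W_def by (intro nn_integral_cong prod_ennreal[symmetric]) (auto simp: decay_nonneg \<epsilon>)
    also have "\<dots> = (\<Prod>l\<in>J. \<integral>\<^sup>+y. ennreal (if l \<le> r then decay \<epsilon> y else 1) \<partial>unit_measure)"
      by (rule unit_product.product_nn_integral_prod[OF J(1) gm])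
    also have "\<dots> \<le> (\<Prod>l\<in>J. ennreal (if l \<le> r then L else 1))"
    proof (rule prod_mono_ennreal)
      fix l
      show "(\<integral>\<^sup>+y. ennreal (if l \<le> r then decay \<epsilon> y else 1) \<partial>unit_measure) \<le> ennreal (if l \<le> r then L else 1)"
        using L(2) by (cases "l \<le> r") simp_all
    qed
    also have "\<dots> = ennreal (\<Prod>l\<in>J. if l \<le> r then L else 1)"
      using L0 by (intro prod_ennreal) auto
    finally show ?thesis .
  qed
  have Wm: "(\<lambda>x. ennreal (W x)) \<in> borel_measurable (cube J)"
  proof -
    have "(\<lambda>x. if l \<le> r then decay \<epsilon> (x l) else 1) \<in> borel_measurable (cube J)" if "l \<in> J" for l
      using measurable_compose[OF measurable_coordinate[OF that] decay_measurable[of \<epsilon>]] by (cases "l \<le> r") auto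
    then have "W \<in> borel_measurable (cube J)" unfolding W_def [abs_def] by (rule borel_measurable_prod)
    then show ?thesis by simp
  qed
  have "(\<integral>\<^sup>+x. F x \<partial>cube {1..h}) = (\<integral>\<^sup>+x. (\<integral>\<^sup>+y. F (x(i := y)) \<partial>unit_measure) \<partial>cube J)"
    unfolding ins by (rule unit_product.product_nn_integral_insert[OF J Fm])
  also have "\<dots> \<le> (\<integral>\<^sup>+x. ennreal (D * (2 * \<delta>)) * ennreal (W x) \<partial>cube J)"
  proof (rule nn_integral_mono)
    fix x assume "x \<in> space (cube J)"
    from inner[OF this] show "(\<integral>\<^sup>+y. F (x(i := y)) \<partial>unit_measure) \<le> ennreal (D * (2 * \<delta>)) * ennreal (W x)"
      by (subst ennreal_mult'[symmetric]) (use D0 \<delta>0 in \<open>simp_all add: mult_ac\<close>)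
  qed
  also have "\<dots> = ennreal (D * (2 * \<delta>)) * (\<integral>\<^sup>+x. ennreal (W x) \<partial>cube J)"
    by (rule nn_integral_cmult[OF Wm])
  also have "\<dots> \<le> ennreal (D * (2 * \<delta>)) * ennreal (\<Prod>l\<in>J. if l \<le> r then L else 1)"
    by (intro mult_left_mono Wi) simp
  also have "\<dots> = ennreal (D * (2 * \<delta>) * (\<Prod>l\<in>J. if l \<le> r then L else 1))"
    using D0 \<delta>0 by (simp add: ennreal_mult')
  also have "\<dots> \<le> ennreal (4 * w / c\<^sup>2 * \<epsilon> * L ^ r)"
  proof (rule ennreal_leI)
    have "(\<Prod>l\<in>J. if l \<le> r then L else 1) = (\<Prod>l\<in>{1..r} - {i}. L)"
      using rh by (intro prod.mono_neutral_cong_right) (auto simp: J_def)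
    also have "\<dots> = L ^ card ({1..r} - {i})" by simp
    finally have pL: "(\<Prod>l\<in>J. if l \<le> r then L else 1) = L ^ card ({1..r} - {i})" .
    \<comment> \<open>If \<open>i > r\<close> there is no decay factor for \<open>i\<close>, but then all \<open>r\<close> factors \<open>L\<close> remain.\<close>
  have DL: "D * L ^ card ({1..r} - {i}) \<le> L ^ r / c"
    proof (cases "i \<le> r")
      case True
      then have cr: "Suc (card ({1..r} - {i})) = r" using ih by (subst card_Suc_Diff1) auto
      have "D * L ^ card ({1..r} - {i}) = \<epsilon> * L ^ card ({1..r} - {i}) / c" using True by (simp add: D_def)
      also have "\<dots> \<le> L * L ^ card ({1..r} - {i}) / c"
        using L L0 c by (intro divide_right_mono mult_right_mono) auto
      also have "L * L ^ card ({1..r} - {i}) = L ^ r" by (metis cr power_Suc)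
      finally show ?thesis .
    next
      case False
      then have "{1..r} - {i} = {1..r}" by auto
      then have "D * L ^ card ({1..r} - {i}) = L ^ r" using False by (simp add: D_def)
      also have "\<dots> \<le> L ^ r / c" using c L0 by (simp add: field_simps mult_left_le)
      finally show ?thesis .
    qed
    have "D * (2 * \<delta>) * (\<Prod>l\<in>J. if l \<le> r then L else 1) = (2 * \<delta>) * (D * L ^ card ({1..r} - {i}))"
      unfolding pL by (simp add: mult_ac)
    also have "\<dots> \<le> (2 * \<delta>) * (L ^ r / c)" using DL \<delta>0 by (intro mult_left_mono) auto
    also have "\<dots> = 4 * w / c\<^sup>2 * \<epsilon> * L ^ r" by (simp add: \<delta>_def power2_eq_square)
    finally show "D * (2 * \<delta>) * (\<Prod>l\<in>J. if l \<le> r then L else 1) \<le> 4 * w / c\<^sup>2 * \<epsilon> * L ^ r" .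
  qed
  finally show ?thesis unfolding FE h_def .
qed

section \<open>Comparison with the origin\<close>

text \<open>The integral is of order \<open>\<epsilon> * ln (1 / \<epsilon>)\<close>; giving up a small power
  of \<open>\<epsilon>\<close> avoids the logarithm.\<close>

lemma decay_integral:
  assumes \<epsilon>: "0 < \<epsilon>" "\<epsilon> \<le> 1" and \<eta>: "0 < \<eta>" "\<eta> \<le> 1"
  shows "(\<integral>\<^sup>+y. ennreal (decay \<epsilon> y) \<partial>unit_measure) \<le> ennreal (\<epsilon> powr (1 - \<eta>) / \<eta>)"
proof -
  have le: "decay \<epsilon> y \<le> \<epsilon> powr (1 - \<eta>) * y powr (\<eta> - 1)" if "y > 0" for y
  proof -
    have eq: "\<epsilon> powr (1 - \<eta>) * y powr (\<eta> - 1) = (\<epsilon> / y) powr (1 - \<eta>)"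
      using \<epsilon> that by (simp add: powr_divide powr_diff powr_minus field_simps)
    show ?thesis
    proof (cases "y \<le> \<epsilon>")
      case True
      then have "1 \<le> (\<epsilon> / y) powr (1 - \<eta>)" using that \<eta> by (intro ge_one_powr_ge_zero) auto
      then show ?thesis using True eq by (simp add: decay_def)
    next
      case False
      then have "(\<epsilon> / y) powr 1 \<le> (\<epsilon> / y) powr (1 - \<eta>)"
        using that \<eta> \<epsilon> by (intro powr_mono') auto
      then show ?thesis using False eq that \<epsilon> by (simp add: decay_def)
    qed
  qed
  have "(\<integral>\<^sup>+y. ennreal (decay \<epsilon> y) \<partial>unit_measure) = (\<integral>\<^sup>+y. ennreal (decay \<epsilon> y) * indicator {0..1} y \<partial>lborel)"
    unfolding unit_measure_def by (rule nn_integral_restrict_space) simp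
  also have "\<dots> \<le> (\<integral>\<^sup>+y. ennreal (\<epsilon> powr (1 - \<eta>) * y powr (\<eta> - 1)) * indicator {0..1} y \<partial>lborel)"
  proof (rule nn_integral_mono_AE)
    have "AE y in lborel. y \<noteq> (0::real)" by (rule AE_lborel_singleton)
    then show "AE y in lborel. ennreal (decay \<epsilon> y) * indicator {0..1} y
        \<le> ennreal (\<epsilon> powr (1 - \<eta>) * y powr (\<eta> - 1)) * indicator {0..1} y"
      by eventually_elim (auto simp: indicator_def intro!: ennreal_leI le)
  qed
  also have "\<dots> = ennreal (\<epsilon> powr (1 - \<eta>) * (1 powr (\<eta> - 1 + 1) / (\<eta> - 1 + 1)))"
    by (intro nn_integral_has_integral_lebesgue' has_integral_mult_right has_integral_powr_from_0)
      (use \<eta> \<epsilon> in auto)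
  also have "\<dots> = ennreal (\<epsilon> powr (1 - \<eta>) / \<eta>)" by simp
  finally show ?thesis .
qed

lemma cyc_poly_cube_measurable:
  assumes "continuous_on UNIV (f :: real \<Rightarrow> real)"
  shows "(\<lambda>x. f ((real q * cyc_poly k x - u) / \<epsilon>)) \<in> borel_measurable (cube {1..<k})"
proof -
  have "cyc_poly k \<in> borel_measurable (cube {1..<k})"
    by (intro poly_funs_measurable poly_funs_cyc_poly) auto
  then have "(\<lambda>x. (real q * cyc_poly k x - u) / \<epsilon>) \<in> borel_measurable (cube {1..<k})" by measurable
  from measurable_compose[OF this borel_measurable_continuous_onI[OF assms]] show ?thesis .
qed

text \<open>High coordinates are integrated out by \<open>integrate_high\<close>. A point that contributes has
  \<open>real q * cyc_poly k\<close> near \<open>u \<ge> 1\<close>, so \<open>low_coordinate\<close> applies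
  to it uniformly in \<open>u\<close>, and the contribution of each low coordinate is bounded by
  \<open>integrate_low_coordinate\<close>.\<close>

theorem window_integral_bound:
  fixes q k :: nat
  assumes k: "k \<ge> 1" and q: "q \<ge> 1" and \<tau>: "bump_family n \<tau> c B" and n: "k - 1 - k div 2 \<le> n"
  obtains C \<epsilon>0 where "C \<ge> 0" "\<epsilon>0 > 0"
    "\<And>\<epsilon> L u. 0 < \<epsilon> \<Longrightarrow> \<epsilon> \<le> \<epsilon>0 \<Longrightarrow> \<epsilon> \<le> L \<Longrightarrow> (\<integral>\<^sup>+y. ennreal (decay \<epsilon> y) \<partial>unit_measure) \<le> ennreal L \<Longrightarrow> 1 \<le> u \<Longrightarrow>
      \<bar>\<integral>x. \<tau> 0 ((real q * cyc_poly k x - u) / \<epsilon>) \<partial>cube {1..<k}\<bar> \<le> C * \<epsilon> * L ^ (k - 1 - k div 2)"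
proof -
  define h where "h = k div 2"
  define r where "r = k - 1 - h"
  define lo where "lo = {1..h}"
  define hi where "hi = {h + 1..<k}"
  define w where "w = c + 1 + real r"
  have cB: "0 \<le> c" "0 \<le> B" using \<tau> by (auto simp: bump_family_def)
  have w1: "w \<ge> 1" using cB by (simp add: w_def)
  obtain c1 where c1: "c1 > 0" "\<And>f. (\<And>j. 1 \<le> j \<Longrightarrow> j < k \<Longrightarrow> 0 \<le> f j \<and> f j \<le> 1) \<Longrightarrow> cyc_poly k f \<ge> 1 / (2 * real q) \<Longrightarrow>
       \<exists>i\<in>{1..k div 2}. f i \<ge> c1 \<and> comp_sum f (k - i) \<ge> c1"
    by (rule low_coordinate[OF k, of "1 / (2 * real q)"]) (use q in auto)
  define c2 where "c2 = min c1 1"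
  have c2: "0 < c2" "c2 \<le> 1" "c2 \<le> c1" using c1 by (auto simp: c2_def)
  define C where "C = real (card (Pow hi)) * real h * (B * (4 * w / c2\<^sup>2))"
  show ?thesis
  proof (rule that[of C "1 / (2 * w)"])
    show "C \<ge> 0" using cB w1 by (simp add: C_def)
    show "1 / (2 * w) > 0" using w1 by simp
    fix \<epsilon> L u :: real
    assume \<epsilon>: "0 < \<epsilon>" "\<epsilon> \<le> 1 / (2 * w)" and L: "\<epsilon> \<le> L" "(\<integral>\<^sup>+y. ennreal (decay \<epsilon> y) \<partial>unit_measure) \<le> ennreal L" and u: "1 \<le> u"
    have w\<epsilon>: "w * \<epsilon> \<le> 1 / 2" using \<epsilon> w1 by (simp add: field_simps)
    have cont: "continuous_on UNIV (\<tau> 0)" and bd: "\<And>v. \<bar>\<tau> 0 v\<bar> \<le> B" using \<tau> by (auto simp: bump_family_def)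
    let ?f = "\<lambda>x. \<tau> 0 ((real q * cyc_poly k x - u) / \<epsilon>)"
    let ?G = "\<lambda>x. \<integral>y. ?f (merge lo hi (x, y)) \<partial>cube hi"
    have split: "{1..<k} = lo \<union> hi" "lo \<inter> hi = {}"
      unfolding lo_def hi_def h_def by (rule index_split[OF k])+
    have fm: "?f \<in> borel_measurable (cube (lo \<union> hi))"
      unfolding split(1)[symmetric] by (rule cyc_poly_cube_measurable[OF cont])
    have "integrable (cube (lo \<union> hi)) ?f"
      by (rule integrable_cube[OF _ fm, where B = B]) (use bd in \<open>auto simp: lo_def hi_def\<close>)
    then have eq: "integral\<^sup>L (cube {1..<k}) ?f = integral\<^sup>L (cube lo) ?G"
      unfolding split(1) by (intro unit_product.product_integral_fold split(2)) (auto simp: lo_def hi_def)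
    have mergem: "(\<lambda>z. ?f (merge lo hi z)) \<in> borel_measurable (cube lo \<Otimes>\<^sub>M cube hi)"
      by (rule measurable_compose[OF measurable_merge fm])
    have Gm: "?G \<in> borel_measurable (cube lo)"
    proof -
      interpret sigma_finite_measure "cube hi"
        by (rule unit_product.sigma_finite) (simp add: hi_def)
      show ?thesis using borel_measurable_lebesgue_integral[of "\<lambda>x y. ?f (merge lo hi (x, y))" "cube lo"] mergem
        by (simp add: case_prod_beta')
    qed
    have Gb: "\<bar>?G x\<bar> \<le> B" if "x \<in> space (cube lo)" for x
    proof (rule integral_cube_bound)
      show "(\<lambda>y. ?f (merge lo hi (x, y))) \<in> borel_measurable (cube hi)"
        by (rule measurable_compose[OF measurable_Pair1'[OF that] mergem])
    qed (use bd in \<open>auto simp: hi_def\<close>)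
    have Gi: "integrable (cube lo) ?G"
      by (rule integrable_cube[OF _ Gm, where B = B]) (use Gb in \<open>auto simp: lo_def\<close>)
    have pw: "ennreal \<bar>?G x\<bar> \<le> (\<Sum>S\<in>Pow hi. \<Sum>i\<in>lo. ennreal B * ennreal (low_weight k q \<epsilon> w c2 u S i x))"
      if x: "x \<in> space (cube lo)" for x
    proof -
      define D where "D = (\<Prod>l\<in>{1..r}. decay \<epsilon> (x l))"
      have D0: "D \<ge> 0" unfolding D_def by (intro prod_nonneg) (simp add: decay_nonneg \<epsilon>)
      have lw0: "0 \<le> low_weight k q \<epsilon> w c2 u S i x" for S i
        unfolding low_weight_def by (intro mult_nonneg_nonneg prod_nonneg) (simp_all add: decay_nonneg \<epsilon>)
      have win: "D * of_bool (\<bar>real q * cyc_poly k (corner h S x) - u\<bar> \<le> w * \<epsilon>) \<le> (\<Sum>i\<in>lo. low_weight k q \<epsilon> w c2 u S i x)" for S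
      proof (cases "\<bar>real q * cyc_poly k (corner h S x) - u\<bar> \<le> w * \<epsilon>")
        case False
        then show ?thesis using lw0 by (simp add: sum_nonneg)
      next
        case True
        then have "real q * cyc_poly k (corner h S x) \<ge> 1 / 2" using w\<epsilon> u by linarith
        then have P: "cyc_poly k (corner h S x) \<ge> 1 / (2 * real q)" using q by (simp add: field_simps)
        have "\<exists>i\<in>{1..k div 2}. corner h S x i \<ge> c1 \<and> comp_sum (corner h S x) (k - i) \<ge> c1"
        proof (rule c1(2)[OF _ P])
          fix j assume "1 \<le> j" "j < k"
          then show "0 \<le> corner h S x j \<and> corner h S x j \<le> 1"
            using cube_coordinate[OF x, of j] by (auto simp: corner_def lo_def)
        qed
        then obtain i where i: "i \<in> {1..h}" "corner h S x i \<ge> c1" "comp_sum (corner h S x) (k - i) \<ge> c1"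
          by (auto simp: h_def)
        have "D * of_bool (\<bar>real q * cyc_poly k (corner h S x) - u\<bar> \<le> w * \<epsilon>) = low_weight k q \<epsilon> w c2 u S i x"
          using True i c2 by (simp add: low_weight_def D_def r_def h_def corner_def)
        also have "\<dots> \<le> (\<Sum>i\<in>lo. low_weight k q \<epsilon> w c2 u S i x)"
          by (rule member_le_sum) (use i lw0 in \<open>auto simp: lo_def\<close>)
        finally show ?thesis .
      qed
      have "\<bar>?G x\<bar> \<le> B * D * (\<Sum>S\<in>Pow hi. of_bool (\<bar>real q * cyc_poly k (corner h S x) - u\<bar> \<le> w * \<epsilon>))"
        using integrate_high[OF k q \<epsilon>(1) \<tau> n, of x u] x
        unfolding lo_def hi_def h_def D_def r_def w_def by simp
      also have "\<dots> = (\<Sum>S\<in>Pow hi. B * (D * of_bool (\<bar>real q * cyc_poly k (corner h S x) - u\<bar> \<le> w * \<epsilon>)))"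
        by (simp only: sum_distrib_left mult.assoc)
      also have "\<dots> \<le> (\<Sum>S\<in>Pow hi. B * (\<Sum>i\<in>lo. low_weight k q \<epsilon> w c2 u S i x))"
        by (intro sum_mono mult_left_mono win cB)
      also have "\<dots> = (\<Sum>S\<in>Pow hi. \<Sum>i\<in>lo. B * low_weight k q \<epsilon> w c2 u S i x)"
        by (simp only: sum_distrib_left)
      finally have "ennreal \<bar>?G x\<bar> \<le> ennreal (\<Sum>S\<in>Pow hi. \<Sum>i\<in>lo. B * low_weight k q \<epsilon> w c2 u S i x)"
        by (rule ennreal_leI)
      also have "\<dots> = (\<Sum>S\<in>Pow hi. \<Sum>i\<in>lo. ennreal (B * low_weight k q \<epsilon> w c2 u S i x))"
        using cB lw0 by (simp add: sum_ennreal sum_nonneg)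
      also have "\<dots> = (\<Sum>S\<in>Pow hi. \<Sum>i\<in>lo. ennreal B * ennreal (low_weight k q \<epsilon> w c2 u S i x))"
        using cB lw0 by (simp add: ennreal_mult)
      finally show ?thesis .
    qed
    have lm: "(\<lambda>x. ennreal B * ennreal (low_weight k q \<epsilon> w c2 u S i x)) \<in> borel_measurable (cube lo)" if "i \<in> lo" for S i
    proof -
      have [measurable]: "low_weight k q \<epsilon> w c2 u S i \<in> borel_measurable (cube lo)"
        unfolding lo_def h_def by (rule low_weight_measurable[OF k]) (use that in \<open>simp add: lo_def h_def\<close>)
      show ?thesis by measurable
    qed
    define T where "T = 4 * w / c2\<^sup>2 * \<epsilon> * L ^ r"
    have T0: "T \<ge> 0" unfolding T_def using w1 \<epsilon> L(1) by simp
    have "ennreal \<bar>integral\<^sup>L (cube {1..<k}) ?f\<bar> \<le> (\<integral>\<^sup>+x. ennreal \<bar>?G x\<bar> \<partial>cube lo)"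
      unfolding eq using integral_norm_bound_ennreal[OF Gi] by simp
    also have "\<dots> \<le> (\<integral>\<^sup>+x. (\<Sum>S\<in>Pow hi. \<Sum>i\<in>lo. ennreal B * ennreal (low_weight k q \<epsilon> w c2 u S i x)) \<partial>cube lo)"
      by (intro nn_integral_mono pw)
    also have "\<dots> = (\<Sum>S\<in>Pow hi. \<Sum>i\<in>lo. \<integral>\<^sup>+x. ennreal B * ennreal (low_weight k q \<epsilon> w c2 u S i x) \<partial>cube lo)"
      using lm by (simp add: nn_integral_sum)
    also have "\<dots> \<le> (\<Sum>S\<in>Pow hi. \<Sum>i\<in>lo. ennreal (B * T))"
    proof (intro sum_mono)
      fix S i assume i: "i \<in> lo"
      have [measurable]: "low_weight k q \<epsilon> w c2 u S i \<in> borel_measurable (cube lo)"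
        unfolding lo_def h_def by (rule low_weight_measurable[OF k]) (use i in \<open>simp add: lo_def h_def\<close>)
      have "(\<integral>\<^sup>+x. ennreal B * ennreal (low_weight k q \<epsilon> w c2 u S i x) \<partial>cube lo)
         = ennreal B * (\<integral>\<^sup>+x. ennreal (low_weight k q \<epsilon> w c2 u S i x) \<partial>cube lo)"
        by (rule nn_integral_cmult) measurable
      also have "\<dots> \<le> ennreal B * ennreal T"
        unfolding lo_def h_def T_def r_def
        by (intro mult_left_mono integrate_low_coordinate[OF k q \<epsilon>(1) c2(1,2) _ _ L])
          (use i w1 in \<open>simp_all add: lo_def h_def\<close>)
      also have "\<dots> = ennreal (B * T)" using cB T0 by (simp add: ennreal_mult)
      finally show "(\<integral>\<^sup>+x. ennreal B * ennreal (low_weight k q \<epsilon> w c2 u S i x) \<partial>cube lo) \<le> ennreal (B * T)" .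
    qed
    also have "\<dots> = ennreal (\<Sum>S\<in>Pow hi. \<Sum>i\<in>lo. B * T)"
    proof -
      have "(\<Sum>i\<in>lo. ennreal (B * T)) = ennreal (\<Sum>i\<in>lo. B * T)"
        using cB T0 by (intro sum_ennreal) simp
      moreover have "(\<Sum>S\<in>Pow hi. ennreal (\<Sum>i\<in>lo. B * T)) = ennreal (\<Sum>S\<in>Pow hi. \<Sum>i\<in>lo. B * T)"
        using cB T0 by (intro sum_ennreal sum_nonneg) simp
      ultimately show ?thesis by (simp only:)
    qed
    also have "(\<Sum>S\<in>Pow hi. \<Sum>i\<in>lo. B * T) = C * \<epsilon> * L ^ r"
      by (simp add: C_def T_def lo_def mult_ac)
    finally have "\<bar>integral\<^sup>L (cube {1..<k}) ?f\<bar> \<le> C * \<epsilon> * L ^ r"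
      using \<open>C \<ge> 0\<close> \<epsilon> L(1) by (subst (asm) ennreal_le_iff) auto
    then show "\<bar>\<integral>x. \<tau> 0 ((real q * cyc_poly k x - u) / \<epsilon>) \<partial>cube {1..<k}\<bar> \<le> C * \<epsilon> * L ^ (k - 1 - k div 2)"
      by (simp add: r_def h_def)
  qed
qed

lemma sum_below: "k \<ge> 1 \<Longrightarrow> real (\<Sum>j\<in>{1..<k}. j) = real k * (real k - 1) / 2"
proof (induction k rule: nat_induct_at_least)
  case (Suc k)
  have "{1..<Suc k} = insert k {1..<k}" using Suc.hyps by auto
  then show ?case using Suc.IH by (simp add: field_simps)
qed simp

text \<open>By homogeneity the box \<open>x j \<le> \<rho> ^ j\<close> lies in the set where \<open>\<tau>
  0\<close> is at least \<open>1/2\<close> if \<open>\<rho> ^ k\<close> is a small multiple of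
  \<open>\<epsilon>\<close>. The volume of the box is \<open>\<rho>\<close> to the power \<open>1 + \<dots> +
  (k - 1)\<close>.\<close>

theorem origin_integral_bound:
  fixes q k :: nat
  assumes k: "k \<ge> 1" and q: "q \<ge> 1" and \<tau>: "bump_family n \<tau> c B" and \<epsilon>: "0 < \<epsilon>" "\<epsilon> \<le> 1"
  shows "1 / 2 * (\<epsilon> / (2 * real q * (real k)\<^sup>2 * 2 ^ k)) powr ((real k - 1) / 2)
    \<le> (\<integral>x. \<tau> 0 (real q * cyc_poly k x / \<epsilon>) \<partial>cube {1..<k})"
proof -
  define C0 where "C0 = 2 * real q * (real k)\<^sup>2 * 2 ^ k"
  have C0: "C0 \<ge> 1"
  proof -
    have "1 * 1 * 1 \<le> real q * (real k)\<^sup>2 * (2 * 2 ^ k)"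
      using q k one_le_power[of "2::real" "Suc k"] by (intro mult_mono) (auto simp: one_le_power)
    then show ?thesis by (simp add: C0_def mult_ac)
  qed
  define \<rho> where "\<rho> = (\<epsilon> / C0) powr (1 / real k)"
  have pos: "\<epsilon> / C0 > 0" using C0 \<epsilon> by simp
  have \<rho>0: "\<rho> > 0" using C0 \<epsilon> by (simp add: \<rho>_def)
  have le1: "\<epsilon> / C0 \<le> 1" using C0 \<epsilon> by (simp add: field_simps)
  have \<rho>1: "\<rho> \<le> 1" using pos le1 unfolding \<rho>_def by (intro powr_le1) auto
  have \<rho>k: "\<rho> ^ k = \<epsilon> / C0"
    using k \<epsilon> C0 \<rho>0 by (simp add: powr_realpow[symmetric] \<rho>_def powr_powr)
  have cont: "continuous_on UNIV (\<tau> 0)" and bd: "\<And>v. \<bar>\<tau> 0 v\<bar> \<le> B" and hat: "\<And>v. v \<ge> 0 \<Longrightarrow> \<tau> 0 v = max 0 (1 - v)"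
    using \<tau> by (auto simp: bump_family_def)
  let ?f = "\<lambda>x. \<tau> 0 (real q * cyc_poly k x / \<epsilon>)"
  let ?g = "\<lambda>x. 1 / 2 * (\<Prod>j\<in>{1..<k}. indicator {0..\<rho> ^ j} (x j)) :: real"
  have fi: "integrable (cube {1..<k}) ?f"
    by (rule integrable_cube[of _ _ B]) (use bd cyc_poly_cube_measurable[OF cont, of q k 0 \<epsilon>] in auto)
  have indi: "integrable unit_measure (indicator {0..\<rho> ^ j} :: real \<Rightarrow> real)" for j
  proof (rule integrable_real_indicator)
    show "{0..\<rho> ^ j} \<in> sets unit_measure"
      using \<rho>0 \<rho>1 by (simp add: unit_measure_def sets_restrict_space_iff power_le_one)
    have "emeasure unit_measure {0..\<rho> ^ j} \<le> emeasure unit_measure (space unit_measure)" by (rule emeasure_space)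
    then show "emeasure unit_measure {0..\<rho> ^ j} < \<infinity>" by (simp add: order_le_less_trans)
  qed
  have ind: "integral\<^sup>L unit_measure (indicator {0..\<rho> ^ j}) = \<rho> ^ j" for j
  proof -
    have "integral\<^sup>L unit_measure (indicator {0..\<rho> ^ j}) = measure unit_measure {0..\<rho> ^ j}"
      using \<rho>1 \<rho>0 by (simp add: Int_absorb2 power_le_one)
    also have "\<dots> = \<rho> ^ j"
      using \<rho>0 \<rho>1 by (simp add: unit_measure_def measure_restrict_space power_le_one)
    finally show ?thesis .
  qed
  have gi: "integrable (cube {1..<k}) ?g"
    by (intro integrable_mult_right unit_product.product_integrable_prod indi) simp
  have "integral\<^sup>L (cube {1..<k}) ?g = 1 / 2 * (\<Prod>j\<in>{1..<k}. \<rho> ^ j)"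
    by (simp only: integral_mult_right_zero unit_product.product_integral_prod[OF finite_atLeastLessThan indi] ind)
  also have "(\<Prod>j\<in>{1..<k}. \<rho> ^ j) = \<rho> ^ (\<Sum>j\<in>{1..<k}. j)" by (simp only: power_sum)
  also have "\<dots> = \<rho> powr (real k * (real k - 1) / 2)"
    by (simp only: powr_realpow[OF \<rho>0, symmetric] sum_below[OF k])
  also have "\<dots> = (\<epsilon> / C0) powr ((real k - 1) / 2)"
    using k by (simp add: \<rho>_def powr_powr)
  finally have geq: "integral\<^sup>L (cube {1..<k}) ?g = 1 / 2 * (\<epsilon> / C0) powr ((real k - 1) / 2)" .
  have "integral\<^sup>L (cube {1..<k}) ?g \<le> integral\<^sup>L (cube {1..<k}) ?f"
  proof (rule integral_mono[OF gi fi])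
    fix x assume x: "x \<in> space (cube {1..<k})"
    have x01: "0 \<le> x j" if "1 \<le> j" "j < k" for j
      using cube_coordinate[OF x, of j] that by simp
    have P0: "0 \<le> cyc_poly k x" by (rule cyc_poly_nonneg) (rule x01)
    then have v0: "0 \<le> real q * cyc_poly k x / \<epsilon>" using \<epsilon> by simp
    show "?g x \<le> ?f x"
    proof (cases "\<forall>j\<in>{1..<k}. x j \<in> {0..\<rho> ^ j}")
      case False
      then have "(\<Prod>j\<in>{1..<k}. indicator {0..\<rho> ^ j} (x j)) = (0 :: real)"
        by (intro prod_zero) (auto simp: indicator_def)
      then have gx: "?g x = 0" by (simp only: mult_zero_right)
      have "0 \<le> ?f x" using hat[OF v0] by simp
      then show ?thesis by (simp only: gx)
    next
      case True
      have "cyc_poly k x \<le> (real k)\<^sup>2 * 2 ^ k * \<rho> ^ k"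
        by (rule cyc_poly_le) (use True \<rho>0 in auto)
      then have "real q * cyc_poly k x \<le> real q * ((real k)\<^sup>2 * 2 ^ k * \<rho> ^ k)"
        by (rule mult_left_mono) simp
      also have "\<dots> = C0 / 2 * (\<epsilon> / C0)" unfolding \<rho>k by (simp add: C0_def)
      also have "\<dots> = \<epsilon> / 2" using C0 by simp
      finally have "real q * cyc_poly k x / \<epsilon> \<le> 1 / 2" using \<epsilon> by (simp add: field_simps)
      moreover have "?g x = 1 / 2" using True by simp
      ultimately show ?thesis using hat[OF v0] by simp
    qed
  qed
  then show ?thesis unfolding geq C0_def .
qed

section \<open>The rational case and the theorem\<close>

lemma powr_small:
  fixes a b \<gamma> \<epsilon>0 :: real
  assumes "a > 0" "b \<ge> 0" "\<gamma> > 0" "\<epsilon>0 > 0"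
  obtains \<epsilon> where "0 < \<epsilon>" "\<epsilon> \<le> \<epsilon>0" "b * \<epsilon> powr \<gamma> < a"
proof -
  define t where "t = a / (b + 1)"
  have t: "t > 0" using assms by (simp add: t_def)
  define \<epsilon> where "\<epsilon> = min \<epsilon>0 (t powr (1 / \<gamma>))"
  have e: "\<epsilon> > 0" "\<epsilon> \<le> \<epsilon>0" "\<epsilon> \<le> t powr (1 / \<gamma>)" using assms t by (auto simp: \<epsilon>_def)
  have "\<epsilon> powr \<gamma> \<le> (t powr (1 / \<gamma>)) powr \<gamma>" using e assms by (intro powr_mono2) auto
  also have "\<dots> = t" using assms t by (simp add: powr_powr)
  finally have "b * \<epsilon> powr \<gamma> \<le> b * t" using assms by (intro mult_left_mono) auto
  also have "\<dots> < a" using assms by (simp add: t_def field_simps)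
  finally show ?thesis using that e by blast
qed

text \<open>The contributions are of order \<open>\<epsilon>\<close> to the powers \<open>1 + r * (1 -
  \<eta>)\<close> and \<open>s = (k - 1) / 2\<close>. Since \<open>s \<le> r + 1/2\<close>, the choice of
  \<open>\<eta>\<close> with \<open>r * \<eta> < 1/2\<close> keeps the first exponent larger.\<close>

theorem cyc_poly_not_equidistributed:
  fixes q k K :: nat
  assumes k: "k \<ge> 1" and q: "q \<ge> 1" and \<tau>: "bump_family n \<tau> c B" and n: "k - 1 - k div 2 \<le> n" and e1: "\<epsilon>1 > 0"
  obtains \<epsilon> where "0 < \<epsilon>" "\<epsilon> \<le> \<epsilon>1"
    "(\<Sum>j\<in>{1..int K}. \<bar>\<integral>x. \<tau> 0 ((real q * cyc_poly k x - of_int j) / \<epsilon>) \<partial>cube {1..<k}\<bar>)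
      < (\<integral>x. \<tau> 0 (real q * cyc_poly k x / \<epsilon>) \<partial>cube {1..<k})"
proof -
  define r where "r = k - 1 - k div 2"
  define \<eta> where "\<eta> = 1 / (2 * real r + 2)"
  define C0 where "C0 = 2 * real q * (real k)\<^sup>2 * 2 ^ k"
  define s where "s = (real k - 1) / 2"
  define \<gamma> where "\<gamma> = 1 + real r * (1 - \<eta>) - s"
  have \<eta>: "0 < \<eta>" "\<eta> \<le> 1" by (simp_all add: \<eta>_def field_simps)
  have C0: "C0 > 0" using k q by (simp add: C0_def)
  have \<gamma>: "\<gamma> > 0"
  proof -
    have "k \<le> 2 * r + 2" by (simp add: r_def)
    then have "real k \<le> 2 * real r + 2" by linarith
    then have "s \<le> real r + 1 / 2" by (simp add: s_def)
    moreover have "real r * \<eta> < 1 / 2" by (simp add: \<eta>_def field_simps)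
    ultimately show ?thesis by (simp add: \<gamma>_def right_diff_distrib)
  qed
  obtain C \<epsilon>0 where C: "C \<ge> 0" "\<epsilon>0 > 0"
    "\<And>\<epsilon> L u. 0 < \<epsilon> \<Longrightarrow> \<epsilon> \<le> \<epsilon>0 \<Longrightarrow> \<epsilon> \<le> L \<Longrightarrow> (\<integral>\<^sup>+y. ennreal (decay \<epsilon> y) \<partial>unit_measure) \<le> ennreal L \<Longrightarrow> 1 \<le> u \<Longrightarrow>
      \<bar>\<integral>x. \<tau> 0 ((real q * cyc_poly k x - u) / \<epsilon>) \<partial>cube {1..<k}\<bar> \<le> C * \<epsilon> * L ^ (k - 1 - k div 2)"
    by (rule window_integral_bound[OF k q \<tau> n]) blast
  define a where "a = 1 / 2 * (1 / C0) powr s"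
  define b where "b = real K * C * (1 / \<eta>) ^ r"
  have a0: "a > 0" using C0 by (simp add: a_def)
  have b0: "b \<ge> 0" using C \<eta> by (simp add: b_def)
  have m0: "min \<epsilon>1 (min \<epsilon>0 1) > 0" using e1 C by simp
  obtain \<epsilon> where \<epsilon>': "0 < \<epsilon>" "\<epsilon> \<le> min \<epsilon>1 (min \<epsilon>0 1)" "b * \<epsilon> powr \<gamma> < a"
    by (rule powr_small[OF a0 b0 \<gamma> m0])
  then have \<epsilon>: "0 < \<epsilon>" "\<epsilon> \<le> \<epsilon>1" "\<epsilon> \<le> \<epsilon>0" "\<epsilon> \<le> 1" "b * \<epsilon> powr \<gamma> < a" by auto
  define L where "L = \<epsilon> powr (1 - \<eta>) / \<eta>"
  have LI: "(\<integral>\<^sup>+y. ennreal (decay \<epsilon> y) \<partial>unit_measure) \<le> ennreal L"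
    unfolding L_def by (rule decay_integral[OF \<epsilon>(1,4) \<eta>])
  have L\<epsilon>: "\<epsilon> \<le> L"
  proof -
    have "\<epsilon> powr 1 \<le> \<epsilon> powr (1 - \<eta>)" using \<epsilon> \<eta> by (intro powr_mono') auto
    also have "\<dots> \<le> \<epsilon> powr (1 - \<eta>) / \<eta>" using \<eta> by (simp add: field_simps mult_left_le_one_le)
    finally show ?thesis using \<epsilon> by (simp add: L_def)
  qed
  have Lr: "\<epsilon> * L ^ r = (1 / \<eta>) ^ r * (\<epsilon> powr s * \<epsilon> powr \<gamma>)"
  proof -
    have "L ^ r = (1 / \<eta>) ^ r * (\<epsilon> powr (1 - \<eta>)) ^ r"
      by (simp add: L_def power_divide)
    also have "(\<epsilon> powr (1 - \<eta>)) ^ r = \<epsilon> powr (real r * (1 - \<eta>))"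
      using \<epsilon> by (simp add: powr_realpow[symmetric] powr_powr mult.commute)
    finally have "\<epsilon> * L ^ r = (1 / \<eta>) ^ r * (\<epsilon> powr 1 * \<epsilon> powr (real r * (1 - \<eta>)))"
      using \<epsilon> by simp
    also have "\<epsilon> powr 1 * \<epsilon> powr (real r * (1 - \<eta>)) = \<epsilon> powr s * \<epsilon> powr \<gamma>"
      by (simp only: powr_add[symmetric]) (simp add: \<gamma>_def)
    finally show ?thesis .
  qed
  have "(\<Sum>j\<in>{1..int K}. \<bar>\<integral>x. \<tau> 0 ((real q * cyc_poly k x - of_int j) / \<epsilon>) \<partial>cube {1..<k}\<bar>)
      \<le> (\<Sum>j\<in>{1..int K}. C * \<epsilon> * L ^ r)"
    unfolding r_def by (intro sum_mono C(3)[OF \<epsilon>(1,3) L\<epsilon> LI]) auto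
  also have "\<dots> = real K * C * (\<epsilon> * L ^ r)" by simp
  also have "\<dots> = \<epsilon> powr s * (b * \<epsilon> powr \<gamma>)" unfolding Lr b_def by (simp only: mult_ac)
  also have "\<dots> < \<epsilon> powr s * a" using \<epsilon> by (intro mult_strict_left_mono) auto
  also have "\<dots> = 1 / 2 * (\<epsilon> / C0) powr s"
    using \<epsilon> C0 by (simp add: a_def powr_divide)
  also have "\<dots> \<le> (\<integral>x. \<tau> 0 (real q * cyc_poly k x / \<epsilon>) \<partial>cube {1..<k})"
    unfolding C0_def s_def by (rule origin_integral_bound[OF k q \<tau> \<epsilon>(1,4)])
  finally show ?thesis using that \<epsilon> by blast
qed

text \<open>A finite sum, so that continuity and integrals are immediate; on arguments well inside \<open>[-K,
  K]\<close> it agrees with the periodic sum over all integers.\<close>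

definition periodize :: "nat \<Rightarrow> (real \<Rightarrow> real) \<Rightarrow> real \<Rightarrow> real" where
  "periodize K g v = (\<Sum>j\<in>{- int K..int K}. g (v - of_int j))"

lemma periodize_frac:
  assumes g: "\<And>v. v < -1 \<or> 1 \<le> v \<Longrightarrow> g v = 0" and v: "\<bar>v\<bar> + 2 \<le> real K"
  shows "periodize K g v = g (frac v) + g (frac v - 1)"
proof -
  have fl: "\<bar>\<lfloor>v\<rfloor>\<bar> + 1 \<le> int K" using v by linarith
  have "periodize K g v = (\<Sum>j\<in>{\<lfloor>v\<rfloor>, \<lfloor>v\<rfloor> + 1}. g (v - of_int j))"
    unfolding periodize_def
  proof (rule sum.mono_neutral_right)
    show "{\<lfloor>v\<rfloor>, \<lfloor>v\<rfloor> + 1} \<subseteq> {- int K..int K}" using fl by auto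
    show "\<forall>j\<in>{- int K..int K} - {\<lfloor>v\<rfloor>, \<lfloor>v\<rfloor> + 1}. g (v - of_int j) = 0"
    proof
      fix j assume "j \<in> {- int K..int K} - {\<lfloor>v\<rfloor>, \<lfloor>v\<rfloor> + 1}"
      then have "j \<le> \<lfloor>v\<rfloor> - 1 \<or> j \<ge> \<lfloor>v\<rfloor> + 2" by auto
      then have "v - of_int j < -1 \<or> 1 \<le> v - of_int j" by linarith
      then show "g (v - of_int j) = 0" by (rule g)
    qed
  qed simp
  then show ?thesis by (simp add: frac_def algebra_simps)
qed

lemma periodize_continuous:
  assumes "continuous_on UNIV g"
  shows "continuous_on S (\<lambda>t. periodize K g (a * t))"
  unfolding periodize_def
proof (rule continuous_on_sum)
  fix j :: int
  have "continuous_on S (\<lambda>t. a * t - of_int j)" by (intro continuous_intros)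
  then show "continuous_on S (\<lambda>t. g (a * t - of_int j))"
    by (rule continuous_on_compose2[OF assms]) simp
qed

text \<open>Equidistribution of the last fractional part would make the periodized test function of \<open>q *
  cyc_poly k\<close> have integral zero over the cube. Of its translates only those at the levels \<open>0,
  \<dots>, K\<close> meet the range of the polynomial, and level \<open>0\<close> outweighs the others.\<close>

theorem not_equidistributed_if_rational:
  assumes irr: "\<And>j. 1 \<le> j \<Longrightarrow> j < k \<Longrightarrow> \<alpha> ^ j \<notin> \<rat>" and k: "k \<ge> 1" and rat: "\<alpha> ^ k \<in> \<rat>"
  shows "\<not> uniformly_distributed (\<lambda>n. frac (floor_pow (\<alpha> * real n) k))"
proof
  assume ud: "uniformly_distributed (\<lambda>n. frac (floor_pow (\<alpha> * real n) k))"
  obtain p D :: int where D: "D > 0" "\<alpha> ^ k = of_int p / of_int D"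
    using rat by (blast elim: Rats_cases')
  define q where "q = nat D"
  have q: "q \<ge> 1" "real q = of_int D" using D by (auto simp: q_def)
  obtain \<tau> c B where \<tau>: "bump_family (Suc k) \<tau> c B" using bump_family_exists by blast
  have c: "c \<ge> 0" and cont: "continuous_on UNIV (\<tau> 0)"
    and supp: "\<And>m v. m \<le> 1 \<Longrightarrow> v < - c \<or> 1 \<le> v \<Longrightarrow> \<tau> m v = 0" and bd: "\<And>v. \<bar>\<tau> 0 v\<bar> \<le> B"
    and der: "\<And>v. (\<tau> 1 has_real_derivative \<tau> 0 v) (at v)"
    using \<tau> by (auto simp: bump_family_def)
  define b where "b = (real k)\<^sup>2 * 2 ^ k"
  define K where "K = q * k\<^sup>2 * 2 ^ k + q * k + 2"
  have rK: "real K = real q * b + real q * real k + 2" by (simp add: K_def b_def)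
  obtain \<epsilon> where \<epsilon>: "0 < \<epsilon>" "\<epsilon> \<le> 1 / (c + 2)" and less:
    "(\<Sum>j\<in>{1..int K}. \<bar>\<integral>x. \<tau> 0 ((real q * cyc_poly k x - of_int j) / \<epsilon>) \<partial>cube {1..<k}\<bar>)
      < (\<integral>x. \<tau> 0 (real q * cyc_poly k x / \<epsilon>) \<partial>cube {1..<k})"
  proof -
    have "k - 1 - k div 2 \<le> Suc k" "1 / (c + 2) > 0" using c by auto
    from cyc_poly_not_equidistributed[OF k q(1) \<tau> this, of K] that show ?thesis by blast
  qed
  have \<epsilon>c: "c * \<epsilon> < 1" "\<epsilon> < 1"
  proof -
    have "\<epsilon> * (c + 2) \<le> 1" using \<epsilon> c by (simp add: field_simps)
    then have "c * \<epsilon> + 2 * \<epsilon> \<le> 1" by (simp add: algebra_simps)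
    moreover have "0 \<le> c * \<epsilon>" using \<epsilon>(1) c by simp
    ultimately show "c * \<epsilon> < 1" "\<epsilon> < 1" using \<epsilon>(1) by linarith+
  qed
  have supp\<epsilon>: "\<tau> m (v / \<epsilon>) = 0" if "m \<le> 1" "v \<le> -1 \<or> 1 \<le> v" for m v
  proof (rule supp[OF that(1)])
    show "v / \<epsilon> < - c \<or> 1 \<le> v / \<epsilon>" using that(2) \<epsilon> \<epsilon>c by (auto simp: field_simps)
  qed
  define g where "g v = \<tau> 0 (v / \<epsilon>)" for v
  have g0: "g v = 0" if "v < -1 \<or> 1 \<le> v" for v unfolding g_def by (rule supp\<epsilon>) (use that in auto)
  have gc: "continuous_on UNIV g" unfolding g_def
    by (rule continuous_on_compose2[OF cont]) (use \<epsilon> in \<open>auto intro!: continuous_intros\<close>)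
  have P01: "cyc_poly k x \<in> {0..b}" if "\<And>j. j \<in> {1..<k} \<Longrightarrow> x j \<in> {0..1}" for x
    using cyc_poly_nonneg[of k x] cyc_poly_le[of 1 k x] that by (auto simp: b_def)
  have m1: "has_mean (\<lambda>n. complex_of_real (periodize K g (real q * cyc_poly k (bfrac \<alpha> n))))
      (of_real (\<integral>x. periodize K g (real q * cyc_poly k x) \<partial>cube {1..<k}))"
    by (rule joint_mean_continuous[OF irr k poly_funs_cyc_poly P01 periodize_continuous[OF gc]]) auto
  have m2: "has_mean (\<lambda>n. 1 * complex_of_real (periodize K g (- (real q * real k) * bfrac \<alpha> n k)))
      (1 * of_real (integral {0..1} (\<lambda>t. periodize K g (- (real q * real k) * t))))"
  proof (rule mean_continuous[of "\<lambda>n. bfrac \<alpha> n k" "\<lambda>_. 1" 1 1 "\<lambda>t. periodize K g (- (real q * real k) * t)"])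
    fix s t :: real assume st: "0 \<le> s" "s < t" "t \<le> 1"
    then have "(\<lambda>N. (\<Sum>n=1..N. of_bool (bfrac \<alpha> n k \<in> {s..<t})) / real N) \<longlonglongrightarrow> t - s"
      using ud unfolding uniformly_distributed_def card_eq_sum_of_bool bfrac_def by blast
    then have "has_mean (\<lambda>n. complex_of_real (of_bool (bfrac \<alpha> n k \<in> {s..<t}))) (of_real (t - s))"
      by (simp only: has_mean_of_real)
    then show "has_mean (\<lambda>n. 1 * of_bool (bfrac \<alpha> n k \<in> {s..<t})) (1 * of_real (t - s))"
      by (simp only: of_real_of_bool mult_1)
  next
    show "continuous_on {0..1} (\<lambda>t. periodize K g (- (real q * real k) * t))"
      by (rule periodize_continuous[OF gc])
  qed (use bfrac_bounds in simp_all)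
  have same: "periodize K g (real q * cyc_poly k (bfrac \<alpha> n)) = periodize K g (- (real q * real k) * bfrac \<alpha> n k)" for n
  proof -
    let ?v = "real q * cyc_poly k (bfrac \<alpha> n)" and ?v' = "- (real q * real k) * bfrac \<alpha> n k"
    have f: "bfrac \<alpha> n j \<in> {0..1}" for j using bfrac_bounds[of \<alpha> n j] by auto
    have P: "cyc_poly k (bfrac \<alpha> n) \<in> {0..b}" by (rule P01) (rule f)
    have "real q * cyc_poly k (bfrac \<alpha> n) \<le> real q * b" using P by (intro mult_left_mono) auto
    moreover have "0 \<le> real q * cyc_poly k (bfrac \<alpha> n)" using P by simp
    moreover have "0 \<le> real q * real k" by simp
    ultimately have v: "\<bar>?v\<bar> + 2 \<le> real K" using rK by linarith
    have "real q * real k * bfrac \<alpha> n k \<le> real q * real k * 1" using f[of k] by (intro mult_left_mono) auto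
    moreover have "0 \<le> real q * real k * bfrac \<alpha> n k" using f[of k] by simp
    moreover have "0 \<le> real q * b" by (simp add: b_def)
    ultimately have v': "\<bar>?v'\<bar> + 2 \<le> real K" using rK by auto
    have "real q * (\<alpha> * real n) ^ k = real q * \<alpha> ^ k * real n ^ k" by (simp add: power_mult_distrib)
    also have "real q * \<alpha> ^ k = of_int p" using D q by simp
    finally have "real q * (\<alpha> * real n) ^ k = of_int (p * int n ^ k)" by simp
    moreover have "real q * (\<alpha> * real n) ^ k
        = real q * of_int (newton_sum (bfloor \<alpha> n) k) + real q * real k * bfrac \<alpha> n k + ?v"
      by (subst bracket_power[OF k]) (simp add: distrib_left mult.assoc)
    ultimately have "?v = ?v' + of_int (p * int n ^ k - int q * newton_sum (bfloor \<alpha> n) k)"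
      by simp
    moreover have "frac (y + of_int i) = frac y" for y :: real and i by (simp add: frac_def)
    ultimately have "frac ?v = frac ?v'" by (simp only:)
    then show ?thesis using periodize_frac[OF g0 v] periodize_frac[OF g0 v'] by simp
  qed
  have int0: "integral {0..1} (\<lambda>t. periodize K g (- (real q * real k) * t)) = 0"
  proof (rule integral_unique)
    define d where "d = real q * real k"
    have d: "d > 0" using q k by (simp add: d_def)
    have "((\<lambda>t. g (- d * t - of_int j)) has_integral
        (- \<epsilon> / d * \<tau> 1 ((- d * 1 - of_int j) / \<epsilon>) - (- \<epsilon> / d * \<tau> 1 ((- d * 0 - of_int j) / \<epsilon>)))) {0..1}" for j :: int
    proof (rule fundamental_theorem_of_calculus)
      fix t :: real
      have "((\<lambda>t. \<tau> 1 ((- d * t - of_int j) / \<epsilon>)) has_real_derivative \<tau> 0 ((- d * t - of_int j) / \<epsilon>) * (- d / \<epsilon>)) (at t within {0..1})"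
        by (rule DERIV_chain'[OF _ der]) (use \<epsilon> in \<open>auto intro!: derivative_eq_intros\<close>)
      from DERIV_cmult[OF this, of "- \<epsilon> / d"]
      show "((\<lambda>t. - \<epsilon> / d * \<tau> 1 ((- d * t - of_int j) / \<epsilon>)) has_vector_derivative g (- d * t - of_int j)) (at t within {0..1})"
        using \<epsilon> d by (simp add: has_real_derivative_iff_has_vector_derivative g_def)
    qed simp
    then have "((\<lambda>t. periodize K g (- d * t)) has_integral
      (\<Sum>j\<in>{- int K..int K}. - \<epsilon> / d * \<tau> 1 ((- d * 1 - of_int j) / \<epsilon>) - (- \<epsilon> / d * \<tau> 1 ((- d * 0 - of_int j) / \<epsilon>)))) {0..1}"
      unfolding periodize_def by (intro has_integral_sum) auto
    moreover have "(\<Sum>j\<in>{- int K..int K}. \<tau> 1 ((- d * 1 - of_int j) / \<epsilon>)) = \<tau> 1 0"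
    proof -
      have "(\<Sum>j\<in>{- int K..int K}. \<tau> 1 ((- d * 1 - of_int j) / \<epsilon>)) = (\<Sum>j\<in>{- int (q * k)}. \<tau> 1 ((- d * 1 - of_int j) / \<epsilon>))"
      proof (rule sum.mono_neutral_right)
        have "q * k \<le> K" unfolding K_def by simp
        then have "int (q * k) \<le> int K" "0 \<le> int (q * k)" by (simp_all only: of_nat_le_iff of_nat_0_le_iff)
        then have "- int K \<le> - int (q * k)" "- int (q * k) \<le> int K" by linarith+
        then show "{- int (q * k)} \<subseteq> {- int K..int K}" by (simp only: insert_subset empty_subsetI atLeastAtMost_iff simp_thms)
        show "\<forall>j\<in>{- int K..int K} - {- int (q * k)}. \<tau> 1 ((- d * 1 - of_int j) / \<epsilon>) = 0"
        proof
          fix j assume "j \<in> {- int K..int K} - {- int (q * k)}"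
          then have "j \<le> - int (q * k) - 1 \<or> j \<ge> - int (q * k) + 1" by auto
          then have "real_of_int j \<le> - d - 1 \<or> real_of_int j \<ge> - d + 1"
            unfolding d_def of_nat_mult[symmetric] by linarith
          then show "\<tau> 1 ((- d * 1 - of_int j) / \<epsilon>) = 0" by (intro supp\<epsilon>) auto
        qed
      qed simp
      then show ?thesis by (simp add: d_def)
    qed
    moreover have "(\<Sum>j\<in>{- int K..int K}. \<tau> 1 ((- d * 0 - of_int j) / \<epsilon>)) = \<tau> 1 0"
    proof -
      have "(\<Sum>j\<in>{- int K..int K}. \<tau> 1 ((- d * 0 - of_int j) / \<epsilon>)) = (\<Sum>j\<in>{0}. \<tau> 1 ((- d * 0 - of_int j) / \<epsilon>))"
      proof (rule sum.mono_neutral_right)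
        show "\<forall>j\<in>{- int K..int K} - {0}. \<tau> 1 ((- d * 0 - of_int j) / \<epsilon>) = 0"
        proof
          fix j assume "j \<in> {- int K..int K} - {0}"
          then have "j \<le> - 1 \<or> j \<ge> 1" by auto
          then have "real_of_int j \<le> - 1 \<or> real_of_int j \<ge> 1" by linarith
          then show "\<tau> 1 ((- d * 0 - of_int j) / \<epsilon>) = 0" by (intro supp\<epsilon>) auto
        qed
      qed auto
      then show ?thesis by simp
    qed
    ultimately show "((\<lambda>t. periodize K g (- (real q * real k) * t)) has_integral 0) {0..1}"
      by (simp only: sum_subtractf sum_distrib_left[symmetric] d_def[symmetric] diff_self)
  qed
  have "complex_of_real (\<integral>x. periodize K g (real q * cyc_poly k x) \<partial>cube {1..<k}) = 0"
    using has_mean_unique[OF m1] m2 unfolding same int0 by simp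
  then have "(\<integral>x. periodize K g (real q * cyc_poly k x) \<partial>cube {1..<k}) = 0" by simp
  moreover have "(\<integral>x. periodize K g (real q * cyc_poly k x) \<partial>cube {1..<k})
     = (\<Sum>j\<in>{- int K..int K}. \<integral>x. g (real q * cyc_poly k x - of_int j) \<partial>cube {1..<k})"
    unfolding periodize_def g_def
    by (intro Bochner_Integration.integral_sum integrable_cube[where B = B] cyc_poly_cube_measurable cont) (use bd in auto)
  moreover have "\<dots> = (\<Sum>j\<in>{0..int K}. \<integral>x. g (real q * cyc_poly k x - of_int j) \<partial>cube {1..<k})"
  proof (rule sum.mono_neutral_right)
    show "\<forall>j\<in>{- int K..int K} - {0..int K}. (\<integral>x. g (real q * cyc_poly k x - of_int j) \<partial>cube {1..<k}) = 0"
    proof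
      fix j assume "j \<in> {- int K..int K} - {0..int K}"
      then have j: "real_of_int j \<le> -1" by auto
      have "(\<integral>x. g (real q * cyc_poly k x - of_int j) \<partial>cube {1..<k}) = (\<integral>x. 0 \<partial>cube {1..<k})"
      proof (rule Bochner_Integration.integral_cong)
        fix x assume x: "x \<in> space (cube {1..<k})"
        have "cyc_poly k x \<in> {0..b}" by (rule P01) (rule cube_coordinate[OF x])
        then have "0 \<le> real q * cyc_poly k x" by simp
        then show "g (real q * cyc_poly k x - of_int j) = 0" using j by (intro g0) linarith
      qed simp
      then show "(\<integral>x. g (real q * cyc_poly k x - of_int j) \<partial>cube {1..<k}) = 0" by simp
    qed
  qed auto
  moreover have "{0..int K} = insert 0 {1..int K}" by auto
  ultimately have zero: "(\<integral>x. \<tau> 0 (real q * cyc_poly k x / \<epsilon>) \<partial>cube {1..<k})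
     + (\<Sum>j\<in>{1..int K}. \<integral>x. \<tau> 0 ((real q * cyc_poly k x - of_int j) / \<epsilon>) \<partial>cube {1..<k}) = 0"
    by (simp add: g_def)
  have "- (\<Sum>j\<in>{1..int K}. \<bar>\<integral>x. \<tau> 0 ((real q * cyc_poly k x - of_int j) / \<epsilon>) \<partial>cube {1..<k}\<bar>)
     \<le> (\<Sum>j\<in>{1..int K}. \<integral>x. \<tau> 0 ((real q * cyc_poly k x - of_int j) / \<epsilon>) \<partial>cube {1..<k})"
    unfolding sum_negf[symmetric] by (intro sum_mono) auto
  then show False using zero less by linarith
qed

text \<open>All terms are integer multiples of \<open>1 / D\<close>, so the interval from \<open>1 / (3
  D)\<close> to \<open>2 / (3 D)\<close> is never visited.\<close>

lemma not_equidistributed_if_rational_base: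
  assumes "\<alpha> \<in> \<rat>" "k \<ge> 1"
  shows "\<not> uniformly_distributed (\<lambda>n. frac (floor_pow (\<alpha> * real n) k))"
proof
  assume ud: "uniformly_distributed (\<lambda>n. frac (floor_pow (\<alpha> * real n) k))"
  obtain p D :: int where D: "D > 0" "\<alpha> = of_int p / of_int D"
    using assms(1) by (blast elim: Rats_cases')
  have D1: "real_of_int D \<ge> 1" using D by linarith
  let ?a = "1 / (3 * real_of_int D)" and ?b = "2 / (3 * real_of_int D)"
  have none: "frac (floor_pow (\<alpha> * real n) k) \<notin> {?a..<?b}" for n
  proof
    obtain i where k: "k = Suc i" using assms(2) by (cases k) auto
    let ?y = "floor_pow (\<alpha> * real n) k"
    assume "frac ?y \<in> {?a..<?b}"
    then have "1 / 3 \<le> of_int D * frac ?y" "of_int D * frac ?y < 2 / 3"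
      using D1 by (auto simp: field_simps)
    moreover define z where "z = p * int n * \<lfloor>floor_pow (\<alpha> * real n) i\<rfloor> - D * \<lfloor>?y\<rfloor>"
    have "of_int D * frac ?y = of_int z"
    proof -
      have "of_int D * ?y = of_int (p * int n * \<lfloor>floor_pow (\<alpha> * real n) i\<rfloor>)"
        using D by (simp add: k)
      then show ?thesis by (simp add: z_def frac_def right_diff_distrib)
    qed
    ultimately have "1 / 3 \<le> real_of_int z" "real_of_int z < 2 / 3" by simp_all
    then have "0 < z" "z < 1" by linarith+
    then show False by simp
  qed
  have "(\<lambda>N. real (card {n \<in> {1..N}. frac (floor_pow (\<alpha> * real n) k) \<in> {?a..<?b}}) / real N) \<longlonglongrightarrow> ?b - ?a"
  proof -
    have "0 \<le> ?a \<and> ?a < ?b \<and> ?b \<le> 1" using D1 by (simp add: field_simps)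
    then show ?thesis using ud unfolding uniformly_distributed_def by blast
  qed
  then have "(\<lambda>N::nat. 0 :: real) \<longlonglongrightarrow> ?b - ?a" by (simp only: none simp_thms) simp
  then have "?b - ?a = 0" by (simp add: LIMSEQ_const_iff)
  then show False using D1 by simp
qed

theorem mainTheorem4:
  fixes k :: nat and \<alpha> :: real
  assumes "k \<ge> 1"
    and "\<forall>j\<in>{2..k - 1}. \<alpha> ^ j \<notin> \<rat>"
  shows "uniformly_distributed (\<lambda>n. frac (floor_pow (\<alpha> * real n) k)) \<longleftrightarrow> \<alpha> ^ k \<notin> \<rat>"
proof (cases "\<alpha> \<in> \<rat>")
  case True
  then show ?thesis
    using not_equidistributed_if_rational_base[OF True assms(1)] by simp
next
  case False
  have irr: "\<alpha> ^ j \<notin> \<rat>" if "1 \<le> j" "j < k" for j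
  proof (cases "j = 1")
    case True
    then show ?thesis using False by simp
  next
    case False
    then have "j \<in> {2..k - 1}" using that by auto
    then show ?thesis using assms(2) by blast
  qed
  show ?thesis
  proof
    assume ud: "uniformly_distributed (\<lambda>n. frac (floor_pow (\<alpha> * real n) k))"
    show "\<alpha> ^ k \<notin> \<rat>"
    proof
      assume "\<alpha> ^ k \<in> \<rat>"
      from not_equidistributed_if_rational[OF irr assms(1) this] ud show False by blast
    qed
  next
    assume irrk: "\<alpha> ^ k \<notin> \<rat>"
    show "uniformly_distributed (\<lambda>n. frac (floor_pow (\<alpha> * real n) k))"
    proof (rule equidistributed_if_irrational[OF assms(1)])
      fix j assume "1 \<le> j" "j \<le> k"
      then show "\<alpha> ^ j \<notin> \<rat>" using irr[of j] irrk by (cases "j = k") auto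
    qed
  qed
qed

end
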